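(* Let $0<a<1$ and, for each $n\geq 2$, let $\sigma,\pi$ be two independent random permutations chosen uniformly from $\partial B(an)\subset\mathcal S_n$. Let $p=I$ be the identity. Then: 1. If $a<1-\log2$, there is $0<\delta=\delta(a)<\infty$ such that $$E\,(\sigma|\pi)_p\le\delta(\log n)^2 .$$ Moreover, with probability tending to $1$ as $n\to\infty$, there is a geodesic between $\sigma$ and $\pi$ that comes within distance at most $\delta(\log n)^2$ of $p$. 2. If $a>1-\log2$, there is $\delta=\delta(a)>0$ such that $$E\,(\sigma|\pi)_p\sim\delta n\qquad(n\to\infty).$$ Moreover, there is $0<\delta'<\infty$ such that, with probability tending to $1$ as $n\to\infty$, no geodesic between $\sigma$ and $\pi$ approaches $p$ closer than $\delta' n$.
   Context: $\mathcal S_n$ is the set of permutations of $\{1,\dots,n\}$, viewed as the Cayley graph $G_n$ with respect to the set of all transpositions, with graph distance $d(x,y)=|x-y|$. $\partial B(an)=\{\sigma\in\mathcal S_n:d(I,\sigma)=\lfloor an\rfloor\}$. The Gromov inner product is defined by $2(x|y)_p=|x-p|+|y-p|-|x-y|$. A geodesic between two permutations is a shortest path in $G_n$ between them; its distance to $p$ is the minimal distance from $p$ to a vertex on it. $\log$ is the natural logarithm. $a_n\sim b_n$ means $a_n/b_n\to1$. *)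

theory Defs
  imports
    "HOL-Probability.Probability_Mass_Function"
    "HOL-Combinatorics.Permutations"
    "HOL-Library.Landau_Symbols"
    "Graph_Theory.Graph_Theory"
begin

text \<open>
  The Cayley graph of the symmetric group with respect to all transpositions, as a symmetric
  digraph. Since the generating set is closed under conjugation, multiplying by generators on the
  left or on the right gives the same arcs.
\<close>

definition transposition_graph :: "nat \<Rightarrow> (nat \<Rightarrow> nat) pair_pre_digraph" where
  "transposition_graph n =
     \<lparr> pverts = {x. x permutes {1..n}},
       parcs = {(x, y). x permutes {1..n} \<and>
         (\<exists>i\<in>{1..n}. \<exists>j\<in>{1..n}. i \<noteq> j \<and> y = x \<circ> Transposition.transpose i j)} \<rparr>"

abbreviation walk_between ::
    "nat \<Rightarrow> (nat \<Rightarrow> nat) \<Rightarrow> ((nat \<Rightarrow> nat) \<times> (nat \<Rightarrow> nat)) awalk \<Rightarrow> (nat \<Rightarrow> nat) \<Rightarrow> bool" where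
  "walk_between n \<equiv> pre_digraph.awalk (with_proj (transposition_graph n))"

text \<open>
  The constant \<^const>\<open>wf_digraph.\<mu>\<close> is the infimum of the costs of all walks between two vertices;
  with unit weights this is the graph distance. The graph is connected, so on its vertices the
  infimum is a minimum and the conversion to a real loses nothing; see the lemma
  \<open>graph_dist_attained\<close> below.
\<close>

definition graph_dist :: "nat \<Rightarrow> (nat \<Rightarrow> nat) \<Rightarrow> (nat \<Rightarrow> nat) \<Rightarrow> real" where
  "graph_dist n x y =
     real_of_ereal (wf_digraph.\<mu> (with_proj (transposition_graph n)) (\<lambda>_. 1) x y)"

definition gromov_product :: "nat \<Rightarrow> (nat \<Rightarrow> nat) \<Rightarrow> (nat \<Rightarrow> nat) \<Rightarrow> (nat \<Rightarrow> nat) \<Rightarrow> real" where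
  "gromov_product n p x y = (graph_dist n x p + graph_dist n y p - graph_dist n x y) / 2"

definition sphere :: "real \<Rightarrow> nat \<Rightarrow> (nat \<Rightarrow> nat) set" where
  "sphere a n = {x. x permutes {1..n} \<and> graph_dist n id x = of_int \<lfloor>a * real n\<rfloor>}"

definition geodesic ::
    "nat \<Rightarrow> (nat \<Rightarrow> nat) \<Rightarrow> ((nat \<Rightarrow> nat) \<times> (nat \<Rightarrow> nat)) awalk \<Rightarrow> (nat \<Rightarrow> nat) \<Rightarrow> bool" where
  "geodesic n x g y \<longleftrightarrow> is_arg_min length (\<lambda>q. walk_between n x q y) g"

text \<open>
  A walk is a list of arcs, so its starting vertex \<open>x\<close> has to be supplied separately.
\<close>

definition dist_to_walk ::
    "nat \<Rightarrow> (nat \<Rightarrow> nat) \<Rightarrow> (nat \<Rightarrow> nat) \<Rightarrow> ((nat \<Rightarrow> nat) \<times> (nat \<Rightarrow> nat)) awalk \<Rightarrow> real" where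
  "dist_to_walk n p x g = Min (graph_dist n p `
     set (pre_digraph.awalk_verts (with_proj (transposition_graph n)) x g))"

text \<open>
  Independence is the product law. For \<open>0 \<le> a < 1\<close> the sphere is finite and nonempty (the graph
  has diameter \<open>n - 1\<close> for \<open>n > 0\<close>), so \<^const>\<open>pmf_of_set\<close> is not applied to a degenerate set.
\<close>

definition two_uniform :: "real \<Rightarrow> nat \<Rightarrow> ((nat \<Rightarrow> nat) \<times> (nat \<Rightarrow> nat)) pmf" where
  "two_uniform a n = pair_pmf (pmf_of_set (sphere a n)) (pmf_of_set (sphere a n))"

lemma permutes_comp_transpose:
  assumes "x permutes S" "i \<in> S" "j \<in> S"
  shows "x \<circ> Transposition.transpose i j permutes S"
  using assms by (intro permutes_compose permutes_swap_id)

lemma transposition_graph: "pair_graph (transposition_graph n)"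
proof
  let ?G = "transposition_graph n"
  have fin: "finite {x. x permutes {1..n}}"
    by (simp add: finite_permutations)
  have arcs_verts: "fst e \<in> pverts ?G" "snd e \<in> pverts ?G" if "e \<in> parcs ?G" for e
    using that
    by (auto simp: transposition_graph_def intro!: permutes_comp_transpose)
  then show "fst e \<in> pverts ?G" "snd e \<in> pverts ?G" if "e \<in> parcs ?G" for e
    using that by blast+
  show "finite (pverts ?G)"
    using fin by (simp add: transposition_graph_def)
  have "parcs ?G \<subseteq> pverts ?G \<times> pverts ?G"
    using arcs_verts by force
  then show "finite (parcs ?G)"
    by (rule finite_subset) (use fin in \<open>simp add: transposition_graph_def\<close>)
  show "fst e \<noteq> snd e" if e: "e \<in> parcs ?G" for e
  proof
    assume "fst e = snd e"
    obtain x i j where x: "x permutes {1..n}" "i \<noteq> j"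
      and "e = (x, x \<circ> Transposition.transpose i j)"
      using e by (auto simp: transposition_graph_def)
    with \<open>fst e = snd e\<close> have "x = x \<circ> Transposition.transpose i j"
      by simp
    then have "x i = x j"
      by (metis comp_apply transpose_apply_first)
    with x show False
      by (metis injD permutes_inj)
  qed
  show "symmetric ?G"
    unfolding symmetric_def
  proof (rule symI)
    fix x y assume "x \<rightarrow>\<^bsub>with_proj ?G\<^esub> y"
    then obtain i j where *: "x permutes {1..n}" "i \<in> {1..n}" "j \<in> {1..n}" "i \<noteq> j"
      "y = x \<circ> Transposition.transpose i j"
      by (auto simp: transposition_graph_def)
    have "y permutes {1..n}"
      using * by (auto intro!: permutes_comp_transpose)
    moreover have "x = y \<circ> Transposition.transpose i j"
      using * by (simp add: comp_assoc)
    ultimately show "y \<rightarrow>\<^bsub>with_proj ?G\<^esub> x"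
      unfolding with_proj_simps transposition_graph_def pair_pre_digraph.simps
      using *(2-4) by blast
  qed
qed

lemma reachable_from_id:
  assumes "x permutes {1..n}"
  shows "id \<rightarrow>\<^sup>*\<^bsub>with_proj (transposition_graph n)\<^esub> x"
proof -
  interpret pair_graph "transposition_graph n" by (rule transposition_graph)
  have "finite {1..n}" by simp
  moreover have "x permutes {1..n}" by fact
  ultimately show ?thesis
  proof (induction rule: permutes_rev_induct)
    case id
    show ?case
      by (intro reachable_refl) (simp add: transposition_graph_def permutes_def)
  next
    case (swap a b p)
    show ?case
    proof (cases "a = b")
      case False
      have "p \<rightarrow>\<^bsub>with_proj (transposition_graph n)\<^esub> (p \<circ> Transposition.transpose a b)"
        unfolding with_proj_simps transposition_graph_def pair_pre_digraph.simps
        using False swap.hyps by blast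
      with swap.IH show ?thesis by (rule wf_digraph.reachable_adj_trans[OF wf_digraph])
    qed (use swap.IH in simp)
  qed
qed

lemma graph_dist_attained:
  assumes "x permutes {1..n}" "y permutes {1..n}"
  shows "\<exists>g. geodesic n x g y" and "geodesic n x g y \<Longrightarrow> graph_dist n x y = real (length g)"
proof -
  interpret pair_graph "transposition_graph n" by (rule transposition_graph)
  have "x \<rightarrow>\<^sup>*\<^bsub>with_proj (transposition_graph n)\<^esub> id"
    using sym_arcs reachable_from_id[OF assms(1)] by (rule symmetric_reachable)
  also have "id \<rightarrow>\<^sup>*\<^bsub>with_proj (transposition_graph n)\<^esub> y"
    using assms(2) by (rule reachable_from_id)
  finally obtain q where q: "awalk x q y"
    unfolding reachable_awalk ..
  have "is_arg_min length (\<lambda>q. awalk x q y) (arg_min length (\<lambda>q. awalk x q y))"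
    using q by (rule is_arg_min_arg_min_nat)
  then show "\<exists>g. geodesic n x g y"
    unfolding geodesic_def ..
  have cost: "awalk_cost (\<lambda>_. 1) q = real (length q)" for q
    by (induction q) simp_all
  assume "geodesic n x g y"
  then have g: "awalk x g y" "length g \<le> length q" if "awalk x q y" for q
    using that unfolding geodesic_def is_arg_min_def by (simp_all add: not_less)
  have "\<mu> (\<lambda>_. 1) x y = ereal (real (length g))"
    unfolding \<mu>_def cost
  proof (rule antisym)
    show "(INF p\<in>{p. awalk x p y}. ereal (real (length p))) \<le> ereal (real (length g))"
      using g(1)[OF q] by (intro INF_lower) simp
    show "ereal (real (length g)) \<le> (INF p\<in>{p. awalk x p y}. ereal (real (length p)))"
      using g(2) by (intro INF_greatest) simp
  qed
  then show "graph_dist n x y = real (length g)"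
    by (simp add: graph_dist_def)
qed

end

theory Submission
  imports Defs "HOL-Combinatorics.Stirling" "HOL-Real_Asymp.Real_Asymp"
begin

text \<open>
  Multiplying a permutation by a transposition joins two of its cycles or splits one, so the distance
  between \<open>x\<close> and \<open>y\<close> is \<open>n\<close> minus the number of cycles of \<open>inv x \<circ> y\<close>. If \<open>\<sigma>\<close> and \<open>\<pi>\<close> lie on the
  sphere, both have \<open>m = n - \<lfloor>an\<rfloor>\<close> cycles and twice their Gromov product is \<open>n - 2m\<close> plus the number of
  cycles of \<open>inv \<sigma> \<circ> \<pi>\<close>. Everything is about counting the cycles of this product.

  Consider the bipartite graph whose nodes are the cycles of \<open>\<sigma>\<close> and the cycles of \<open>\<pi>\<close> and whose edges
  are the points, a point joining the two cycles that contain it. If the component of a point is a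
  tree with \<open>k\<close> edges, it has \<open>k + 1\<close> nodes, and removing leaves one at a time shows that
  \<open>inv \<sigma> \<circ> \<pi>\<close> acts on its points as one cycle (\<open>tree_single_cycle\<close>). Hence on such a component
  the distances of \<open>\<sigma>\<close> and \<open>\<pi>\<close> from the identity add up to their distance from each other. The
  permutation that is the identity on the tree components and \<open>\<sigma>\<close> elsewhere is therefore on a
  geodesic from \<open>\<sigma>\<close> to \<open>\<pi>\<close>, and its distance from the identity is at most the number of points in
  other components (\<open>geodesic_midpoint\<close>).

  The number of permutations with \<open>m\<close> cycles is a Stirling number. Let \<open>t\<close> be the solution of
  \<open>t ln (1 + 1/t) = 1 - a\<close>. Log-concavity and a comparison of means show that passing from \<open>m\<close> to
  \<open>m + 1\<close> cycles multiplies the count by about \<open>1/(tn)\<close> (\<open>stirling_ratio_limit\<close>). Splitting a cycle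
  that contains two prescribed points is injective, so requiring two points to share a cycle costs a
  factor \<open>1/(tn)\<close>, uniformly over many such requirements. A point has \<open>n\<close> candidates for a
  neighbour, so a path of length \<open>L\<close> in the bipartite graph has expected number about
  \<open>(1/t) ^ L\<close> per starting point. This exploration is critical at \<open>t = 1\<close>, that is at \<open>a = 1 - ln 2\<close>.

  For \<open>t > 1\<close> a point outside the tree components starts a path that closes up after some number
  \<open>L\<close> of steps. Closing up costs a factor of order \<open>L/n\<close>, so the expected number of such points is
  bounded by a convergent series. This bounds the expected Gromov product by a constant, and
  Markov's inequality gives the geodesic.

  For \<open>t < 1\<close> the tree components are counted by size. The first and second moments of the number of
  tree components with \<open>k\<close> points are explicit in Stirling numbers, so this number divided by \<open>n\<close>
  concentrates at a limit \<open>\<tau>\<^sub>k(t)\<close> of the form \<open>w\<^sub>k t (t/(1+t)\<^sup>2)\<^sup>k\<close>, for every \<open>t\<close>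
  (\<open>tree_sum_deviation\<close>). Since paths of bounded length rarely close up, short cycles of
  \<open>inv \<sigma> \<circ> \<pi>\<close> are tree components up to an error \<open>o(n)\<close>, while long cycles are few. So the expected
  number of cycles divided by \<open>n\<close> tends to the sum of all \<open>\<tau>\<^sub>k(t)\<close> (\<open>cycle_fraction_limit\<close>). This
  sum is evaluated by duality: \<open>t/(1+t)\<^sup>2\<close> is invariant under \<open>t \<mapsto> 1/t\<close>, and for \<open>1/t > 1\<close> the
  sum is known because there the Gromov product is \<open>o(n)\<close>. The result evaluates the limit of the
  Gromov product divided by \<open>n\<close> as \<open>(1 - t\<^sup>2 + 2 t ln t)/2\<close>, which is positive for \<open>0 < t < 1\<close>.
\<close>

section \<open>Cycles of permutations and transpositions\<close>

abbreviation swap :: "'a \<Rightarrow> 'a \<Rightarrow> 'a \<Rightarrow> 'a" where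
  "swap \<equiv> Transposition.transpose"

text \<open>
  An equivalence closure, so symmetry is built in and inverse permutations have the same relation. For
  permutations of finite sets it coincides with lying in the same orbit.
\<close>

definition cyc_rel :: "('a \<Rightarrow> 'a) \<Rightarrow> 'a \<Rightarrow> 'a \<Rightarrow> bool" where
  "cyc_rel f = equivclp (\<lambda>x y. f x = y)"

lemma cyc_rel_refl [simp]: "cyc_rel f x x"
  by (simp add: cyc_rel_def)

lemma cyc_rel_sym: "cyc_rel f x y \<Longrightarrow> cyc_rel f y x"
  by (simp add: cyc_rel_def equivclp_sym)

lemma cyc_rel_trans: "cyc_rel f x y \<Longrightarrow> cyc_rel f y z \<Longrightarrow> cyc_rel f x z"
  unfolding cyc_rel_def by (rule equivclp_trans)

lemma cyc_rel_step [simp]: "cyc_rel f x (f x)"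
  by (simp add: cyc_rel_def r_into_equivclp)

lemma cyc_rel_least:
  assumes "cyc_rel f x y" "\<And>x. Q x x" "\<And>x y. Q x y \<Longrightarrow> Q y x"
    "\<And>x y z. Q x y \<Longrightarrow> Q y z \<Longrightarrow> Q x z" "\<And>x. Q x (f x)"
  shows "Q x y"
  using assms(1) unfolding cyc_rel_def
  by (induction rule: equivclp_induct) (use assms(2-) in blast)+

lemma cyc_rel_invariant:
  assumes "cyc_rel f x y" "\<And>z. f z \<in> D \<longleftrightarrow> z \<in> D"
  shows "x \<in> D \<longleftrightarrow> y \<in> D"
  using assms(1) by (rule cyc_rel_least) (use assms(2) in auto)

lemma cyc_rel_inv:
  assumes "bij f"
  shows "cyc_rel (inv f) = cyc_rel f"
proof -
  have "(\<lambda>x y. inv f x = y) = conversep (\<lambda>x y. f x = y)"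
    using assms by (auto simp: fun_eq_iff bij_is_surj surj_f_inv_f bij_is_inj)
  then show ?thesis unfolding cyc_rel_def by simp
qed

lemma cyc_rel_eq_orbit:
  assumes "permutation f"
  shows "cyc_rel f x y \<longleftrightarrow> y \<in> orbit f x"
proof
  assume "cyc_rel f x y"
  then show "y \<in> orbit f x"
  proof (rule cyc_rel_least)
    show "x \<in> orbit f x" for x by (rule permutation_self_in_orbit[OF assms])
    show "x \<in> orbit f y" if "y \<in> orbit f x" for x y
      using orbit_swap[OF permutation_self_in_orbit[OF assms] that] .
    show "z \<in> orbit f x" if "y \<in> orbit f x" "z \<in> orbit f y" for x y z
      using orbit_trans that by metis
    show "f x \<in> orbit f x" for x by (rule orbit.base)
  qed
next
  assume "y \<in> orbit f x"
  then show "cyc_rel f x y"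
    by induction (auto intro: cyc_rel_trans)
qed

lemma cyc_rel_funpow:
  assumes "permutation f" "cyc_rel f x y"
  obtains k where "0 < k" "(f ^^ k) x = y" "\<And>j. 0 < j \<Longrightarrow> j < k \<Longrightarrow> (f ^^ j) x \<noteq> y"
proof -
  have "\<exists>k. 0 < k \<and> (f ^^ k) x = y"
    using assms by (auto simp: cyc_rel_eq_orbit orbit_altdef)
  from LeastI_ex[OF this] not_less_Least[of _ "\<lambda>k. 0 < k \<and> (f ^^ k) x = y"]
  show ?thesis by (intro that[of "LEAST k. 0 < k \<and> (f ^^ k) x = y"]) auto
qed

text \<open>
  Under \<open>f \<circ> (a b)\<close> the point \<open>a\<close> moves to \<open>f b\<close> and then follows the old cycle of \<open>b\<close>, which avoids
  \<open>a\<close>, until it arrives at \<open>b\<close>.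
\<close>

lemma transpose_joins_cycles:
  assumes f: "permutation f" and ab: "\<not> cyc_rel f a b"
  shows "cyc_rel (f \<circ> swap a b) a b"
proof -
  let ?g = "f \<circ> swap a b"
  obtain k where k: "0 < k" "(f ^^ k) b = b" "\<And>j. 0 < j \<Longrightarrow> j < k \<Longrightarrow> (f ^^ j) b \<noteq> b"
    using cyc_rel_funpow[OF f cyc_rel_refl, of b] by metis
  have *: "cyc_rel f b ((f ^^ j) b)" for j
    by (induction j) (auto intro: cyc_rel_trans)
  have "cyc_rel ?g a ((f ^^ j) b)" if "0 < j" "j \<le> k" for j
    using that
  proof (induction j)
    case (Suc j)
    show ?case
    proof (cases "j = 0")
      case True
      moreover have "?g a = (f ^^ Suc 0) b" by simp
      ultimately show ?thesis using cyc_rel_step[of ?g a] by metis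
    next
      case False
      then have "(f ^^ j) b \<noteq> b" "(f ^^ j) b \<noteq> a"
        using k(3)[of j] Suc.prems *[of j] ab cyc_rel_sym[of f b a] by auto
      then have "?g ((f ^^ j) b) = (f ^^ Suc j) b" by simp
      then show ?thesis
        using Suc False cyc_rel_step[of ?g "(f ^^ j) b"] cyc_rel_trans
        by (metis Suc_leD bot_nat_0.not_eq_extremum)
    qed
  qed simp
  from this[of k] show ?thesis using k by simp
qed

text \<open>
  If \<open>k\<close> is the first time at which \<open>f\<close> carries \<open>a\<close> to \<open>b\<close>, then the points visited at the times
  \<open>1, \<dots>, k\<close> form a closed set of \<open>f \<circ> (a b)\<close>: the new permutation sends \<open>b\<close> back to \<open>f a\<close>. This set
  contains \<open>b\<close> but not \<open>a\<close>.
\<close>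

lemma transpose_splits_cycle:
  assumes f: "permutation f" and ab: "cyc_rel f a b" "a \<noteq> b"
  shows "\<not> cyc_rel (f \<circ> swap a b) a b"
proof -
  let ?g = "f \<circ> swap a b"
  obtain k where k: "0 < k" "(f ^^ k) a = b" "\<And>j. 0 < j \<Longrightarrow> j < k \<Longrightarrow> (f ^^ j) a \<noteq> b"
    using cyc_rel_funpow[OF f ab(1)] by metis
  have na: "(f ^^ j) a \<noteq> a" if "0 < j" "j \<le> k" for j
  proof
    assume j: "(f ^^ j) a = a"
    show False
    proof (cases "j = k")
      case False
      have "(f ^^ (k - j)) ((f ^^ j) a) = b"
        using k(2) that by (metis comp_apply funpow_add le_add_diff_inverse2)
      then show False using j k(3)[of "k - j"] False that by auto
    qed (use k(2) ab(2) j in auto)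
  qed
  define D where "D = (\<lambda>j. (f ^^ j) a) ` {1..k}"
  have "?g z \<in> D" if "z \<in> D" for z
  proof -
    obtain j where "j \<in> {1..k}" "z = (f ^^ j) a"
      using \<open>z \<in> D\<close> unfolding D_def by (rule imageE) 
    then have j: "0 < j" "j \<le> k" "z = (f ^^ j) a" by simp_all
    show ?thesis
    proof (cases "j = k")
      case True
      then have "?g z = (f ^^ 1) a" using j k by simp
      then show ?thesis using k(1) unfolding D_def by (intro image_eqI[of _ _ 1]) auto
    next
      case False
      then have "z \<noteq> b" "z \<noteq> a" using na j k by auto
      then have "?g z = (f ^^ Suc j) a" using j by simp
      then show ?thesis using j False unfolding D_def by (intro image_eqI[of _ _ "Suc j"]) auto
    qed
  qed
  then have sub: "?g ` D \<subseteq> D" by blast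
  have inj: "inj ?g"
    using f by (intro inj_compose) (auto simp: permutation_bijective bij_is_inj)
  have "finite D" by (simp add: D_def)
  then have "?g ` D = D"
    using sub inj by (metis endo_inj_surj inj_on_subset subset_UNIV)
  then have "?g z \<in> D \<longleftrightarrow> z \<in> D" for z
    using inj by (metis inj_image_mem_iff)
  moreover have "b \<in> D"
    unfolding D_def by (rule image_eqI[of _ _ k]) (use k in auto)
  moreover have "a \<notin> D"
  proof
    assume "a \<in> D"
    then obtain j where "j \<in> {1..k}" "a = (f ^^ j) a" unfolding D_def by (rule imageE)
    then show False using na[of j] by simp
  qed
  ultimately show ?thesis using cyc_rel_invariant[of ?g a b D] by blast
qed

lemma permutation_comp_transpose: "permutation f \<Longrightarrow> permutation (f \<circ> swap a b)"
  by (simp add: permutation_compose permutation_swap_id)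

lemma comp_transpose_twice: "f \<circ> swap a b \<circ> swap a b = f"
  by (simp add: comp_assoc)

lemma cyc_rel_join:
  assumes f: "permutation f" and ab: "\<not> cyc_rel f a b"
  shows "cyc_rel (f \<circ> swap a b) x y \<longleftrightarrow>
    cyc_rel f x y \<or> (cyc_rel f x a \<or> cyc_rel f x b) \<and> (cyc_rel f y a \<or> cyc_rel f y b)"
    (is "cyc_rel ?g x y \<longleftrightarrow> ?Q x y")
proof
  assume "cyc_rel ?g x y"
  then show "?Q x y"
  proof (rule cyc_rel_least)
    show "?Q x (?g x)" for x
      by (cases "x = a"; cases "x = b") (auto intro: cyc_rel_sym)
  qed (meson cyc_rel_refl cyc_rel_sym cyc_rel_trans)+
next
  have g: "cyc_rel ?g a b" by (rule transpose_joins_cycles[OF assms])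
  have sub: "cyc_rel ?g x y" if "cyc_rel f x y" for x y
    using that
  proof (rule cyc_rel_least)
    show "cyc_rel ?g x (f x)" for x
    proof -
      consider "x = a" | "x = b" | "x \<noteq> a" "x \<noteq> b" by blast
      then show ?thesis
      proof cases
        case 1
        then show ?thesis using cyc_rel_trans[OF g] cyc_rel_step[of ?g b] by simp
      next
        case 2
        then show ?thesis using cyc_rel_trans[OF cyc_rel_sym[OF g]] cyc_rel_step[of ?g a] by simp
      next
        case 3
        then show ?thesis using cyc_rel_step[of ?g x] by simp
      qed
    qed
  qed (blast intro: cyc_rel_refl cyc_rel_sym cyc_rel_trans)+
  assume "?Q x y"
  then show "cyc_rel ?g x y"
    by (meson g sub cyc_rel_sym cyc_rel_trans)
qed

lemma cyc_rel_split:
  assumes f: "permutation f" and ab: "cyc_rel f a b" "a \<noteq> b"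
  shows "cyc_rel f x y \<longleftrightarrow> cyc_rel (f \<circ> swap a b) x y \<or>
    (cyc_rel (f \<circ> swap a b) x a \<or> cyc_rel (f \<circ> swap a b) x b) \<and>
    (cyc_rel (f \<circ> swap a b) y a \<or> cyc_rel (f \<circ> swap a b) y b)"
  using cyc_rel_join[OF permutation_comp_transpose[OF f] transpose_splits_cycle[OF assms]]
  unfolding comp_transpose_twice .

definition cycle_of :: "('a \<Rightarrow> 'a) \<Rightarrow> 'a \<Rightarrow> 'a set" where
  "cycle_of f x = {y. cyc_rel f x y}"

text \<open>
  Fixed points count as cycles. The number of cycles is taken relative to a set, because cycles will be
  counted component by component.
\<close>

definition ncyc :: "'a set \<Rightarrow> ('a \<Rightarrow> 'a) \<Rightarrow> nat" where
  "ncyc A f = card (cycle_of f ` A)"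

lemma cycle_of_eq_iff: "cycle_of f x = cycle_of f y \<longleftrightarrow> cyc_rel f x y"
  unfolding cycle_of_def
  by (metis (no_types, lifting) Collect_cong cyc_rel_refl cyc_rel_sym cyc_rel_trans mem_Collect_eq)

lemma card_image_cong:
  assumes "\<And>x y. x \<in> A \<Longrightarrow> y \<in> A \<Longrightarrow> F x = F y \<longleftrightarrow> G x = G y"
  shows "card (F ` A) = card (G ` A)"
proof -
  let ?h = "\<lambda>C. G (inv_into A F C)"
  have h: "?h (F x) = G x" if "x \<in> A" for x
    using assms[of "inv_into A F (F x)" x] that by (simp add: inv_into_into f_inv_into_f)
  then have "G ` A = ?h ` (F ` A)"
    unfolding image_image by (intro image_cong) simp_all
  moreover have "inj_on ?h (F ` A)"
  proof (rule inj_onI)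
    fix C D assume "C \<in> F ` A" "D \<in> F ` A" and eq: "?h C = ?h D"
    then obtain x y where xy: "x \<in> A" "y \<in> A" "C = F x" "D = F y" by blast
    with eq have "G x = G y" using h[of x] h[of y] by simp
    then show "C = D" using assms[of x y] xy by simp
  qed
  ultimately show ?thesis by (simp add: card_image)
qed

lemma ncyc_cong:
  assumes "\<And>x y. x \<in> A \<Longrightarrow> y \<in> A \<Longrightarrow> cyc_rel f x y \<longleftrightarrow> cyc_rel g x y"
  shows "ncyc A f = ncyc A g"
  unfolding ncyc_def using assms by (intro card_image_cong) (simp add: cycle_of_eq_iff)

lemma ncyc_pos: "finite A \<Longrightarrow> A \<noteq> {} \<Longrightarrow> 0 < ncyc A f"
  unfolding ncyc_def by (simp add: card_gt_0_iff)

lemma ncyc_join: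
  assumes f: "permutation f" and ab: "\<not> cyc_rel f a b" "a \<in> A" "b \<in> A" and A: "finite A"
  shows "ncyc A f = Suc (ncyc A (f \<circ> swap a b))"
proof -
  let ?g = "f \<circ> swap a b"
  define h where "h C = (if C = cycle_of f a \<or> C = cycle_of f b then cycle_of ?g a else C)" for C
  have sub: "cyc_rel f x y \<Longrightarrow> cyc_rel ?g x y" for x y
    using cyc_rel_join[OF f ab(1), of x y] by simp
  have g: "cyc_rel ?g a b" by (rule transpose_joins_cycles[OF f ab(1)])
  have h: "h (cycle_of f x) = cycle_of ?g x" for x
  proof (cases "cyc_rel f x a \<or> cyc_rel f x b")
    case True
    then have "cyc_rel ?g x a" using cyc_rel_join[OF f ab(1), of x a] by auto
    with True show ?thesis
      unfolding h_def cycle_of_eq_iff by (metis cycle_of_eq_iff)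
  next
    case False
    then have "cyc_rel ?g x y \<longleftrightarrow> cyc_rel f x y" for y
      using cyc_rel_join[OF f ab(1), of x y] by auto
    then have "cycle_of ?g x = cycle_of f x" unfolding cycle_of_def by blast
    with False show ?thesis by (simp add: h_def cycle_of_eq_iff)
  qed
  have img: "cycle_of ?g ` A = h ` (cycle_of f ` A - {cycle_of f b})"
  proof
    show "cycle_of ?g ` A \<subseteq> h ` (cycle_of f ` A - {cycle_of f b})"
    proof
      fix C assume "C \<in> cycle_of ?g ` A"
      then obtain x where x: "x \<in> A" "C = cycle_of ?g x" by auto
      show "C \<in> h ` (cycle_of f ` A - {cycle_of f b})"
      proof (cases "cyc_rel f x b")
        case True
        then have "C = h (cycle_of f a)"
          unfolding h x(2) cycle_of_eq_iff using sub[OF True] cyc_rel_sym[OF g] cyc_rel_trans[of ?g x b a] by blast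
        moreover have "cycle_of f a \<in> cycle_of f ` A - {cycle_of f b}"
          using ab by (auto simp: cycle_of_eq_iff intro!: imageI)
        ultimately show ?thesis by blast
      next
        case False
        then have "cycle_of f x \<in> cycle_of f ` A - {cycle_of f b}"
          using x by (auto simp: cycle_of_eq_iff intro!: imageI)
        then show ?thesis unfolding x(2) h[symmetric] by blast
      qed
    qed
    show "h ` (cycle_of f ` A - {cycle_of f b}) \<subseteq> cycle_of ?g ` A"
    proof
      fix C assume "C \<in> h ` (cycle_of f ` A - {cycle_of f b})"
      then obtain x where "x \<in> A" "C = h (cycle_of f x)" by blast
      then show "C \<in> cycle_of ?g ` A" unfolding h by blast
    qed
  qed
  have "inj_on h (cycle_of f ` A - {cycle_of f b})"
  proof (rule inj_onI)
    fix C D assume "C \<in> cycle_of f ` A - {cycle_of f b}" "D \<in> cycle_of f ` A - {cycle_of f b}"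
      and eq: "h C = h D"
    then obtain x y where "C = cycle_of f x" "D = cycle_of f y"
      "cycle_of f x \<noteq> cycle_of f b" "cycle_of f y \<noteq> cycle_of f b" by blast
    then have xy: "C = cycle_of f x" "D = cycle_of f y" "\<not> cyc_rel f x b" "\<not> cyc_rel f y b"
      by (simp_all add: cycle_of_eq_iff)
    have "cyc_rel ?g x y" using eq unfolding xy h cycle_of_eq_iff .
    with cyc_rel_join[OF f ab(1), of x y] xy(3,4)
    have "cyc_rel f x y \<or> cyc_rel f x a \<and> cyc_rel f y a" by blast
    then have "cyc_rel f x y" using cyc_rel_sym[of f y a] cyc_rel_trans[of f x a y] by blast
    then show "C = D" unfolding xy cycle_of_eq_iff .
  qed
  then have "ncyc A ?g = card (cycle_of f ` A - {cycle_of f b})"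
    unfolding ncyc_def img by (rule card_image)
  also have "\<dots> = ncyc A f - 1"
    using ab A by (simp add: ncyc_def)
  finally show ?thesis
    using ncyc_pos[OF A, of f] ab(3) by (cases "ncyc A f") auto
qed

lemma ncyc_split:
  assumes f: "permutation f" and ab: "cyc_rel f a b" "a \<noteq> b" "a \<in> A" "b \<in> A" and A: "finite A"
  shows "ncyc A (f \<circ> swap a b) = Suc (ncyc A f)"
  using ncyc_join[OF permutation_comp_transpose[OF f] transpose_splits_cycle[OF f ab(1,2)] ab(3,4) A]
  unfolding comp_transpose_twice .

lemma cyc_rel_fixed:
  assumes "f i = i" "cyc_rel f i x" "inj f"
  shows "x = i"
proof -
  have "f z \<in> {i} \<longleftrightarrow> z \<in> {i}" for z using assms(1,3) by (metis injD singleton_iff)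
  from cyc_rel_invariant[OF assms(2) this] show ?thesis by simp
qed

lemma ncyc_id [simp]: "finite A \<Longrightarrow> ncyc A id = card A"
  unfolding ncyc_def
  by (intro card_image inj_onI) (auto simp: cycle_of_eq_iff dest: cyc_rel_fixed[of id, simplified])

lemma ncyc_le_card: "finite A \<Longrightarrow> ncyc A f \<le> card A"
  unfolding ncyc_def by (rule card_image_le)

text \<open>
  Removes the point \<open>z\<close> from its cycle: \<open>z\<close> becomes a fixed point and its predecessor is sent to the
  successor of \<open>z\<close>.
\<close>

definition skip :: "'a \<Rightarrow> ('a \<Rightarrow> 'a) \<Rightarrow> 'a \<Rightarrow> 'a" where
  "skip z f = f \<circ> swap z (inv f z)"

lemma
  assumes "bij f"
  shows skip_self [simp]: "skip z f z = z"
    and skip_other: "x \<noteq> z \<Longrightarrow> f x \<noteq> z \<Longrightarrow> skip z f x = f x"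
    and skip_pred: "x \<noteq> z \<Longrightarrow> f x = z \<Longrightarrow> skip z f x = f z"
proof -
  show "skip z f z = z" using assms by (simp add: skip_def bij_is_surj surj_f_inv_f)
  show "x \<noteq> z \<Longrightarrow> f x \<noteq> z \<Longrightarrow> skip z f x = f x"
    using assms by (auto simp: skip_def Transposition.transpose_def bij_is_surj surj_f_inv_f)
  show "x \<noteq> z \<Longrightarrow> f x = z \<Longrightarrow> skip z f x = f z"
    using assms by (auto simp: skip_def Transposition.transpose_def bij_is_inj inv_f_f)
qed

lemma skip_permutation: "permutation f \<Longrightarrow> permutation (skip z f)"
  unfolding skip_def by (rule permutation_comp_transpose)

lemma cyc_rel_skip:
  assumes f: "permutation f" and "x \<noteq> z" "y \<noteq> z"
  shows "cyc_rel (skip z f) x y \<longleftrightarrow> cyc_rel f x y"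
proof (cases "inv f z = z")
  case True
  then show ?thesis by (simp add: skip_def)
next
  case False
  have b: "bij f" using f by (simp add: permutation_bijective)
  let ?w = "inv f z"
  have "f ?w = z" using b by (simp add: bij_is_surj surj_f_inv_f)
  then have "cyc_rel f z ?w" using cyc_rel_step[of f ?w] cyc_rel_sym by metis
  note * = cyc_rel_split[OF f this False[symmetric], of x y, folded skip_def]
  have "inj (skip z f)" using skip_permutation[OF f] by (simp add: permutation_bijective bij_is_inj)
  then have "\<not> cyc_rel (skip z f) x z" "\<not> cyc_rel (skip z f) y z"
    using cyc_rel_fixed[of "skip z f" z] skip_self[OF b, of z] assms(2,3) cyc_rel_sym by metis+
  with * show ?thesis by (meson cyc_rel_sym cyc_rel_trans)
qed

section \<open>Stirling numbers at a fixed density of cycles\<close>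

lemma stirling_pos: "0 < k \<Longrightarrow> k \<le> n \<Longrightarrow> 0 < stirling n k"
proof (induction n arbitrary: k)
  case (Suc n)
  then show ?case by (cases k; cases "k = Suc n") auto
qed simp

text \<open>
  Log-concavity in the form of decreasing ratios. The cross terms in the induction step compare
  \<open>stirling n i * stirling n (l + 2)\<close> with \<open>stirling n (i + 2) * stirling n l\<close>, which follows by two
  applications of the induction hypothesis.
\<close>

lemma stirling_log_concave:
  "j \<le> k \<Longrightarrow> stirling n j * stirling n (Suc k) \<le> stirling n (Suc j) * stirling n k"
proof (induction n arbitrary: j k)
  case 0
  then show ?case by simp
next
  case (Suc n)
  show ?case
  proof (cases j)
    case 0
    then show ?thesis by simp
  next
    case (Suc i)
    then obtain l where k: "k = Suc l" and il: "i \<le> l" using Suc.prems by (cases k) auto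
    let ?a = "stirling n"
    have 1: "?a (Suc i) * ?a (Suc (Suc l)) \<le> ?a (Suc (Suc i)) * ?a (Suc l)"
      using Suc.IH[of "Suc i" "Suc l"] il by simp
    have 2: "?a i * ?a (Suc l) \<le> ?a (Suc i) * ?a l"
      using Suc.IH[of i l] il by simp
    have 3: "?a i * ?a (Suc (Suc l)) \<le> ?a (Suc (Suc i)) * ?a l"
    proof (cases "i = l")
      case False
      have "?a i * ?a (Suc (Suc l)) \<le> ?a (Suc i) * ?a (Suc l)"
        using Suc.IH[of i "Suc l"] il by simp
      also have "\<dots> \<le> ?a (Suc (Suc i)) * ?a l"
        using Suc.IH[of "Suc i" l] il False by simp
      finally show ?thesis .
    qed simp
    have "n * n * (?a (Suc i) * ?a (Suc (Suc l))) + n * (?a i * ?a (Suc (Suc l))) + ?a i * ?a (Suc l)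
      \<le> n * n * (?a (Suc (Suc i)) * ?a (Suc l)) + n * (?a (Suc (Suc i)) * ?a l) + ?a (Suc i) * ?a l"
      by (intro add_mono mult_left_mono 1 2 3) auto
    then show ?thesis
      unfolding Suc k stirling.simps by (simp add: algebra_simps)
  qed
qed

text \<open>
  The mean number of cycles of a random permutation whose law gives each permutation a weight
  \<open>\<theta>\<close> to the power of its number of cycles; see \<open>stirling_weighted_sum\<close>.
\<close>

definition ewens_mean :: "nat \<Rightarrow> real \<Rightarrow> real" where
  "ewens_mean n \<theta> = (\<Sum>i<n. \<theta> / (\<theta> + real i))"

lemma stirling_weighted_sum:
  assumes "0 < \<theta>"
  shows "(\<Sum>k\<le>n. real k * (real (stirling n k) * \<theta> ^ k))
    = ewens_mean n \<theta> * (\<Sum>k\<le>n. real (stirling n k) * \<theta> ^ k)"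
proof (induction n)
  case 0
  then show ?case by (simp add: ewens_mean_def)
next
  case (Suc n)
  let ?P = "\<lambda>n. \<Sum>k\<le>n. real (stirling n k) * \<theta> ^ k"
  let ?M = "\<lambda>n. \<Sum>k\<le>n. real k * (real (stirling n k) * \<theta> ^ k)"
  have rec: "(\<Sum>k\<le>Suc n. g k * (real (stirling (Suc n) k) * \<theta> ^ k))
    = real n * (\<Sum>k\<le>n. g k * (real (stirling n k) * \<theta> ^ k))
      + \<theta> * (\<Sum>k\<le>n. g (Suc k) * (real (stirling n k) * \<theta> ^ k))" for g :: "nat \<Rightarrow> real"
  proof -
    have "(\<Sum>k\<le>Suc n. g k * (real (stirling (Suc n) k) * \<theta> ^ k))
      = (\<Sum>k\<le>n. g (Suc k) * (real (stirling (Suc n) (Suc k)) * \<theta> ^ Suc k))"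
      by (subst sum.atMost_Suc_shift) simp
    also have "\<dots> = real n * (\<Sum>k\<le>n. g (Suc k) * (real (stirling n (Suc k)) * \<theta> ^ Suc k))
      + \<theta> * (\<Sum>k\<le>n. g (Suc k) * (real (stirling n k) * \<theta> ^ k))"
      by (simp add: sum.distrib sum_distrib_left algebra_simps)
    also have "real n * (\<Sum>k\<le>n. g (Suc k) * (real (stirling n (Suc k)) * \<theta> ^ Suc k))
      = real n * (\<Sum>k\<le>Suc n. g k * (real (stirling n k) * \<theta> ^ k))"
      by (subst sum.atMost_Suc_shift) (cases n; simp)
    finally show ?thesis by simp
  qed
  have P: "?P (Suc n) = (\<theta> + real n) * ?P n"
    using rec[of "\<lambda>_. 1"] by (simp add: algebra_simps)
  have "?M (Suc n) = real n * ?M n + \<theta> * (\<Sum>k\<le>n. real (Suc k) * (real (stirling n k) * \<theta> ^ k))"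
    by (rule rec)
  also have "(\<Sum>k\<le>n. real (Suc k) * (real (stirling n k) * \<theta> ^ k)) = ?M n + ?P n"
    by (simp add: sum.distrib[symmetric] algebra_simps)
  also have "real n * ?M n + \<theta> * (?M n + ?P n) = ((\<theta> + real n) * ewens_mean n \<theta> + \<theta>) * ?P n"
    unfolding Suc by (simp add: algebra_simps)
  also have "(\<theta> + real n) * ewens_mean n \<theta> + \<theta> = (\<theta> + real n) * ewens_mean (Suc n) \<theta>"
    using assms by (simp add: ewens_mean_def field_simps)
  finally show ?case unfolding P by simp
qed

lemma sum_le_sum_subset:
  fixes f :: "'a \<Rightarrow> real"
  assumes "finite A" "B \<subseteq> A" "\<And>x. x \<in> A - B \<Longrightarrow> f x \<le> 0"
  shows "sum f A \<le> sum f B"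
  using sum.subset_diff[OF assms(2,1), of f] sum_nonpos[of "A - B" f] assms(3) by simp

lemma geometric_moment_le:
  fixes x :: real
  assumes "0 \<le> x" "x < 1"
  shows "(\<Sum>j\<le>N. real j * x ^ j) \<le> 1 / (1 - x)\<^sup>2"
proof -
  have s: "(\<lambda>j. real (Suc j) * x ^ j) sums (1 / (1 - x)\<^sup>2)"
    using geometric_deriv_sums[of x] assms by simp
  have "(\<Sum>j\<le>N. real j * x ^ j) \<le> (\<Sum>j\<le>N. real (Suc j) * x ^ j)"
    using assms by (intro sum_mono mult_right_mono) auto
  also have "\<dots> \<le> (\<Sum>j. real (Suc j) * x ^ j)"
    using assms sums_summable[OF s] by (intro sum_le_suminf) auto
  finally show ?thesis using sums_unique[OF s] by simp
qed

text \<open>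
  If the weights \<open>stirling n k * \<theta> ^ k\<close> do not decrease from \<open>m\<close> to \<open>m + 1\<close>, then by log-concavity they
  do not decrease anywhere before. With the larger parameter \<open>\<kappa> * \<theta>\<close> they then grow at least
  geometrically up to \<open>m + 1\<close>, so the mean cannot be far below \<open>m + 1\<close>. Read backwards, a mean well
  below \<open>m\<close> bounds the ratio of consecutive Stirling numbers from above.
\<close>

lemma mean_ge_of_ratio:
  assumes \<theta>: "0 < \<theta>" and \<kappa>: "1 < \<kappa>" and m: "Suc m \<le> n"
    and ratio: "real (stirling n m) \<le> real (stirling n (Suc m)) * \<theta>"
  shows "real (Suc m) - 1 / (1 - 1 / \<kappa>)\<^sup>2 \<le> ewens_mean n (\<kappa> * \<theta>)"
proof -
  define \<phi> where "\<phi> = \<kappa> * \<theta>"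
  define a where "a k = real (stirling n k)" for k
  define w where "w k = a k * \<phi> ^ k" for k
  define x where "x = 1 / \<kappa>"
  define C where "C = 1 / (1 - x)\<^sup>2"
  have \<phi>: "0 < \<phi>" using \<theta> \<kappa> by (simp add: \<phi>_def)
  have x: "0 < x" "x < 1" using \<kappa> by (auto simp: x_def)
  have w0: "0 \<le> w k" for k using \<phi> by (simp add: w_def a_def)
  have am: "0 < a (Suc m)" using m stirling_pos[of "Suc m" n] by (simp add: a_def)
  have step: "a k \<le> a (Suc k) * \<theta>" if "k \<le> m" for k
  proof -
    have "a k * a (Suc m) \<le> a (Suc k) * a m"
      using stirling_log_concave[OF that, of n] unfolding a_def of_nat_mult[symmetric] of_nat_le_iff .
    also have "\<dots> \<le> a (Suc k) * (a (Suc m) * \<theta>)"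
      using ratio by (intro mult_left_mono) (auto simp: a_def)
    finally have "a k * a (Suc m) \<le> (a (Suc k) * \<theta>) * a (Suc m)" by (simp add: algebra_simps)
    then show ?thesis using am by (rule mult_right_le_imp_le)
  qed
  have decay: "w (Suc m - j) \<le> x ^ j * w (Suc m)" if "j \<le> Suc m" for j
    using that
  proof (induction j)
    case (Suc j)
    define k where "k = m - j"
    have k: "Suc m - j = Suc k" "Suc m - Suc j = k" "k \<le> m" using Suc.prems by (auto simp: k_def)
    have "w k \<le> a (Suc k) * \<theta> * \<phi> ^ k"
      unfolding w_def using step[OF k(3)] \<phi> by (intro mult_right_mono) auto
    also have "\<dots> = x * w (Suc k)" using \<kappa> by (simp add: w_def x_def \<phi>_def)
    also have "\<dots> \<le> x * (x ^ j * w (Suc m))"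
      using Suc x by (intro mult_left_mono) (auto simp: k)
    finally show ?case by (metis k(2) power_Suc mult.assoc)
  qed simp
  have "(\<Sum>k\<le>n. (real (Suc m) - real k) * w k) \<le> (\<Sum>k\<le>Suc m. (real (Suc m) - real k) * w k)"
    using m w0 by (intro sum_le_sum_subset) (auto intro!: mult_nonpos_nonneg)
  also have "\<dots> = (\<Sum>j\<le>Suc m. real j * w (Suc m - j))"
    by (intro sum.reindex_bij_witness[of _ "\<lambda>j. Suc m - j" "\<lambda>k. Suc m - k"]) (auto simp: of_nat_diff)
  also have "\<dots> \<le> (\<Sum>j\<le>Suc m. real j * (x ^ j * w (Suc m)))"
    using decay by (intro sum_mono mult_left_mono) auto
  also have "\<dots> = (\<Sum>j\<le>Suc m. real j * x ^ j) * w (Suc m)"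
    unfolding sum_distrib_right mult.assoc ..
  also have "\<dots> \<le> C * w (Suc m)"
    unfolding C_def using x w0 by (intro mult_right_mono geometric_moment_le) auto
  also have "\<dots> \<le> C * (\<Sum>k\<le>n. w k)"
    using m w0 member_le_sum[of "Suc m" "{..n}" w] by (intro mult_left_mono) (auto simp: C_def)
  finally have "real (Suc m) * (\<Sum>k\<le>n. w k) - (\<Sum>k\<le>n. real k * w k) \<le> C * (\<Sum>k\<le>n. w k)"
    by (simp add: sum_subtractf left_diff_distrib sum_distrib_left)
  moreover have "(\<Sum>k\<le>n. real k * w k) = ewens_mean n \<phi> * (\<Sum>k\<le>n. w k)"
    unfolding w_def a_def by (rule stirling_weighted_sum[OF \<phi>])
  ultimately have "(real (Suc m) - C) * (\<Sum>k\<le>n. w k) \<le> ewens_mean n \<phi> * (\<Sum>k\<le>n. w k)"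
    by (simp add: algebra_simps)
  moreover have "0 < (\<Sum>k\<le>n. w k)"
    using am \<phi> m w0 by (intro sum_pos2[of _ "Suc m"]) (auto simp: w_def)
  ultimately show ?thesis
    unfolding C_def x_def \<phi>_def by (rule mult_right_le_imp_le)
qed

text \<open>
  The mirror image of \<open>mean_ge_of_ratio\<close>: with the smaller parameter the weights decay geometrically
  after \<open>m\<close>.
\<close>

lemma mean_le_of_ratio:
  assumes \<theta>: "0 < \<theta>" and \<kappa>: "1 < \<kappa>" and m: "0 < m" "m \<le> n"
    and ratio: "real (stirling n (Suc m)) * \<theta> \<le> real (stirling n m)"
  shows "ewens_mean n (\<theta> / \<kappa>) \<le> real m + 1 / (1 - 1 / \<kappa>)\<^sup>2"
proof -
  define \<phi> where "\<phi> = \<theta> / \<kappa>"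
  define a where "a k = real (stirling n k)" for k
  define w where "w k = a k * \<phi> ^ k" for k
  define x where "x = 1 / \<kappa>"
  define C where "C = 1 / (1 - x)\<^sup>2"
  have \<phi>: "0 < \<phi>" using \<theta> \<kappa> by (simp add: \<phi>_def)
  have x: "0 < x" "x < 1" using \<kappa> by (auto simp: x_def)
  have w0: "0 \<le> w k" for k using \<phi> by (simp add: w_def a_def)
  have am: "0 < a m" using m stirling_pos[of m n] by (simp add: a_def)
  have step: "a (Suc k) * \<theta> \<le> a k" if "m \<le> k" for k
  proof -
    have "a m * a (Suc k) \<le> a (Suc m) * a k"
      using stirling_log_concave[OF that, of n] unfolding a_def of_nat_mult[symmetric] of_nat_le_iff .
    then have "(a m * a (Suc k)) * \<theta> \<le> (a (Suc m) * a k) * \<theta>"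
      using \<theta> by (intro mult_right_mono) auto
    also have "\<dots> = (a (Suc m) * \<theta>) * a k" by simp
    also have "\<dots> \<le> a m * a k"
      using ratio by (intro mult_right_mono) (auto simp: a_def)
    finally have "a m * (a (Suc k) * \<theta>) \<le> a m * a k" by (simp add: algebra_simps)
    then show ?thesis using am by (rule mult_left_le_imp_le)
  qed
  have decay: "w (m + j) \<le> x ^ j * w m" for j
  proof (induction j)
    case (Suc j)
    have "w (m + Suc j) = a (Suc (m + j)) * \<theta> * \<phi> ^ (m + j) * x"
      by (simp add: w_def x_def \<phi>_def)
    also have "\<dots> \<le> a (m + j) * \<phi> ^ (m + j) * x"
      using step[of "m + j"] \<phi> x by (intro mult_right_mono) auto
    also have "\<dots> = x * w (m + j)" by (simp add: w_def)
    also have "\<dots> \<le> x * (x ^ j * w m)"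
      using Suc x by (intro mult_left_mono) auto
    finally show ?case by simp
  qed simp
  have "(\<Sum>k\<le>n. (real k - real m) * w k) \<le> (\<Sum>k\<in>{m..n}. (real k - real m) * w k)"
    using m w0 by (intro sum_le_sum_subset) (auto intro!: mult_nonpos_nonneg)
  also have "\<dots> = (\<Sum>j\<le>n - m. real j * w (m + j))"
    using m by (intro sum.reindex_bij_witness[of _ "\<lambda>j. m + j" "\<lambda>k. k - m"]) (auto simp: of_nat_diff)
  also have "\<dots> \<le> (\<Sum>j\<le>n - m. real j * (x ^ j * w m))"
    using decay by (intro sum_mono mult_left_mono) auto
  also have "\<dots> = (\<Sum>j\<le>n - m. real j * x ^ j) * w m"
    by (simp add: sum_distrib_right mult.assoc)
  also have "\<dots> \<le> C * w m"
    unfolding C_def using x w0 by (intro mult_right_mono geometric_moment_le) auto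
  also have "\<dots> \<le> C * (\<Sum>k\<le>n. w k)"
    using m w0 member_le_sum[of m "{..n}" w] by (intro mult_left_mono) (auto simp: C_def)
  finally have "(\<Sum>k\<le>n. real k * w k) - real m * (\<Sum>k\<le>n. w k) \<le> C * (\<Sum>k\<le>n. w k)"
    by (simp add: sum_subtractf left_diff_distrib sum_distrib_left)
  moreover have "(\<Sum>k\<le>n. real k * w k) = ewens_mean n \<phi> * (\<Sum>k\<le>n. w k)"
    unfolding w_def a_def by (rule stirling_weighted_sum[OF \<phi>])
  ultimately have "ewens_mean n \<phi> * (\<Sum>k\<le>n. w k) \<le> (real m + C) * (\<Sum>k\<le>n. w k)"
    by (simp add: algebra_simps)
  moreover have "0 < (\<Sum>k\<le>n. w k)"
    using am \<phi> m w0 by (intro sum_pos2[of _ m]) (auto simp: w_def)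
  ultimately show ?thesis
    unfolding C_def x_def \<phi>_def by (rule mult_right_le_imp_le)
qed

text \<open>
  The limiting number of cycles per point under the weights with \<open>\<theta> = t n\<close>: the integral of \<open>t / (t + x)\<close>
  for \<open>x\<close> between \<open>0\<close> and \<open>1\<close>.
\<close>

definition cycle_density :: "real \<Rightarrow> real" where
  "cycle_density t = t * ln (1 + 1 / t)"

text \<open>
  Comparison of the sum with a logarithm, which telescopes.
\<close>

lemma ewens_mean_bounds:
  assumes t: "0 < t" and n: "0 < n"
  shows "real n * cycle_density t \<le> ewens_mean n (t * real n)"
    and "ewens_mean n (t * real n) \<le> real n * cycle_density t + 1"
proof -
  define \<theta> where "\<theta> = t * real n"
  have \<theta>: "0 < \<theta>" using t n by (simp add: \<theta>_def)
  have tel: "(\<Sum>i<k. ln ((\<theta> + real (Suc i)) / (\<theta> + real i))) = ln ((\<theta> + real k) / \<theta>)" for k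
  proof (induction k)
    case (Suc k)
    have "\<theta> + real k > 0" using \<theta> by simp
    then show ?case using Suc \<theta> by (simp add: ln_div add_pos_nonneg)
  qed (use \<theta> in simp)
  have hn: "\<theta> * ln ((\<theta> + real n) / \<theta>) = real n * cycle_density t"
  proof -
    have "(\<theta> + real n) / \<theta> = 1 + 1 / t" using t n by (simp add: \<theta>_def field_simps)
    then show ?thesis by (simp add: \<theta>_def cycle_density_def)
  qed
  have "ln ((\<theta> + real (Suc i)) / (\<theta> + real i)) \<le> 1 / (\<theta> + real i)" for i
  proof -
    have p: "\<theta> + real i > 0" using \<theta> by simp
    then have "(\<theta> + real (Suc i)) / (\<theta> + real i) = 1 + 1 / (\<theta> + real i)" by (simp add: field_simps)
    then show ?thesis using p ln_add_one_self_le_self[of "1 / (\<theta> + real i)"] by simp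
  qed
  then have "(\<Sum>i<n. ln ((\<theta> + real (Suc i)) / (\<theta> + real i))) \<le> (\<Sum>i<n. 1 / (\<theta> + real i))"
    by (intro sum_mono)
  then have "\<theta> * ln ((\<theta> + real n) / \<theta>) \<le> \<theta> * (\<Sum>i<n. 1 / (\<theta> + real i))"
    using \<theta> unfolding tel by (intro mult_left_mono) auto
  then show "real n * cycle_density t \<le> ewens_mean n (t * real n)"
    unfolding hn ewens_mean_def \<theta>_def[symmetric] by (simp add: sum_distrib_left)
  have "1 / (\<theta> + real (Suc i)) \<le> ln ((\<theta> + real (Suc i)) / (\<theta> + real i))" for i
  proof -
    have p: "\<theta> + real i > 0" using \<theta> by simp
    have "ln ((\<theta> + real i) / (\<theta> + real (Suc i))) \<le> (\<theta> + real i) / (\<theta> + real (Suc i)) - 1"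
      using p by (intro ln_le_minus_one) auto
    also have "\<dots> = - (1 / (\<theta> + real (Suc i)))" using p by (simp add: field_simps)
    finally show ?thesis using p by (simp add: ln_div)
  qed
  then have le: "(\<Sum>i<n - 1. 1 / (\<theta> + real (Suc i))) \<le> ln ((\<theta> + real (n - 1)) / \<theta>)"
    unfolding tel[symmetric] by (intro sum_mono)
  have "ewens_mean n \<theta> = \<theta> * (\<Sum>i<n. 1 / (\<theta> + real i))"
    by (simp add: ewens_mean_def sum_distrib_left)
  also have "(\<Sum>i<n. 1 / (\<theta> + real i)) = 1 / \<theta> + (\<Sum>i<n - 1. 1 / (\<theta> + real (Suc i)))"
    using n sum.lessThan_Suc_shift[of "\<lambda>i. 1 / (\<theta> + real i)" "n - 1"] by simp
  also have "\<theta> * \<dots> = 1 + \<theta> * (\<Sum>i<n - 1. 1 / (\<theta> + real (Suc i)))"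
    using \<theta> by (simp add: distrib_left)
  also have "\<dots> \<le> 1 + \<theta> * ln ((\<theta> + real n) / \<theta>)"
  proof -
    have "ln ((\<theta> + real (n - 1)) / \<theta>) \<le> ln ((\<theta> + real n) / \<theta>)"
      using \<theta> by (intro iffD2[OF ln_le_cancel_iff] divide_right_mono divide_pos_pos add_pos_nonneg) auto
    then show ?thesis using \<theta> by (intro add_left_mono mult_left_mono order_trans[OF le]) auto
  qed
  finally show "ewens_mean n (t * real n) \<le> real n * cycle_density t + 1"
    unfolding hn \<theta>_def[symmetric] by simp
qed

lemma cycle_density_strict_mono:
  assumes "0 < s" "s < t"
  shows "cycle_density s < cycle_density t"
proof (rule DERIV_pos_imp_increasing[OF assms(2)])
  fix x assume x: "s \<le> x" "x \<le> t"
  then have x0: "0 < x" using assms by simp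
  have "(cycle_density has_real_derivative ln (1 + 1 / x) - 1 / (1 + x)) (at x)"
    unfolding cycle_density_def[abs_def]
    using x0 add_pos_pos[OF x0 mult_pos_pos[OF x0 x0]]
    by (auto intro!: derivative_eq_intros simp: field_simps power2_eq_square)
  moreover have "0 < ln (1 + 1 / x) - 1 / (1 + x)"
  proof -
    have "x / (1 + x) \<noteq> 1" "0 < x / (1 + x)" using x0 by auto
    then have "ln (x / (1 + x)) < x / (1 + x) - 1"
      using ln_eq_minus_one[of "x / (1 + x)"] ln_le_minus_one[of "x / (1 + x)"] by fastforce
    moreover have "ln (1 + 1 / x) = - ln (x / (1 + x))"
    proof -
      have "1 + 1 / x = inverse (x / (1 + x))" using x0 by (simp add: field_simps)
      then show ?thesis by (metis ln_inverse)
    qed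
    moreover have "x / (1 + x) - 1 = - (1 / (1 + x))" using x0 by (simp add: field_simps)
    ultimately show ?thesis by linarith
  qed
  ultimately show "\<exists>y. (cycle_density has_real_derivative y) (at x) \<and> 0 < y" by blast
qed

lemma cycle_density_one: "cycle_density 1 = ln 2"
  by (simp add: cycle_density_def)

lemma cycle_density_surj:
  assumes "0 < b" "b < 1"
  obtains t where "0 < t" "cycle_density t = b"
proof -
  have "(cycle_density \<longlongrightarrow> 0) (at_right 0)" unfolding cycle_density_def[abs_def] by real_asymp
  then have "\<forall>\<^sub>F x in at_right 0. cycle_density x < b"
    using assms by (simp add: order_tendstoD)
  moreover have "\<forall>\<^sub>F x in at_right 0. (0::real) < x" by (simp add: eventually_at_filter)
  ultimately have "\<forall>\<^sub>F x in at_right (0::real). 0 < x \<and> cycle_density x < b"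
    by eventually_elim simp
  then obtain l where l: "0 < l" "cycle_density l < b"
    using eventually_happens'[OF trivial_limit_at_right_real] by blast
  have "(cycle_density \<longlongrightarrow> 1) at_top" unfolding cycle_density_def[abs_def] by real_asymp
  then have "\<forall>\<^sub>F x in at_top. b < cycle_density x \<and> l < x"
    using assms by (intro eventually_conj order_tendstoD eventually_gt_at_top)
  then obtain u where u: "b < cycle_density u" "l < u"
    using eventually_happens'[OF trivial_limit_at_top_linorder] by blast
  have "\<exists>x\<ge>l. x \<le> u \<and> cycle_density x = b"
    using l u by (intro IVT) (auto simp: cycle_density_def add_nonneg_eq_0_iff intro!: continuous_intros)
  then obtain x where "l \<le> x" "cycle_density x = b" by blast
  then show ?thesis using l by (intro that[of x]) auto
qed

lemma cycle_density_range:
  assumes "0 < t"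
  shows "0 < cycle_density t" "cycle_density t < 1"
proof -
  show "0 < cycle_density t"
    using assms unfolding cycle_density_def by (intro mult_pos_pos ln_gt_zero) auto
  have x: "0 < 1 / t" using assms by simp
  have "ln (1 + 1 / t) \<noteq> 1 / t"
  proof
    assume "ln (1 + 1 / t) = 1 / t"
    then have "1 + 1 / t = 1" using x add_pos_pos[OF zero_less_one x] by (intro ln_eq_minus_one) simp_all
    then show False using x by simp
  qed
  then have "ln (1 + 1 / t) < 1 / t"
    using ln_add_one_self_le_self[of "1 / t"] x by linarith
  then show "cycle_density t < 1" using assms by (simp add: cycle_density_def field_simps)
qed

text \<open>
  Sizes \<open>N\<close> and numbers of cycles \<open>M\<close> whose quotient tends to \<open>cycle_density t\<close>. General sequences are
  admitted so that the size and the number of cycles can be lowered by one without leaving the regime.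
\<close>

definition regime :: "real \<Rightarrow> (nat \<Rightarrow> nat) \<Rightarrow> (nat \<Rightarrow> nat) \<Rightarrow> bool" where
  "regime t N M \<longleftrightarrow> 0 < t \<and> filterlim N at_top sequentially \<and>
     (\<lambda>i. real (M i) / real (N i)) \<longlonglongrightarrow> cycle_density t"

lemma regime_eventually:
  assumes "regime t N M"
  shows "\<forall>\<^sub>F i in sequentially. K < M i \<and> M i + K < N i"
proof -
  note r = assms[unfolded regime_def]
  have N: "filterlim (\<lambda>i. real (N i)) at_top sequentially"
    using r filterlim_compose[OF filterlim_real_sequentially] by blast
  define b where "b = cycle_density t"
  have b: "0 < b" "b < 1" using r cycle_density_range by (auto simp: b_def)
  have "\<forall>\<^sub>F i in sequentially. b / 2 < real (M i) / real (N i)"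
    using r b by (intro order_tendstoD) (auto simp: b_def)
  moreover have "\<forall>\<^sub>F i in sequentially. real (M i) / real (N i) < (1 + b) / 2"
    using r b by (intro order_tendstoD) (auto simp: b_def)
  moreover have "\<forall>\<^sub>F i in sequentially. real K / (b / 2) < real (N i)"
    using N by (simp add: filterlim_at_top_dense)
  moreover have "\<forall>\<^sub>F i in sequentially. real K / ((1 - b) / 2) < real (N i)"
    using N by (simp add: filterlim_at_top_dense)
  ultimately show ?thesis
  proof eventually_elim
    case (elim i)
    have N0: "0 < real (N i)" using elim(3) b by (meson divide_nonneg_pos half_gt_zero le_less_trans of_nat_0_le_iff)
    have "real K < real (N i) * (b / 2)" using elim(3) b by (simp add: field_simps)
    also have "\<dots> < real (M i)" using elim(1) N0 by (simp add: field_simps)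
    finally have 1: "K < M i" by simp
    have "real K < real (N i) * ((1 - b) / 2)" using elim(4) b by (simp add: field_simps)
    moreover have "real (M i) < real (N i) * ((1 + b) / 2)" using elim(2) N0 by (simp add: field_simps)
    moreover have "real (N i) * ((1 - b) / 2) + real (N i) * ((1 + b) / 2) = real (N i)"
      by (simp add: field_simps)
    ultimately have "real (M i + K) < real (N i)" unfolding of_nat_add by linarith
    then show ?case using 1 by linarith
  qed
qed

lemma regime_linear_eventually:
  assumes "regime t N M" "cycle_density t < b"
  shows "\<forall>\<^sub>F i in sequentially. real (M i) + C < real (N i) * b"
proof -
  note r = assms(1)[unfolded regime_def]
  have N: "filterlim (\<lambda>i. real (N i)) at_top sequentially"
    using r filterlim_compose[OF filterlim_real_sequentially] by blast
  define b' where "b' = (cycle_density t + b) / 2"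
  have b': "cycle_density t < b'" "b' < b" using assms(2) by (auto simp: b'_def)
  have "\<forall>\<^sub>F i in sequentially. real (M i) / real (N i) < b'"
    using r b' by (intro order_tendstoD) auto
  moreover have "\<forall>\<^sub>F i in sequentially. C / (b - b') < real (N i)"
    using N by (simp add: filterlim_at_top_dense)
  moreover have "\<forall>\<^sub>F i in sequentially. 0 < real (N i)"
    using N unfolding filterlim_at_top_dense by blast
  ultimately show ?thesis
  proof eventually_elim
    case (elim i)
    have "C < real (N i) * (b - b')" using elim b' by (simp add: field_simps)
    moreover have "real (M i) < real (N i) * b'" using elim by (simp add: field_simps)
    ultimately show ?case by (simp add: algebra_simps)
  qed
qed

lemma regime_linear_eventually':
  assumes "regime t N M" "b < cycle_density t"
  shows "\<forall>\<^sub>F i in sequentially. real (N i) * b + C < real (M i)"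
proof -
  note r = assms(1)[unfolded regime_def]
  have N: "filterlim (\<lambda>i. real (N i)) at_top sequentially"
    using r filterlim_compose[OF filterlim_real_sequentially] by blast
  define b' where "b' = (cycle_density t + b) / 2"
  have b': "b < b'" "b' < cycle_density t" using assms(2) by (auto simp: b'_def)
  have "\<forall>\<^sub>F i in sequentially. b' < real (M i) / real (N i)"
    using r b' by (intro order_tendstoD) auto
  moreover have "\<forall>\<^sub>F i in sequentially. C / (b' - b) < real (N i)"
    using N by (simp add: filterlim_at_top_dense)
  moreover have "\<forall>\<^sub>F i in sequentially. 0 < real (N i)"
    using N unfolding filterlim_at_top_dense by blast
  ultimately show ?thesis
  proof eventually_elim
    case (elim i)
    have "C < real (N i) * (b' - b)" using elim b' by (simp add: field_simps)
    moreover have "real (N i) * b' < real (M i)" using elim by (simp add: field_simps)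
    ultimately show ?case by (simp add: algebra_simps)
  qed
qed

text \<open>
  For a parameter \<open>s\<close> slightly smaller than \<open>t\<close>, the mean at \<open>\<theta> = s n\<close> is below the number of cycles by
  a multiple of \<open>n\<close>, which exceeds the bounded error in \<open>mean_ge_of_ratio\<close>; so the ratio is at most
  \<open>1 / s\<close>. A parameter slightly larger than \<open>t\<close> gives the lower bound.
\<close>

lemma stirling_ratio_limit:
  assumes reg: "regime t N M"
  shows "(\<lambda>i. real (N i) * real (stirling (N i) (Suc (M i))) / real (stirling (N i) (M i))) \<longlonglongrightarrow> 1 / t"
proof -
  have t: "0 < t" using reg by (simp add: regime_def)
  have upper: "\<forall>\<^sub>F i in sequentially.
      real (N i) * real (stirling (N i) (Suc (M i))) / real (stirling (N i) (M i)) \<le> 1 / s"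
    if s: "0 < s" "s < t" for s
  proof -
    \<comment> \<open>Any factor above 1 that keeps \<open>\<kappa> * s\<close> below \<open>t\<close>.\<close>
    define \<kappa> where "\<kappa> = (s + t) / (2 * s)"
    have \<kappa>: "1 < \<kappa>" "\<kappa> * s < t" "0 < \<kappa> * s"
      using s by (auto simp: \<kappa>_def field_simps intro: add_pos_pos)
    have "cycle_density (\<kappa> * s) < cycle_density t" by (rule cycle_density_strict_mono[OF \<kappa>(3,2)])
    from regime_linear_eventually'[OF reg this, of "1 / (1 - 1 / \<kappa>)\<^sup>2 + 1"] regime_eventually[OF reg, of 1]
    show ?thesis
    proof eventually_elim
      case (elim i)
      let ?n = "N i" and ?m = "M i"
      have n: "0 < ?n" "Suc ?m \<le> ?n" "0 < ?m" using elim by auto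
      have "ewens_mean ?n (\<kappa> * (s * real ?n)) \<le> real ?n * cycle_density (\<kappa> * s) + 1"
        using ewens_mean_bounds(2)[OF \<kappa>(3) n(1)] by (simp add: mult.assoc)
      also have "\<dots> < real (Suc ?m) - 1 / (1 - 1 / \<kappa>)\<^sup>2" using elim by simp
      finally have "\<not> real (stirling ?n ?m) \<le> real (stirling ?n (Suc ?m)) * (s * real ?n)"
        using mean_ge_of_ratio[of "s * real ?n" \<kappa> ?m ?n] s n \<kappa> by fastforce
      moreover have "0 < stirling ?n ?m" using n by (intro stirling_pos) auto
      ultimately show ?case using s by (simp add: field_simps)
    qed
  qed
  have lower: "\<forall>\<^sub>F i in sequentially.
      1 / s \<le> real (N i) * real (stirling (N i) (Suc (M i))) / real (stirling (N i) (M i))"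
    if s: "t < s" for s
  proof -
    define \<kappa> where "\<kappa> = 2 * s / (s + t)"
    have \<kappa>: "1 < \<kappa>" "t < s / \<kappa>" "0 < s / \<kappa>" 
    proof -
      have "0 < s" using s t by simp
      then have "0 < s * s + s * t" using t by (intro add_pos_pos mult_pos_pos)
      then show "1 < \<kappa>" "t < s / \<kappa>" "0 < s / \<kappa>" using s t by (auto simp: \<kappa>_def field_simps)
    qed
    have "cycle_density t < cycle_density (s / \<kappa>)" by (rule cycle_density_strict_mono[OF t \<kappa>(2)])
    from regime_linear_eventually[OF reg this, of "1 / (1 - 1 / \<kappa>)\<^sup>2"] regime_eventually[OF reg, of 1]
    show ?thesis
    proof eventually_elim
      case (elim i)
      let ?n = "N i" and ?m = "M i"
      have n: "0 < ?n" "Suc ?m \<le> ?n" "0 < ?m" using elim by auto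
      have "real ?m + 1 / (1 - 1 / \<kappa>)\<^sup>2 < real ?n * cycle_density (s / \<kappa>)" using elim by simp
      also have "\<dots> \<le> ewens_mean ?n (s * real ?n / \<kappa>)"
        using ewens_mean_bounds(1)[OF \<kappa>(3) n(1)] by simp
      finally have "\<not> real (stirling ?n (Suc ?m)) * (s * real ?n) \<le> real (stirling ?n ?m)"
        using mean_le_of_ratio[of "s * real ?n" \<kappa> ?m ?n] s t n \<kappa> by fastforce
      moreover have "0 < stirling ?n ?m" using n by (intro stirling_pos) auto
      ultimately show ?case using s t by (simp add: field_simps)
    qed
  qed
  show ?thesis
  proof (rule order_tendstoI)
    fix y assume y: "y < 1 / t"
    define s where "s = (if y \<le> 0 then 2 * t else (t + 1 / y) / 2)"
    have "t < s \<and> y < 1 / s"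
    proof (cases "y \<le> 0")
      case True
      moreover have "0 < 1 / (2 * t)" using t by simp
      ultimately have "y < 1 / (2 * t)" by linarith
      then show ?thesis using True t unfolding s_def by simp
    next
      case False
      then have "t < 1 / y" using y t by (simp add: field_simps)
      then have "t < s" "s < 1 / y" using False by (auto simp: s_def)
      then show ?thesis using False t by (simp add: field_simps)
    qed
    then have "t < s" "y < 1 / s" by auto
    with lower[of s] show "\<forall>\<^sub>F i in sequentially.
        y < real (N i) * real (stirling (N i) (Suc (M i))) / real (stirling (N i) (M i))"
      by (auto elim!: eventually_mono)
  next
    fix y assume y: "1 / t < y"
    then have y0: "0 < y" using t by (meson divide_pos_pos less_trans zero_less_one)
    define s where "s = (t + 1 / y) / 2"
    have "0 < s" "s < t" "1 / s < y" using y t y0 by (auto simp: s_def field_simps)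
    with upper[of s] show "\<forall>\<^sub>F i in sequentially.
        real (N i) * real (stirling (N i) (Suc (M i))) / real (stirling (N i) (M i)) < y"
      by (auto elim!: eventually_mono)
  qed
qed

lemma regime_diff_one:
  assumes reg: "regime t N M"
  shows "regime t (\<lambda>i. N i - 1) M" "regime t (\<lambda>i. N i - 1) (\<lambda>i. M i - 1)"
    and "(\<lambda>i. real (N i) / real (N i - 1)) \<longlonglongrightarrow> 1"
proof -
  have t: "0 < t" and N: "filterlim N at_top sequentially"
    and lim: "(\<lambda>i. real (M i) / real (N i)) \<longlonglongrightarrow> cycle_density t"
    using reg by (auto simp: regime_def)
  have N': "filterlim (\<lambda>i. N i - 1) at_top sequentially"
    by (rule filterlim_compose[OF filterlim_minus_const_nat_at_top N])
  have Nr: "filterlim (\<lambda>i. real (N i)) at_top sequentially"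
    by (rule filterlim_compose[OF filterlim_real_sequentially N])
  have Nr': "filterlim (\<lambda>i. real (N i - 1)) at_top sequentially"
    by (rule filterlim_compose[OF filterlim_real_sequentially N'])
  have ev: "\<forall>\<^sub>F i in sequentially. 1 < M i \<and> M i + 1 < N i"
    by (rule regime_eventually[OF reg])
  have "((\<lambda>x::real. x / (x - 1)) \<longlongrightarrow> 1) at_top" by real_asymp
  from filterlim_compose[OF this Nr]
  show q: "(\<lambda>i. real (N i) / real (N i - 1)) \<longlonglongrightarrow> 1"
    by (rule Lim_transform_eventually) (use ev in eventually_elim, auto simp: of_nat_diff)
  have "(\<lambda>i. real (M i) / real (N i) * (real (N i) / real (N i - 1))) \<longlonglongrightarrow> cycle_density t * 1"
    by (intro tendsto_mult lim q)
  then have l1: "(\<lambda>i. real (M i) / real (N i - 1)) \<longlonglongrightarrow> cycle_density t"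
    unfolding mult_1_right by (rule Lim_transform_eventually) (use ev in eventually_elim, auto)
  then show "regime t (\<lambda>i. N i - 1) M" using t N' by (simp add: regime_def)
  have "((\<lambda>x::real. 1 / x) \<longlongrightarrow> 0) at_top" by real_asymp
  from tendsto_diff[OF l1 filterlim_compose[OF this Nr']]
  have "(\<lambda>i. real (M i - 1) / real (N i - 1)) \<longlonglongrightarrow> cycle_density t - 0"
    by (rule Lim_transform_eventually)
      (use ev in eventually_elim, auto simp: of_nat_diff diff_divide_distrib)
  then show "regime t (\<lambda>i. N i - 1) (\<lambda>i. M i - 1)" using t N' by (simp add: regime_def)
qed

lemma stirling_pred_ratio_limits:
  assumes reg: "regime t N M"
  shows "(\<lambda>i. real (stirling (N i - 1) (M i - 1)) / real (stirling (N i) (M i))) \<longlonglongrightarrow> t / (1 + t)"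
    and "(\<lambda>i. real (N i) * real (stirling (N i - 1) (M i)) / real (stirling (N i) (M i))) \<longlonglongrightarrow> 1 / (1 + t)"
proof -
  have t: "0 < t" using reg by (simp add: regime_def)
  define u where
    "u i = real (N i - 1) * real (stirling (N i - 1) (Suc (M i - 1))) / real (stirling (N i - 1) (M i - 1))" for i
  have u: "u \<longlonglongrightarrow> 1 / t"
    unfolding u_def by (rule stirling_ratio_limit[OF regime_diff_one(2)[OF reg]])
  have ev: "\<forall>\<^sub>F i in sequentially. 1 < M i \<and> M i + 1 < N i"
    by (rule regime_eventually[OF reg])
  have rec: "\<forall>\<^sub>F i in sequentially.
      real (stirling (N i) (M i)) = real (stirling (N i - 1) (M i - 1)) * (1 + u i) \<and>
      0 < stirling (N i - 1) (M i - 1) \<and> 0 < stirling (N i) (M i)"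
    using ev
  proof eventually_elim
    case (elim i)
    obtain n m where nm: "N i = Suc n" "M i = Suc m" "0 < m" "Suc m < n"
      using elim by (cases "N i"; cases "M i") auto
    have "0 < stirling n m" "0 < stirling (N i) (M i)"
      using nm by (auto intro!: stirling_pos simp del: stirling.simps)
    then show ?case using nm by (simp add: u_def field_simps)
  qed
  have 1: "(\<lambda>i. 1 / (1 + u i)) \<longlonglongrightarrow> 1 / (1 + 1 / t)"
    using t add_pos_pos[of 1 "1 / t"] by (intro tendsto_intros u) auto
  also have "1 / (1 + 1 / t) = t / (1 + t)" using t by (simp add: field_simps)
  finally show lim1: "(\<lambda>i. real (stirling (N i - 1) (M i - 1)) / real (stirling (N i) (M i))) \<longlonglongrightarrow> t / (1 + t)"
    by (rule Lim_transform_eventually) (use rec in eventually_elim, auto)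
  have "(\<lambda>i. (real (N i) / real (N i - 1)) * (u i *
      (real (stirling (N i - 1) (M i - 1)) / real (stirling (N i) (M i))))) \<longlonglongrightarrow> 1 * (1 / t * (t / (1 + t)))"
    by (intro tendsto_mult regime_diff_one(3)[OF reg] u lim1)
  also have "1 * (1 / t * (t / (1 + t))) = 1 / (1 + t)" using t by simp
  finally show "(\<lambda>i. real (N i) * real (stirling (N i - 1) (M i)) / real (stirling (N i) (M i))) \<longlonglongrightarrow> 1 / (1 + t)"
    by (rule Lim_transform_eventually)
      (use rec ev in eventually_elim, auto simp: u_def of_nat_diff)
qed

text \<open>
  The ratio is, up to the power of \<open>N\<close>, the probability that a uniform permutation with \<open>M\<close> cycles
  extends a prescribed permutation of \<open>h\<close> points with \<open>c\<close> cycles. The points are removed one at a time,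
  \<open>c\<close> of them together with a cycle.
\<close>

lemma stirling_block_ratio_limit:
  assumes "c \<le> h" "regime t N M"
  shows "(\<lambda>i. real (N i) ^ (h - c) * real (stirling (N i - h) (M i - c)) / real (stirling (N i) (M i)))
    \<longlonglongrightarrow> t ^ c / (1 + t) ^ h"
  using assms
proof (induction h arbitrary: c N M)
  case 0
  have "\<forall>\<^sub>F i in sequentially. 1 < M i \<and> M i + 1 < N i"
    by (rule regime_eventually[OF 0(2)])
  then have "\<forall>\<^sub>F i in sequentially. 1 = real (stirling (N i) (M i)) / real (stirling (N i) (M i))"
  proof eventually_elim
    case (elim i)
    then have "0 < stirling (N i) (M i)" by (intro stirling_pos) auto
    then show ?case by simp
  qed
  then show ?case using 0 by (auto intro: Lim_transform_eventually[OF tendsto_const])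
next
  case (Suc h)
  have t: "0 < t" using Suc.prems by (simp add: regime_def)
  have ev: "\<forall>\<^sub>F i in sequentially. 1 < M i \<and> M i + 1 < N i"
    by (rule regime_eventually[OF Suc.prems(2)])
  have pos: "\<forall>\<^sub>F i in sequentially. 0 < N i - 1 \<and> 0 < stirling (N i - 1) (M i - 1) \<and>
      0 < stirling (N i - 1) (M i)"
    using ev by eventually_elim (auto intro!: stirling_pos)
  note r = regime_diff_one[OF Suc.prems(2)] and s = stirling_pred_ratio_limits[OF Suc.prems(2)]
  show ?case
  proof (cases "c = Suc h")
    case True
    have "(\<lambda>i. (real (N i - 1) ^ (h - h) * real (stirling (N i - 1 - h) (M i - 1 - h)) /
        real (stirling (N i - 1) (M i - 1))) *
        (real (stirling (N i - 1) (M i - 1)) / real (stirling (N i) (M i))))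
      \<longlonglongrightarrow> t ^ h / (1 + t) ^ h * (t / (1 + t))"
      by (intro tendsto_mult Suc.IH r s) simp
    also have "t ^ h / (1 + t) ^ h * (t / (1 + t)) = t ^ c / (1 + t) ^ Suc h"
      unfolding True by (simp add: ac_simps)
    finally show ?thesis
      by (rule Lim_transform_eventually) (use pos in eventually_elim, auto simp: True)
  next
    case False
    then have c: "c \<le> h" "Suc h - c = Suc (h - c)" using Suc.prems by auto
    have "(\<lambda>i. (real (N i) / real (N i - 1)) ^ (h - c) *
        ((real (N i - 1) ^ (h - c) * real (stirling (N i - 1 - h) (M i - c)) /
        real (stirling (N i - 1) (M i))) *
        (real (N i) * real (stirling (N i - 1) (M i)) / real (stirling (N i) (M i)))))
      \<longlonglongrightarrow> 1 ^ (h - c) * (t ^ c / (1 + t) ^ h * (1 / (1 + t)))"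
      by (intro tendsto_mult tendsto_power Suc.IH r s c)
    also have "1 ^ (h - c) * (t ^ c / (1 + t) ^ h * (1 / (1 + t))) = t ^ c / (1 + t) ^ Suc h"
      by simp
    finally show ?thesis
      by (rule Lim_transform_eventually)
        (use pos in eventually_elim, auto simp: c power_divide)
  qed
qed

section \<open>Paths through the cycles of two permutations\<close>

text \<open>
  Paths in the bipartite graph of the cycles of two permutations, with \<open>E True\<close> and \<open>E False\<close> the
  relations of lying in a common cycle. A path is the list of its points, the last point visited first;
  consecutive points share a cycle, alternately of the two permutations. The Boolean \<open>c\<close> is the kind of
  the cycle through which the path may continue. Since each earlier point belongs to visited cycles only,
  requiring the new point to be unrelated by \<open>E c\<close> to all earlier points says exactly that the cycle at
  the end of the path has not been visited before.
\<close>

fun simple_path :: "(bool \<Rightarrow> 'a \<Rightarrow> 'a \<Rightarrow> bool) \<Rightarrow> bool \<Rightarrow> 'a list \<Rightarrow> bool" where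
  "simple_path E c [] \<longleftrightarrow> False"
| "simple_path E c [v] \<longleftrightarrow> True"
| "simple_path E c (w # v # vs) \<longleftrightarrow>
     simple_path E (\<not> c) (v # vs) \<and> E (\<not> c) v w \<and> v \<noteq> w \<and> (\<forall>u\<in>set (v # vs). \<not> E c w u)"

text \<open>
  One more step, to the point \<open>w\<close>, that arrives in a cycle visited before: a path with a loop at its end.
\<close>

definition lollipop :: "(bool \<Rightarrow> 'a \<Rightarrow> 'a \<Rightarrow> bool) \<Rightarrow> bool \<Rightarrow> 'a \<Rightarrow> 'a list \<Rightarrow> bool" where
  "lollipop E c w vs \<longleftrightarrow>
     simple_path E c vs \<and> E c (hd vs) w \<and> hd vs \<noteq> w \<and> (\<exists>u\<in>set vs. E (\<not> c) w u)"

abbreviation cyc_rels :: "(bool \<Rightarrow> 'a \<Rightarrow> 'a) \<Rightarrow> bool \<Rightarrow> 'a \<Rightarrow> 'a \<Rightarrow> bool" where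
  "cyc_rels P \<equiv> \<lambda>d. cyc_rel (P d)"

lemma simple_path_nonempty: "simple_path E c vs \<Longrightarrow> vs \<noteq> []"
  by auto

lemma simple_path_distinct:
  assumes "simple_path E c vs" "\<And>d x. E d x x"
  shows "distinct vs"
  using assms(1) by (induction vs arbitrary: c rule: induct_list012) (use assms(2) in auto)

lemma simple_path_cong:
  assumes "\<And>d x y. x \<in> B \<Longrightarrow> y \<in> B \<Longrightarrow> E d x y \<longleftrightarrow> E' d x y" "set vs \<subseteq> B"
  shows "simple_path E c vs \<longleftrightarrow> simple_path E' c vs"
  using assms(2) by (induction vs arbitrary: c rule: induct_list012) (auto simp: assms(1) subset_iff)

lemma lollipop_cong:
  assumes "\<And>d x y. x \<in> B \<Longrightarrow> y \<in> B \<Longrightarrow> E d x y \<longleftrightarrow> E' d x y" "set vs \<subseteq> B" "w \<in> B"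
  shows "lollipop E c w vs \<longleftrightarrow> lollipop E' c w vs"
proof -
  have "simple_path E c vs \<longleftrightarrow> simple_path E' c vs" using simple_path_cong[OF assms(1,2)] .
  moreover have "hd vs \<in> B" if "simple_path E' c vs"
    using simple_path_nonempty[OF that] assms(2) by (cases vs) auto
  moreover have "E (\<not> c) w u \<longleftrightarrow> E' (\<not> c) w u" if "u \<in> set vs" for u
    using assms that by blast
  ultimately show ?thesis unfolding lollipop_def using assms(1,3) by metis
qed

lemma permutation_invariant_iff:
  assumes "permutation f" "finite A" "\<And>x. x \<in> A \<Longrightarrow> f x \<in> A"
  shows "f z \<in> A \<longleftrightarrow> z \<in> A"
proof -
  have inj: "inj f" using assms(1) by (simp add: permutation_bijective bij_is_inj)
  have "f ` A \<subseteq> A" using assms(3) by blast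
  then have "f ` A = A"
    using assms(2) inj by (meson endo_inj_surj inj_on_subset subset_UNIV)
  then show ?thesis using inj by (metis inj_image_mem_iff)
qed

text \<open>
  Without lollipops from \<open>v\<close>, a longest simple path ends at a point \<open>i\<close> that one of the permutations
  fixes, since otherwise the path could be continued. Such a point is a leaf. Skipping it in the other
  permutation lowers by one the number of points and the total number of cycles, and it skips \<open>i\<close> in the
  product of the two permutations as well. Connectedness is expressed by closed sets: each set that
  contains \<open>v\<close> and is invariant under both permutations contains \<open>A\<close>.
\<close>

lemma tree_single_cycle:
  fixes P :: "bool \<Rightarrow> 'a \<Rightarrow> 'a"
  assumes "finite A" "\<And>d. permutation (P d)" "\<And>d x. x \<in> A \<Longrightarrow> P d x \<in> A" "v \<in> A"
    and "\<And>D. v \<in> D \<Longrightarrow> (\<And>d z. P d z \<in> D \<longleftrightarrow> z \<in> D) \<Longrightarrow> A \<subseteq> D"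
    and "\<And>c w vs. last vs = v \<Longrightarrow> set vs \<subseteq> A \<Longrightarrow> w \<in> A \<Longrightarrow> \<not> lollipop (cyc_rels P) c w vs"
  shows "ncyc A (P True) + ncyc A (P False) = Suc (card A) \<and>
    (\<forall>x\<in>A. cyc_rel (P True \<circ> P False) v x)"
  using assms
proof (induction "card A" arbitrary: A P rule: less_induct)
  case less
  note fin = less.prems(1) and perm = less.prems(2) and inv = less.prems(3) and v = less.prems(4)
    and conn = less.prems(5) and nolol = less.prems(6)
  have closed: "P d z \<in> A \<longleftrightarrow> z \<in> A" for d z
    using permutation_invariant_iff[OF perm fin inv] .
  have inj: "inj (P d)" for d using perm by (simp add: permutation_bijective bij_is_inj)
  have bij: "bij (P d)" for d using perm by (simp add: permutation_bijective)
  \<comment> \<open>Simple paths from \<open>v\<close> inside \<open>A\<close>. The one-point path counts for both kinds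
    \<open>c\<close>.\<close>
  define Q where "Q = (\<lambda>(c, vs). simple_path (cyc_rels P) c vs \<and> last vs = v \<and> set vs \<subseteq> A)"
  have "Q (True, [v])" using v by (simp add: Q_def)
  moreover have "\<forall>y. Q y \<longrightarrow> length (snd y) < Suc (card A)"
  proof (intro allI impI)
    fix y assume "Q y"
    then have "distinct (snd y)" "set (snd y) \<subseteq> A"
      using simple_path_distinct[of "cyc_rels P"] by (auto simp: Q_def)
    then show "length (snd y) < Suc (card A)"
      using card_mono[OF fin] distinct_card by (metis less_Suc_eq_le)
  qed
  ultimately obtain y where y: "Q y" "\<And>z. Q z \<Longrightarrow> length (snd z) \<le> length (snd y)"
    using ex_has_greatest_nat[of Q _ "\<lambda>z. length (snd z)" "Suc (card A)"] by metis
  have leaf: "P c i = i"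
    if q: "Q (c, i # us)" and len: "length (i # us) = length (snd y)" for c i us
  proof (rule ccontr)
    define w where "w = P c i"
    assume "P c i \<noteq> i"
    then have w: "w \<noteq> i" "cyc_rel (P c) i w" "w \<in> A" using q inv by (auto simp: w_def Q_def)
    have "\<not> lollipop (cyc_rels P) c w (i # us)"
      using nolol[of "i # us" w c] q w by (simp add: Q_def)
    then have "Q (\<not> c, w # i # us)"
      using q w by (auto simp: Q_def lollipop_def)
    from y(2)[OF this] len show False by simp
  qed
  obtain c vs where yc: "y = (c, vs)" by (cases y)
  have spv: "simple_path (cyc_rels P) c vs" "last vs = v" "set vs \<subseteq> A" using y(1) by (auto simp: yc Q_def)
  obtain i us where vs: "vs = i # us" using spv by (cases vs) auto
  show ?case
  proof (cases us)
    case Nil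
    then have iv: "i = v" using spv vs by simp
    have "P d v = v" for d
    proof (rule leaf[of d v "[]"])
      show "Q (d, [v])" using v by (simp add: Q_def)
      show "length [v] = length (snd y)" by (simp add: yc vs Nil)
    qed
    then have "P d z \<in> {v} \<longleftrightarrow> z \<in> {v}" for d z using inj by (metis injD singleton_iff)
    then have "A = {v}" using conn[of "{v}"] v by blast
    then show ?thesis by (simp add: ncyc_def)
  next
    case (Cons u us')
    define b where "b = (\<not> c)"
    have iA: "i \<in> A" "u \<in> A" using spv vs Cons by auto
    have dist: "distinct vs" using simple_path_distinct[of "cyc_rels P"] spv by simp
    have ui: "cyc_rel (P b) u i" "u \<noteq> i" using spv vs Cons by (auto simp: b_def)
    have "v \<in> set us" using spv(2) vs Cons by (metis last_ConsR last_in_set list.discI)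
    then have vi: "v \<noteq> i" using dist vs by auto
    have fix_i: "P c i = i" by (rule leaf[of c i us]) (use y yc vs in auto)
    have nfix: "P b i \<noteq> i"
      using cyc_rel_fixed[of "P b" i u] ui cyc_rel_sym[OF ui(1)] inj by blast
    define P' where "P' = P(b := skip i (P b))"
    have P'b: "P' b = skip i (P b)" and P'c: "P' c = P c" by (auto simp: P'_def b_def)
    have bc: "d = b \<or> d = c" for d by (auto simp: b_def)
    define A' where "A' = A - {i}"
    have P'perm: "permutation (P' d)" for d
      using bc[of d] by (elim disjE) (simp_all only: P'b P'c skip_permutation[OF perm] perm)
    have P'fix: "P' d i = i" for d 
      using bc[of d] by (elim disjE) (simp_all only: P'b P'c fix_i skip_self[OF bij])
    have P'inj: "inj (P' d)" for d using P'perm by (simp add: permutation_bijective bij_is_inj)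
    have rel: "cyc_rel (P' d) x z \<longleftrightarrow> cyc_rel (P d) x z" if "x \<noteq> i" "z \<noteq> i" for d x z
      using bc[of d] by (elim disjE) (simp_all only: P'b P'c cyc_rel_skip[OF perm that])
    have P'val: "P' d x = (if P d x = i then P d i else P d x)" if "x \<noteq> i" for d x
    proof -
      have "P c x \<noteq> i" using fix_i that inj[of c] by (metis injD)
      then show ?thesis
        using bc[of d] skip_other[OF bij that, of b] skip_pred[OF bij that, of b]
        by (elim disjE) (simp_all only: P'b P'c split: if_split, blast+)
    qed
    have IH: "ncyc A' (P' True) + ncyc A' (P' False) = Suc (card A') \<and>
      (\<forall>x\<in>A'. cyc_rel (P' True \<circ> P' False) v x)"
    proof (rule less.hyps)
      show "card A' < card A" unfolding A'_def using fin iA by (intro psubset_card_mono) auto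
      show "finite A'" using fin by (simp add: A'_def)
      show "permutation (P' d)" for d by (rule P'perm)
      show "P' d x \<in> A'" if "x \<in> A'" for d x
      proof -
        have "P' d x \<noteq> i" using P'fix[of d] P'inj[of d] that by (metis A'_def DiffE injD singletonI)
        moreover have "P' d x \<in> A" using that iA P'val[of x d] inv by (auto simp: A'_def)
        ultimately show ?thesis by (simp add: A'_def)
      qed
      show "v \<in> A'" using v vi by (simp add: A'_def)
      show "A' \<subseteq> D" if D: "v \<in> D" "\<And>d z. P' d z \<in> D \<longleftrightarrow> z \<in> D" for D
      proof -
        \<comment> \<open>A closed set of the reduced permutations becomes closed for the original ones once \<open>i\<close> is
          put where its image is.\<close>
        define D' where "D' = (if P b i \<in> D then insert i D else D - {i})"
        have "P d z \<in> D' \<longleftrightarrow> z \<in> D'" for d z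
        proof (cases "z = i")
          case True
          have "P b z \<in> D' \<longleftrightarrow> z \<in> D'" using True nfix by (auto simp: D'_def)
          then show ?thesis using bc[of d] True fix_i by (elim disjE) simp_all
        next
          case False
          show ?thesis
          proof (cases "P d z = i")
            case True
            have "d \<noteq> c"
            proof
              assume "d = c"
              with True fix_i have "P c z = P c i" by simp
              then show False using injD[OF inj] False by blast
            qed
            then have "d = b" using bc[of d] by blast
            then show ?thesis using True False P'val[OF False, of d] D(2)[of d z] by (auto simp: D'_def)
          next
            case F: False
            then show ?thesis using False P'val[OF False, of d] D(2)[of d z] by (auto simp: D'_def)
          qed
        qed
        moreover have "v \<in> D'" using D vi by (simp add: D'_def)
        ultimately have "A \<subseteq> D'" by (intro conn)
        then show ?thesis by (auto simp: A'_def D'_def split: if_splits)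
      qed
      show "\<not> lollipop (cyc_rels P') c' w ws" if "last ws = v" "set ws \<subseteq> A'" "w \<in> A'" for c' w ws
        using lollipop_cong[of A' "cyc_rels P'" "cyc_rels P" ws w c'] rel nolol[of ws w c'] that
        by (auto simp: A'_def)
    qed
    have cardA: "card A = Suc (card A')" using card_Suc_Diff1[OF fin iA(1)] by (simp add: A'_def)
    have fin_A': "finite A'" using fin by (simp add: A'_def)
    have Ains: "A = insert i A'" using iA by (auto simp: A'_def)
    have n': "ncyc A' (P' d) = ncyc A' (P d)" for d
      by (rule ncyc_cong) (use rel in \<open>auto simp: A'_def\<close>)
    have "cycle_of (P c) i \<notin> cycle_of (P c) ` A'"
      using cyc_rel_fixed[of "P c" i, OF fix_i _ inj] by (auto simp: cycle_of_eq_iff A'_def)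
    then have nc: "ncyc A (P c) = Suc (ncyc A' (P c))"
      using fin_A' unfolding ncyc_def Ains image_insert by simp
    have "cycle_of (P b) i = cycle_of (P b) u" using ui cycle_of_eq_iff cyc_rel_sym by metis
    moreover have "u \<in> A'" using iA ui by (simp add: A'_def)
    ultimately have nb: "ncyc A (P b) = ncyc A' (P b)"
      unfolding ncyc_def Ains by (simp add: insert_absorb)
    have sum: "ncyc B (p True) + ncyc B (p False) = ncyc B (p c) + ncyc B (p b)"
      for p :: "bool \<Rightarrow> 'a \<Rightarrow> 'a" and B by (cases c) (auto simp: b_def)
    have 1: "ncyc A (P True) + ncyc A (P False) = Suc (card A)"
      using IH sum[of A P] sum[of A' P] unfolding n' nc nb cardA by linarith
    let ?f = "P True \<circ> P False" and ?f' = "P' True \<circ> P' False"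
    have fperm: "permutation ?f" using perm by (simp add: permutation_compose)
    have fbij: "bij ?f" using fperm by (simp add: permutation_bijective)
    have fi: "?f i \<noteq> i"
    proof (cases c)
      case True
      then have "P True i = i" "P False i \<noteq> i" using fix_i nfix by (auto simp: b_def)
      then show ?thesis using inj[of True] by (metis comp_apply injD)
    next
      case False
      then have "P False i = i" "P True i \<noteq> i" using fix_i nfix by (auto simp: b_def)
      then show ?thesis by simp
    qed
    have "?f' = skip i ?f"
    proof
      fix x
      show "?f' x = skip i ?f x"
      proof (cases "x = i")
        case True
        then show ?thesis using P'fix skip_self[OF fbij, of i] by simp
      next
        case x: False
        show ?thesis
        proof (cases c)
          case True
          then have T: "P True i = i" "P' True = P True" using fix_i P'c by auto
          have "P True z = i \<longleftrightarrow> z = i" for z using T inj[of True] by (metis injD)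
          then show ?thesis
            using x T(2) P'val[OF x, of False] skip_other[OF fbij x] skip_pred[OF fbij x] by auto
        next
          case False
          then have F: "P False i = i" "P' False = P False" using fix_i P'c by auto
          then have "P False x \<noteq> i" using inj[of False] x by (metis injD)
          then show ?thesis
            using F x P'val[of "P False x" True] skip_other[OF fbij x] skip_pred[OF fbij x] by auto
        qed
      qed
    qed
    then have "cyc_rel ?f v x" if "x \<in> A'" for x
      using IH that cyc_rel_skip[OF fperm vi, of x] by (auto simp: A'_def)
    moreover have "?f i \<in> A'" using fi iA inv by (simp add: A'_def)
    moreover have "cyc_rel ?f (?f i) i" using cyc_rel_sym cyc_rel_step by metis
    ultimately have "\<forall>x\<in>A. cyc_rel ?f v x"
      unfolding Ains using cyc_rel_trans by (metis insert_iff)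
    with 1 show ?thesis by blast
  qed
qed

text \<open>
  The first return map to \<open>A\<close>, obtained by skipping the points outside \<open>A\<close> one by one.
\<close>

lemma induced_permutation:
  assumes "finite V" "s permutes V" "A \<subseteq> V"
  obtains s' where "s' permutes A" "\<And>y. y \<in> A \<Longrightarrow> s y \<in> A \<Longrightarrow> s' y = s y"
    "\<And>x y. x \<in> A \<Longrightarrow> y \<in> A \<Longrightarrow> cyc_rel s' x y \<longleftrightarrow> cyc_rel s x y"
proof -
  have "\<exists>s'. s' permutes A \<and> (\<forall>y\<in>A. s y \<in> A \<longrightarrow> s' y = s y) \<and>
      (\<forall>x\<in>A. \<forall>y\<in>A. cyc_rel s' x y \<longleftrightarrow> cyc_rel s x y)"
    using assms
  proof (induction "card (V - A)" arbitrary: V s)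
    case 0
    then have "V = A" by auto
    then show ?case using 0 by blast
  next
    case (Suc n)
    then obtain z where z: "z \<in> V" "z \<notin> A" by (metis Diff_iff card.empty ex_in_conv nat.distinct(1))
    have perm: "permutation s" using Suc.prems by (auto simp: permutation_permutes)
    have bij: "bij s" using perm by (simp add: permutation_bijective)
    have "inv s z \<in> V" using Suc.prems z by (metis permutes_inv permutes_in_image)
    then have "skip z s permutes V"
      unfolding skip_def using Suc.prems z by (intro permutes_compose permutes_swap_id)
    then have "skip z s permutes (V - {z})"
      by (rule permutes_superset) (use skip_self[OF bij] in auto)
    moreover have "n = card (V - {z} - A)"
    proof -
      have "V - {z} - A = V - A - {z}" by blast
      then show ?thesis using Suc.hyps(2) z Suc.prems by (simp add: card_Diff_singleton)
    qed
    moreover have "A \<subseteq> V - {z}" using Suc.prems z by blast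
    ultimately obtain s' where s': "s' permutes A" "\<forall>y\<in>A. skip z s y \<in> A \<longrightarrow> s' y = skip z s y"
      "\<forall>x\<in>A. \<forall>y\<in>A. cyc_rel s' x y \<longleftrightarrow> cyc_rel (skip z s) x y"
      using Suc.hyps(1)[of "V - {z}" "skip z s"] Suc.prems(1) by blast
    have "s' y = s y" if "y \<in> A" "s y \<in> A" for y
    proof -
      have "skip z s y = s y" using that z by (intro skip_other[OF bij]) auto
      then show ?thesis using s'(2) that by metis
    qed
    moreover have "cyc_rel s' x y \<longleftrightarrow> cyc_rel s x y" if "x \<in> A" "y \<in> A" for x y
    proof -
      have "x \<noteq> z" "y \<noteq> z" using that z by auto
      then show ?thesis using s'(3) that cyc_rel_skip[OF perm] by metis
    qed
    ultimately show ?case using s'(1) by blast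
  qed
  then show ?thesis using that by blast
qed

text \<open>
  The points of a tree component: invariant under both permutations, a single cycle of their product, and
  with one more cycle than points. The single cycle replaces connectedness, and it makes distinct tree
  components disjoint.
\<close>

definition tree_cycle :: "(bool \<Rightarrow> 'a \<Rightarrow> 'a) \<Rightarrow> 'a set \<Rightarrow> bool" where
  "tree_cycle P X \<longleftrightarrow> finite X \<and> X \<noteq> {} \<and> (\<forall>d. P d ` X = X) \<and>
     (\<forall>x\<in>X. cycle_of (P True \<circ> P False) x = X) \<and>
     ncyc X (P True) + ncyc X (P False) = Suc (card X)"

lemma cycle_of_subset:
  assumes "f permutes V" "v \<in> V"
  shows "cycle_of f v \<subseteq> V"
  using cyc_rel_invariant[of f v _ V] assms permutes_in_image by (fastforce simp: cycle_of_def)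

text \<open>
  Let \<open>X\<close> be the cycle of \<open>v\<close> under the product and \<open>Y\<close> its image under \<open>P False\<close>. The
  first return maps to \<open>X \<union> Y\<close> agree with the two permutations along the cycle, so \<open>X\<close> is also a cycle of
  the product of the return maps. By \<open>tree_single_cycle\<close> that product has only one cycle on \<open>X \<union> Y\<close>;
  hence \<open>Y = X\<close> and \<open>X\<close> is a whole component. Lollipops that stay inside \<open>X \<union> Y\<close> have at most
  \<open>2 * card X\<close> points before the last step, so only these must be excluded. This matters in the
  supercritical phase, where long lollipops are common.
\<close>

lemma tree_cycle_of_no_lollipop:
  fixes P :: "bool \<Rightarrow> 'a \<Rightarrow> 'a"
  assumes V: "finite V" and P: "\<And>d. P d permutes V" and v: "v \<in> V"
    and nolol: "\<And>c w vs. last vs = v \<Longrightarrow> set (w # vs) \<subseteq> V \<Longrightarrow>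
      length vs \<le> 2 * card (cycle_of (P True \<circ> P False) v) \<Longrightarrow> \<not> lollipop (cyc_rels P) c w vs"
  shows "tree_cycle P (cycle_of (P True \<circ> P False) v)"
proof -
  let ?s = "P True" and ?p = "P False"
  let ?f = "?s \<circ> ?p"
  define X where "X = cycle_of ?f v"
  define Y where "Y = ?p ` X"
  define A where "A = X \<union> Y"
  have fV: "?f permutes V" using P by (intro permutes_compose)
  have XV: "X \<subseteq> V" unfolding X_def by (rule cycle_of_subset[OF fV v])
  have YV: "Y \<subseteq> V" using XV permutes_in_image[OF P] by (auto simp: Y_def)
  have finX: "finite X" using XV V finite_subset by blast
  have finA: "finite A" and AV: "A \<subseteq> V" using XV YV finX by (auto simp: A_def Y_def)
  have vX: "v \<in> X" by (simp add: X_def cycle_of_def)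
  have fX: "?f x \<in> X" if "x \<in> X" for x
    using that cyc_rel_step[of ?f x] cyc_rel_trans[of ?f v x "?f x"] by (simp add: X_def cycle_of_def)
  have permf: "permutation ?f" using fV V by (auto simp: permutation_permutes)
  have fXi: "?f z \<in> X \<longleftrightarrow> z \<in> X" for z by (rule permutation_invariant_iff[OF permf finX fX])
  obtain s' where s': "s' permutes A" "\<And>y. y \<in> A \<Longrightarrow> ?s y \<in> A \<Longrightarrow> s' y = ?s y"
    "\<And>x y. x \<in> A \<Longrightarrow> y \<in> A \<Longrightarrow> cyc_rel s' x y \<longleftrightarrow> cyc_rel ?s x y"
    using induced_permutation[OF V P AV, of True] by metis
  obtain p' where p': "p' permutes A" "\<And>y. y \<in> A \<Longrightarrow> ?p y \<in> A \<Longrightarrow> p' y = ?p y"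
    "\<And>x y. x \<in> A \<Longrightarrow> y \<in> A \<Longrightarrow> cyc_rel p' x y \<longleftrightarrow> cyc_rel ?p x y"
    using induced_permutation[OF V P AV, of False] by metis
  define P' where "P' d = (if d then s' else p')" for d
  have P'A: "P' d permutes A" for d using s' p' by (simp add: P'_def)
  have pX: "p' x = ?p x" if "x \<in> X" for x using that p'(2) by (auto simp: A_def Y_def)
  have f'X: "s' (p' x) = ?f x" if "x \<in> X" for x
    using that pX[OF that] fX[OF that] s'(2)[of "?p x"] by (auto simp: A_def Y_def)
  have rel: "cyc_rel (P' d) x y \<longleftrightarrow> cyc_rel (P d) x y" if "x \<in> A" "y \<in> A" for d x y
    using that s'(3) p'(3) by (cases d) (auto simp: P'_def)
  have main: "ncyc A (P' True) + ncyc A (P' False) = Suc (card A) \<and>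
    (\<forall>x\<in>A. cyc_rel (P' True \<circ> P' False) v x)"
  proof (rule tree_single_cycle[OF finA])
    show "permutation (P' d)" for d using P'A finA by (auto simp: permutation_permutes)
    show "P' d x \<in> A" if "x \<in> A" for d x using that permutes_in_image[OF P'A] by blast
    show "v \<in> A" using vX by (simp add: A_def)
    show "A \<subseteq> D" if D: "v \<in> D" "\<And>d z. P' d z \<in> D \<longleftrightarrow> z \<in> D" for D
    proof -
      have XD: "X \<subseteq> D"
      proof
        fix x assume x: "x \<in> X"
        then have "cyc_rel ?f v x" by (simp add: X_def cycle_of_def)
        moreover have "?f z \<in> {z. z \<in> X \<longrightarrow> z \<in> D} \<longleftrightarrow> z \<in> {z. z \<in> X \<longrightarrow> z \<in> D}" for z
          using fXi[of z] f'X[of z] D(2)[of True "p' z"] D(2)[of False z] by (auto simp: P'_def)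
        ultimately have "v \<in> {z. z \<in> X \<longrightarrow> z \<in> D} \<longleftrightarrow> x \<in> {z. z \<in> X \<longrightarrow> z \<in> D}"
          by (rule cyc_rel_invariant)
        then show "x \<in> D" using D(1) x by simp
      qed
      moreover have "Y \<subseteq> D"
        using XD pX D(2)[of False] by (auto simp: Y_def P'_def) (metis subsetD)
      ultimately show ?thesis by (simp add: A_def)
    qed
    show "\<not> lollipop (cyc_rels P') c w vs" if vs: "last vs = v" "set vs \<subseteq> A" "w \<in> A" for c w vs
    proof
      assume "lollipop (cyc_rels P') c w vs"
      then have lol: "lollipop (cyc_rels P) c w vs"
        using lollipop_cong[of A "cyc_rels P'" "cyc_rels P" vs w c] rel vs by blast
      then have "distinct vs" using simple_path_distinct[of "cyc_rels P"] by (auto simp: lollipop_def)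
      then have "length vs \<le> card A" using card_mono[OF finA vs(2)] by (simp add: distinct_card)
      also have "\<dots> \<le> card X + card Y" unfolding A_def by (rule card_Un_le)
      also have "\<dots> \<le> 2 * card X" unfolding Y_def using card_image_le[OF finX, of ?p] by simp
      finally show False using nolol[of vs w c] lol vs AV unfolding X_def by auto
    qed
  qed
  have f'Xi: "(P' True \<circ> P' False) z \<in> X \<longleftrightarrow> z \<in> X" for z
  proof (rule permutation_invariant_iff[OF _ finX])
    show "permutation (P' True \<circ> P' False)"
      using permutes_compose[OF P'A P'A] finA by (auto simp: permutation_permutes)
    show "(P' True \<circ> P' False) x \<in> X" if "x \<in> X" for x
      using f'X[OF that] fX[OF that] by (simp add: P'_def)
  qed
  have "x \<in> X" if "x \<in> A" for x
  proof -
    have "cyc_rel (P' True \<circ> P' False) v x" using main that by blast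
    from cyc_rel_invariant[OF this f'Xi] vX show ?thesis by simp
  qed
  then have AX: "A = X" by (auto simp: A_def)
  have pX': "?p ` X = X"
  proof (rule card_subset_eq[OF finX])
    show "?p ` X \<subseteq> X" using AX by (auto simp: A_def Y_def)
    show "card (?p ` X) = card X"
      by (rule card_image) (use permutes_inj[OF P] in \<open>auto intro: inj_on_subset\<close>)
  qed
  have "?f ` X = X"
  proof (rule card_subset_eq[OF finX])
    show "?f ` X \<subseteq> X" using fX by blast
    show "card (?f ` X) = card X"
      by (rule card_image) (use permutes_inj[OF fV] in \<open>auto intro: inj_on_subset\<close>)
  qed
  then have sX': "?s ` X = X" using pX' by (metis image_comp)
  have "P d ` X = X" for d using sX' pX' by (cases d) auto
  moreover have "cycle_of ?f x = X" if "x \<in> X" for x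
    using that cycle_of_eq_iff[of ?f v x] by (simp add: X_def cycle_of_def)
  moreover have "ncyc X (P True) + ncyc X (P False) = Suc (card X)"
  proof -
    have "ncyc X (P' d) = ncyc X (P d)" for d
      by (rule ncyc_cong) (use rel AX in auto)
    then show ?thesis using main AX by simp
  qed
  ultimately show ?thesis using finX vX unfolding tree_cycle_def X_def[symmetric] by blast
qed

section \<open>Counting pairs of permutations with a lollipop\<close>

definition perms :: "'a set \<Rightarrow> nat \<Rightarrow> ('a \<Rightarrow> 'a) set" where
  "perms V m = {f. f permutes V \<and> ncyc V f = m}"

lemma finite_perms: "finite V \<Longrightarrow> finite (perms V m)"
  unfolding perms_def by (rule finite_subset[OF _ finite_permutations]) auto

lemma perms_permutation: "finite V \<Longrightarrow> f \<in> perms V m \<Longrightarrow> permutation f"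
  by (auto simp: perms_def permutation_permutes)

lemma ncyc_insert_fixed:
  assumes "f i = i" "inj f" "finite A" "i \<notin> A"
  shows "ncyc (insert i A) f = Suc (ncyc A f)"
proof -
  have "cycle_of f i \<notin> cycle_of f ` A"
  proof
    assume "cycle_of f i \<in> cycle_of f ` A"
    then obtain x where "x \<in> A" "cyc_rel f i x" by (auto simp: cycle_of_eq_iff)
    then show False using cyc_rel_fixed[OF assms(1) _ assms(2), of x] assms(4) by simp
  qed
  then show ?thesis using assms(3) unfolding ncyc_def image_insert by simp
qed

text \<open>
  The recursion of the Stirling numbers: a new point \<open>a\<close> is either a fixed point or is inserted into the
  cycle of one of the old points \<open>b\<close>.
\<close>

lemma card_perms:
  assumes "finite V"
  shows "card (perms V m) = stirling (card V) m"
  using assms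
proof (induction V arbitrary: m rule: finite_induct)
  case empty
  have "perms ({}::'a set) m = (if m = 0 then {id} else {})"
    by (auto simp: perms_def ncyc_def)
  then show ?case by (cases m) auto
next
  case (insert a S)
  \<comment> \<open>Inserts \<open>a\<close> into the cycle of \<open>b\<close>; for \<open>b = a\<close> it stays a fixed
    point.\<close>
  define h where "h = (\<lambda>(q :: 'a \<Rightarrow> 'a, b). q \<circ> swap a b)"
  have inv_h: "inv (h (q, b)) a = b" and undo: "h (h (q, b), b) = q"
    if "q permutes S" for q b
  proof -
    have "h (q, b) b = a" using permutes_not_in[OF that insert.hyps(2)] by (simp add: h_def)
    moreover have "bij (h (q, b))"
      unfolding h_def using permutes_bij[OF that] by (auto intro!: bij_comp)
    ultimately show "inv (h (q, b)) a = b" by (metis bij_inv_eq_iff)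
    show "h (h (q, b), b) = q" by (simp add: h_def comp_assoc)
  qed
  have inj: "inj_on h ({q. q permutes S} \<times> insert a S)"
  proof (rule inj_onI, clarify)
    fix q b q' b'
    assume q: "q permutes S" "q' permutes S" and eq: "h (q, b) = h (q', b')"
    have "b = b'" using inv_h[OF q(1), of b] inv_h[OF q(2), of b'] eq by metis
    then show "q = q' \<and> b = b'" using undo[OF q(1), of b] undo[OF q(2), of b'] eq by metis
  qed
  have ins: "q permutes insert a S" if "q permutes S" for q
    using that by (rule permutes_subset) auto
  have hp: "h (q, b) permutes insert a S" if "q permutes S" "b \<in> insert a S" for q b
    unfolding h_def prod.case using ins[OF that(1)] that(2) by (intro permutes_compose permutes_swap_id) auto
  have val: "ncyc (insert a S) (h (q, b)) = (if b = a then Suc (ncyc S q) else ncyc S q)"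
    if q: "q permutes S" and b: "b \<in> insert a S" for q b
  proof -
    have qa: "q a = a" using permutes_not_in[OF q insert.hyps(2)] .
    have fx: "ncyc (insert a S) q = Suc (ncyc S q)"
      by (rule ncyc_insert_fixed[OF qa permutes_inj[OF q] insert.hyps])
    show ?thesis
    proof (cases "b = a")
      case True
      then show ?thesis using fx by (simp add: h_def)
    next
      case False
      have "\<not> cyc_rel q a b" using cyc_rel_fixed[OF qa _ permutes_inj[OF q]] False by blast
      moreover have "permutation q" using q insert.hyps by (auto simp: permutation_permutes)
      ultimately have "ncyc (insert a S) q = Suc (ncyc (insert a S) (h (q, b)))"
        unfolding h_def prod.case using b insert.hyps by (intro ncyc_join) auto
      then show ?thesis using fx False by simp
    qed
  qed
  have surj: "\<exists>q b. q permutes S \<and> b \<in> insert a S \<and> f = h (q, b)" if f: "f permutes insert a S" for f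
  proof -
    have bij: "bij f" using permutes_bij[OF f] .
    have b: "inv f a \<in> insert a S" using f by (metis insertI1 permutes_in_image permutes_inv)
    then have "skip a f permutes insert a S"
      unfolding skip_def using f by (intro permutes_compose permutes_swap_id) auto
    then have "skip a f permutes S"
      by (rule permutes_superset) (use skip_self[OF bij] in auto)
    moreover have "f = h (skip a f, inv f a)" by (simp add: h_def skip_def comp_assoc)
    ultimately show ?thesis using b by blast
  qed
  show ?case
  proof (cases m)
    case 0
    have "perms (insert a S) m = {}"
      using ncyc_pos[of "insert a S"] insert.hyps by (auto simp: perms_def 0)
    then show ?thesis using insert.hyps by (simp add: 0)
  next
    case (Suc k)
    have eq: "perms (insert a S) m = h ` ((perms S k \<times> {a}) \<union> (perms S m \<times> S))"
    proof
      show "perms (insert a S) m \<subseteq> h ` ((perms S k \<times> {a}) \<union> (perms S m \<times> S))"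
      proof
        fix f assume f: "f \<in> perms (insert a S) m"
        then obtain q b where qb: "q permutes S" "b \<in> insert a S" "f = h (q, b)"
          using surj[of f] unfolding perms_def by blast
        then have "(q, b) \<in> (perms S k \<times> {a}) \<union> (perms S m \<times> S)"
          using f val[OF qb(1,2)] Suc by (auto simp: perms_def split: if_splits)
        then show "f \<in> h ` ((perms S k \<times> {a}) \<union> (perms S m \<times> S))" using qb(3) by blast
      qed
      show "h ` ((perms S k \<times> {a}) \<union> (perms S m \<times> S)) \<subseteq> perms (insert a S) m"
        using val hp insert.hyps(2) by (auto simp: perms_def Suc)
    qed
    have "card (perms (insert a S) m) = card ((perms S k \<times> {a}) \<union> (perms S m \<times> S))"
      unfolding eq by (intro card_image inj_on_subset[OF inj]) (auto simp: perms_def)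
    also have "\<dots> = card (perms S k \<times> {a}) + card (perms S m \<times> S)"
      using insert.hyps by (intro card_Un_disjoint) (auto simp: finite_perms)
    also have "\<dots> = stirling (card S) k + card S * stirling (card S) m"
      by (simp add: card_cartesian_product insert.IH)
    finally show ?thesis using insert.hyps by (simp add: Suc)
  qed
qed

text \<open>
  The two points of each pair share a cycle, and different pairs belong to different cycles.
\<close>

definition separated :: "('a \<Rightarrow> 'a) \<Rightarrow> ('a \<times> 'a) set \<Rightarrow> bool" where
  "separated f T \<longleftrightarrow> (\<forall>(a, b)\<in>T. cyc_rel f a b \<and> a \<noteq> b) \<and>
     (\<forall>(a, b)\<in>T. \<forall>(c, d)\<in>T. cyc_rel f a c \<longrightarrow> (a, b) = (c, d))"

lemma separatedI:
  assumes "\<And>a b. (a, b) \<in> T \<Longrightarrow> cyc_rel f a b \<and> a \<noteq> b"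
    "\<And>a b c d. (a, b) \<in> T \<Longrightarrow> (c, d) \<in> T \<Longrightarrow> cyc_rel f a c \<Longrightarrow> a = c \<and> b = d"
  shows "separated f T"
  unfolding separated_def using assms by auto

lemma
  assumes "separated f T" "(a, b) \<in> T"
  shows separatedD1: "cyc_rel f a b" "a \<noteq> b"
    and separatedD2: "(c, d) \<in> T \<Longrightarrow> cyc_rel f a c \<Longrightarrow> a = c \<and> b = d"
  using assms unfolding separated_def by auto

lemma separated_insert:
  assumes "separated f T" "cyc_rel f a b" "a \<noteq> b" "\<And>c d. (c, d) \<in> T \<Longrightarrow> \<not> cyc_rel f a c"
  shows "separated f (insert (a, b) T)"
proof (rule separatedI)
  show "cyc_rel f x y \<and> x \<noteq> y" if "(x, y) \<in> insert (a, b) T" for x y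
    using that assms(2,3) separatedD1[OF assms(1)] by blast
  have *: "\<not> cyc_rel f c a" if "(c, d) \<in> T" for c d using assms(4)[OF that] cyc_rel_sym by metis
  show "x = c \<and> y = d"
    if "(x, y) \<in> insert (a, b) T" "(c, d) \<in> insert (a, b) T" "cyc_rel f x c" for x y c d
    using that assms(4) * separatedD2[OF assms(1)] by blast
qed

lemma cyc_rel_away:
  assumes "permutation f" "cyc_rel f a b" "a \<noteq> b" "\<not> cyc_rel f a x"
  shows "cyc_rel (f \<circ> swap a b) x y \<longleftrightarrow> cyc_rel f x y"
    and "\<not> cyc_rel (f \<circ> swap a b) a x"
    and "\<not> cyc_rel (f \<circ> swap a b) b x"
proof -
  let ?g = "f \<circ> swap a b"
  note s = cyc_rel_split[OF assms(1-3)]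
  have sub: "cyc_rel ?g u v \<Longrightarrow> cyc_rel f u v" for u v using s[of u v] by blast
  show na: "\<not> cyc_rel ?g a x" using assms(4) sub by blast
  show nb: "\<not> cyc_rel ?g b x" using assms(2,4) sub cyc_rel_trans by metis
  show "cyc_rel ?g x y \<longleftrightarrow> cyc_rel f x y"
    using s[of x y] na nb cyc_rel_sym by metis
qed

lemma separated_split:
  assumes f: "permutation f" and ab: "cyc_rel f a b" "a \<noteq> b"
    and T: "separated f T" "\<And>c d. (c, d) \<in> T \<Longrightarrow> \<not> cyc_rel f a c"
  shows "separated (f \<circ> swap a b) T"
proof (rule separatedI)
  have away: "cyc_rel (f \<circ> swap a b) c y \<longleftrightarrow> cyc_rel f c y" if "(c, d) \<in> T" for c d y
    by (rule cyc_rel_away(1)[OF f ab T(2)[OF that]])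
  show "cyc_rel (f \<circ> swap a b) c d \<and> c \<noteq> d" if "(c, d) \<in> T" for c d
    using separatedD1[OF T(1) that] away[OF that] by blast
  show "x = c \<and> y = d"
    if "(x, y) \<in> T" "(c, d) \<in> T" "cyc_rel (f \<circ> swap a b) x c" for x y c d
    using separatedD2[OF T(1) that(1,2)] away[OF that(1)] that(3) by blast
qed

text \<open>
  Multiplying by the transpositions of all pairs splits one cycle per pair, and the multiplication is
  injective. Hence the number of permutations with separated pairs is at most the number of permutations
  with correspondingly more cycles.
\<close>

lemma card_separated_le:
  assumes V: "finite V" and T: "finite T" "T \<subseteq> V \<times> V"
  shows "card {f \<in> perms V m. separated f T} \<le> stirling (card V) (m + card T)"
  using T
proof (induction T arbitrary: m rule: finite_induct)
  case empty
  have "card {f \<in> perms V m. separated f {}} \<le> card (perms V m)"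
    by (intro card_mono finite_perms V) auto
  then show ?case by (simp add: card_perms[OF V])
next
  case (insert p T)
  obtain a b where p: "p = (a, b)" by (cases p)
  let ?h = "\<lambda>f. f \<circ> swap a b"
  have "?h ` {f \<in> perms V m. separated f (insert p T)} \<subseteq> {f \<in> perms V (Suc m). separated f T}"
  proof (clarify, intro CollectI conjI)
    fix f assume f: "f \<in> perms V m" and s: "separated f (insert p T)"
    have pT: "(a, b) \<in> insert p T" by (simp add: p)
    have ab: "cyc_rel f a b" "a \<noteq> b" using separatedD1[OF s pT] by auto
    have away: "\<not> cyc_rel f a c" if "(c, d) \<in> T" for c d
      using separatedD2[OF s pT, of c d] that insert.hyps(2) p by blast
    have sT: "separated f T" using s by (auto simp: separated_def)
    have perm: "permutation f" by (rule perms_permutation[OF V f])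
    have V': "a \<in> V" "b \<in> V" using insert.prems p by auto
    show "?h f \<in> perms V (Suc m)"
      using f V' ncyc_split[OF perm ab V' V] by (auto simp: perms_def intro!: permutes_compose permutes_swap_id)
    show "separated (?h f) T" by (rule separated_split[OF perm ab sT away])
  qed
  moreover have "inj_on ?h {f \<in> perms V m. separated f (insert p T)}"
    by (rule inj_onI) (metis comp_transpose_twice)
  ultimately have "card {f \<in> perms V m. separated f (insert p T)} \<le> card {f \<in> perms V (Suc m). separated f T}"
    by (intro card_inj_on_le[of ?h]) (auto simp: finite_perms V)
  also have "\<dots> \<le> stirling (card V) (Suc m + card T)"
    using insert.IH[of "Suc m"] insert.prems by auto
  finally show ?case using insert.hyps by simp
qed

text \<open>
  A third point \<open>w\<close> in the cycle of a pair \<open>(p, q)\<close>: after the split by \<open>p\<close> and \<open>w\<close> the point \<open>q\<close> shares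
  a cycle with one of them. Either way the pairs remain separated, with \<open>(w, q)\<close> in place of \<open>(p, q)\<close> in
  the second case; this accounts for the factor 2.
\<close>

lemma card_separated_third_le:
  assumes V: "finite V" and T: "finite T" "T \<subseteq> V \<times> V" and pq: "(p, q) \<in> T"
    and w: "w \<in> V" "w \<noteq> p" "w \<noteq> q"
  shows "card {f \<in> perms V m. separated f T \<and> cyc_rel f p w} \<le> 2 * stirling (card V) (m + Suc (card T))"
proof -
  let ?h = "\<lambda>f. f \<circ> swap p w"
  define T' where "T' = insert (w, q) (T - {(p, q)})"
  let ?N = "{f \<in> perms V m. separated f T \<and> cyc_rel f p w}"
  show ?thesis
  proof (cases "(w, q) \<in> T")
    case True
    have "\<not> (separated f T \<and> cyc_rel f p w)" for f
      using separatedD2[of f T p q w q] True pq w(2) by blast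
    then have "?N = {}" by blast
    then show ?thesis by (metis card.empty le0)
  next
    case False
    have T'c: "card T' = card T" "finite T'" "T' \<subseteq> V \<times> V"
      using T pq w False card_Suc_Diff1[OF T(1) pq] by (auto simp: T'_def)
    have "?h ` ?N \<subseteq> {f \<in> perms V (Suc m). separated f T} \<union> {f \<in> perms V (Suc m). separated f T'}"
    proof (rule image_subsetI)
      fix f assume "f \<in> ?N"
      then have f: "f \<in> perms V m" and s: "separated f T" and pw: "cyc_rel f p w" by auto
      have perm: "permutation f" by (rule perms_permutation[OF V f])
      have rel: "cyc_rel f p q" "p \<noteq> q" using separatedD1[OF s pq] by auto
      have pV: "p \<in> V" using T pq by auto
      have hp: "?h f \<in> perms V (Suc m)"
        using f pV w ncyc_split[OF perm pw w(2)[symmetric] pV w(1) V]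
        by (auto simp: perms_def intro!: permutes_compose permutes_swap_id)
      have away: "\<not> cyc_rel f p c" if "(c, d) \<in> T - {(p, q)}" for c d
        using separatedD2[OF s pq, of c d] that by blast
      have sT: "separated f (T - {(p, q)})" using s by (auto simp: separated_def)
      have sh: "separated (?h f) (T - {(p, q)})"
        by (rule separated_split[OF perm pw w(2)[symmetric] sT away])
      note far = cyc_rel_away[OF perm pw w(2)[symmetric]]
      have pq_eq: "T = insert (p, q) (T - {(p, q)})" using pq by blast
      consider "cyc_rel (?h f) p q" | "cyc_rel (?h f) w q"
        using cyc_rel_split[OF perm pw w(2)[symmetric], of p q] rel cyc_rel_sym
        by (metis cyc_rel_trans)
      then show "?h f \<in> {f \<in> perms V (Suc m). separated f T} \<union> {f \<in> perms V (Suc m). separated f T'}"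
      proof cases
        case 1
        have "separated (?h f) (insert (p, q) (T - {(p, q)}))"
          by (rule separated_insert[OF sh 1 rel(2)]) (use far(2) away in blast)
        then show ?thesis using hp pq_eq by simp
      next
        case 2
        have "separated (?h f) T'"
          unfolding T'_def by (rule separated_insert[OF sh 2 w(3)]) (use far(3) away in blast)
        then show ?thesis using hp by simp
      qed
    qed
    moreover have "inj_on ?h ?N" by (rule inj_onI) (metis comp_transpose_twice)
    ultimately have "card ?N \<le> card ({f \<in> perms V (Suc m). separated f T} \<union> {f \<in> perms V (Suc m). separated f T'})"
      by (intro card_inj_on_le[of ?h]) (auto simp: finite_perms V)
    also have "\<dots> \<le> card {f \<in> perms V (Suc m). separated f T} + card {f \<in> perms V (Suc m). separated f T'}"
      by (rule card_Un_le)
    also have "\<dots> \<le> stirling (card V) (Suc m + card T) + stirling (card V) (Suc m + card T')"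
      by (intro add_mono card_separated_le V T T'c)
    finally show ?thesis by (simp add: T'c)
  qed
qed

text \<open>
  The last step of a lollipop. The cycle that is visited again either contains one of the pairs, or it
  yields a new separated pair \<open>(w, u)\<close>.
\<close>

lemma card_closing_le:
  assumes V: "finite V" and T: "finite T" "T \<subseteq> U \<times> U" and U: "U \<subseteq> V" and w: "w \<in> V" "w \<notin> U"
  shows "card {f \<in> perms V m. separated f T \<and> (\<exists>u\<in>U. cyc_rel f w u)}
    \<le> (2 * card T + card U) * stirling (card V) (m + Suc (card T))"
proof -
  let ?A = "\<lambda>(p, q). {f \<in> perms V m. separated f T \<and> cyc_rel f p w}"
  let ?B = "\<lambda>u. {f \<in> perms V m. separated f (insert (w, u) T)}"
  have finU: "finite U" using U V finite_subset by blast
  have TV: "T \<subseteq> V \<times> V" using T U by blast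
  have "{f \<in> perms V m. separated f T \<and> (\<exists>u\<in>U. cyc_rel f w u)} \<subseteq> (\<Union>t\<in>T. ?A t) \<union> (\<Union>u\<in>U. ?B u)"
  proof
    fix f assume "f \<in> {f \<in> perms V m. separated f T \<and> (\<exists>u\<in>U. cyc_rel f w u)}"
    then obtain u where f: "f \<in> perms V m" "separated f T" "u \<in> U" "cyc_rel f w u" by auto
    show "f \<in> (\<Union>t\<in>T. ?A t) \<union> (\<Union>u\<in>U. ?B u)"
    proof (cases "\<exists>p q. (p, q) \<in> T \<and> cyc_rel f p w")
      case True
      then show ?thesis using f by blast
    next
      case False
      have "separated f (insert (w, u) T)"
      proof (rule separated_insert[OF f(2,4)])
        show "w \<noteq> u" using w f by auto
        show "\<not> cyc_rel f w c" if "(c, d) \<in> T" for c d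
          using False that cyc_rel_sym by metis
      qed
      then show ?thesis using f by blast
    qed
  qed
  then have "card {f \<in> perms V m. separated f T \<and> (\<exists>u\<in>U. cyc_rel f w u)}
    \<le> card ((\<Union>t\<in>T. ?A t) \<union> (\<Union>u\<in>U. ?B u))"
    using T finU finite_perms[OF V] by (intro card_mono) auto
  also have "\<dots> \<le> card (\<Union>t\<in>T. ?A t) + card (\<Union>u\<in>U. ?B u)" by (rule card_Un_le)
  also have "\<dots> \<le> (\<Sum>t\<in>T. card (?A t)) + (\<Sum>u\<in>U. card (?B u))"
    using T finU by (intro add_mono card_UN_le) auto
  also have "\<dots> \<le> (\<Sum>t\<in>T. 2 * stirling (card V) (m + Suc (card T))) +
      (\<Sum>u\<in>U. stirling (card V) (m + Suc (card T)))"
  proof (intro add_mono sum_mono)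
    fix t assume t: "t \<in> T"
    then obtain p q where "t = (p, q)" "p \<in> U" "q \<in> U" using T by blast
    then show "card (?A t) \<le> 2 * stirling (card V) (m + Suc (card T))"
      using card_separated_third_le[OF V T(1) TV, of p q w m] t w by auto
  next
    fix u assume u: "u \<in> U"
    have "card (?B u) \<le> stirling (card V) (m + card (insert (w, u) T))"
      using u U w TV T by (intro card_separated_le V) auto
    moreover have "(w, u) \<notin> T" using T w by blast
    ultimately show "card (?B u) \<le> stirling (card V) (m + Suc (card T))" using T by simp
  qed
  finally show ?thesis by (simp add: algebra_simps)
qed

fun steps :: "bool \<Rightarrow> bool \<Rightarrow> 'a list \<Rightarrow> ('a \<times> 'a) list" where
  "steps d c (w # v # vs) = (if d = (\<not> c) then [(v, w)] else []) @ steps d (\<not> c) (v # vs)"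
| "steps d c _ = []"

lemma steps_subset: "set (steps d c vs) \<subseteq> set vs \<times> set vs"
  by (induction d c vs rule: steps.induct) auto

lemma steps_same_subset: "set (steps c c (v # vs)) \<subseteq> set vs \<times> set vs"
proof (cases vs)
  case (Cons u us)
  then show ?thesis using steps_subset[of c "\<not> c" "u # us"] by simp
qed simp

lemma length_steps: "length (steps c c vs) + length (steps (\<not> c) c vs) = length vs - 1"
proof (induction vs arbitrary: c rule: induct_list012)
  case (3 w v vs)
  from "3.IH"(2)[of "\<not> c"] show ?case by simp
qed auto

lemma distinct_steps: "distinct vs \<Longrightarrow> distinct (steps d c vs)"
proof (induction vs arbitrary: c rule: induct_list012)
  case (3 w v vs)
  have "(v, w) \<notin> set (steps d (\<not> c) (v # vs))" using steps_subset[of d "\<not> c" "v # vs"] "3.prems" by auto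
  moreover have "distinct (steps d (\<not> c) (v # vs))" by (rule "3.IH"(2)) (use "3.prems" in auto)
  ultimately show ?case by (cases "d = (\<not> c)") (simp_all del: not_not)
qed auto

lemma simple_path_separated:
  assumes "simple_path (cyc_rels P) c vs"
  shows "separated (P d) (set (steps d c vs))"
  using assms
proof (induction vs arbitrary: c rule: induct_list012)
  case (3 w v vs)
  have IH: "separated (P d) (set (steps d (\<not> c) (v # vs)))"
    using 3 by auto
  show ?case
  proof (cases "d = (\<not> c)")
    case True
    have "separated (P d) (insert (v, w) (set (steps d (\<not> c) (v # vs))))"
    proof (rule separated_insert[OF IH])
      show "cyc_rel (P d) v w" "v \<noteq> w" using "3.prems" True by auto
      fix a b assume "(a, b) \<in> set (steps d (\<not> c) (v # vs))"
      then have "a \<in> set vs" using steps_same_subset[of "\<not> c" v vs] unfolding True by auto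
      then show "\<not> cyc_rel (P d) v a" using "3.prems" True by (cases vs) auto
    qed
    then show ?thesis using True by simp
  next
    case False
    then show ?thesis using IH by simp
  qed
qed (auto simp: separated_def)

definition perm_pair :: "('a \<Rightarrow> 'a) \<Rightarrow> ('a \<Rightarrow> 'a) \<Rightarrow> bool \<Rightarrow> 'a \<Rightarrow> 'a" where
  "perm_pair s p d = (if d then s else p)"

text \<open>
  In the cycles of kind \<open>c\<close> the step to \<open>w\<close> is one more separated pair; in the cycles of the other kind
  \<open>w\<close> closes the loop.
\<close>

lemma lollipop_separated:
  assumes "lollipop (cyc_rels P) c w vs"
  shows "separated (P c) (insert (hd vs, w) (set (steps c c vs)))"
    and "separated (P (\<not> c)) (set (steps (\<not> c) c vs))"
    and "\<exists>u\<in>set vs. cyc_rel (P (\<not> c)) w u"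
    and "distinct (w # vs)"
proof -
  have sp: "simple_path (cyc_rels P) c vs" and hw: "cyc_rel (P c) (hd vs) w" "hd vs \<noteq> w"
    using assms by (auto simp: lollipop_def)
  obtain x xs where vs: "vs = x # xs" using sp by (cases vs) auto
  have fresh: "\<not> cyc_rel (P c) x u" if "u \<in> set xs" for u
    using sp that by (cases xs) (auto simp: vs)
  show "separated (P c) (insert (hd vs, w) (set (steps c c vs)))"
  proof (rule separated_insert[OF simple_path_separated[OF sp] hw])
    fix a b assume "(a, b) \<in> set (steps c c vs)"
    then have "a \<in> set xs" using steps_same_subset[of c x xs] by (auto simp: vs)
    then show "\<not> cyc_rel (P c) (hd vs) a" using fresh by (simp add: vs)
  qed
  show "separated (P (\<not> c)) (set (steps (\<not> c) c vs))" by (rule simple_path_separated[OF sp])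
  show "\<exists>u\<in>set vs. cyc_rel (P (\<not> c)) w u" using assms by (simp add: lollipop_def)
  have "w \<notin> set vs" using fresh hw by (auto simp: vs)
  then show "distinct (w # vs)" using simple_path_distinct[OF sp] by simp
qed

text \<open>
  The two permutations are chosen independently, so the bounds for the two kinds of cycles multiply.
  The \<open>L\<close> steps and the closing of the loop together split \<open>L + 1\<close> cycles.
\<close>

lemma card_lollipop_le:
  assumes V: "finite V" and sub: "set (w # vs) \<subseteq> V" and L: "length vs = L"
  obtains i j where "i + j = Suc L"
    "card {(s, p). s \<in> perms V m \<and> p \<in> perms V m \<and> lollipop (cyc_rels (perm_pair s p)) c w vs}
      \<le> stirling (card V) (m + i) * (3 * L * stirling (card V) (m + j))"
proof (cases "vs \<noteq> [] \<and> distinct (w # vs)")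
  case False
  have "\<not> lollipop (cyc_rels (perm_pair s p)) c w vs" for s p
  proof
    assume lol: "lollipop (cyc_rels (perm_pair s p)) c w vs"
    then have "vs \<noteq> []" by (auto simp: lollipop_def)
    then show False using lollipop_separated(4)[OF lol] False by blast
  qed
  then show ?thesis using that[of "Suc L" 0] by simp
next
  case True
  then obtain x xs where vs: "vs = x # xs" by (cases vs) auto
  define T1 where "T1 = insert (hd vs, w) (set (steps c c vs))"
  define T2 where "T2 = set (steps (\<not> c) c vs)"
  define A where "A = {f \<in> perms V m. separated f T1}"
  define B where "B = {f \<in> perms V m. separated f T2 \<and> (\<exists>u\<in>set vs. cyc_rel f w u)}"
  let ?lol = "{(s, p). s \<in> perms V m \<and> p \<in> perms V m \<and> lollipop (cyc_rels (perm_pair s p)) c w vs}"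
  have d: "distinct vs" "w \<notin> set vs" using True by auto
  have "(hd vs, w) \<notin> set (steps c c vs)" using d steps_subset[of c c vs] by auto
  then have c1: "card T1 = Suc (length (steps c c vs))"
    using distinct_card[OF distinct_steps[OF d(1)], of c c] by (simp add: T1_def)
  have c2: "card T2 = length (steps (\<not> c) c vs)"
    using distinct_card[OF distinct_steps[OF d(1)], of "\<not> c" c] by (simp add: T2_def)
  have ij: "card T1 + Suc (card T2) = Suc L"
    using length_steps[of c vs] L True by (simp add: c1 c2 vs)
  have A: "card A \<le> stirling (card V) (m + card T1)"
    unfolding A_def using steps_subset[of c c vs] sub
    by (intro card_separated_le V) (auto simp: T1_def vs)
  have "card B \<le> (2 * card T2 + card (set vs)) * stirling (card V) (m + Suc (card T2))"
    unfolding B_def using sub d steps_subset[of "\<not> c" c vs]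
    by (intro card_closing_le V) (auto simp: T2_def)
  also have "\<dots> \<le> 3 * L * stirling (card V) (m + Suc (card T2))"
    using ij c1 L card_length[of vs] by (intro mult_right_mono) auto
  finally have B: "card B \<le> 3 * L * stirling (card V) (m + Suc (card T2))" .
  have fin: "finite A" "finite B" by (auto simp: A_def B_def finite_perms V)
  have "card ?lol \<le> card A * card B"
  proof (cases c)
    case True
    have "?lol \<subseteq> A \<times> B"
      using lollipop_separated(1-3)[of _ c w vs] True
      by (fastforce simp: A_def B_def T1_def T2_def perm_pair_def)
    then have "card ?lol \<le> card (A \<times> B)" by (intro card_mono) (use fin in auto)
    then show ?thesis by (simp add: card_cartesian_product)
  next
    case False
    have "?lol \<subseteq> B \<times> A"
      using lollipop_separated(1-3)[of _ c w vs] False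
      by (fastforce simp: A_def B_def T1_def T2_def perm_pair_def)
    then have "card ?lol \<le> card (B \<times> A)" by (intro card_mono) (use fin in auto)
    then show ?thesis by (simp add: card_cartesian_product mult.commute)
  qed
  also have "\<dots> \<le> stirling (card V) (m + card T1) * (3 * L * stirling (card V) (m + Suc (card T2)))"
    by (intro mult_mono A B) auto
  finally show ?thesis by (rule that[OF ij])
qed

definition bad_points :: "'a set \<Rightarrow> nat \<Rightarrow> (bool \<Rightarrow> 'a \<Rightarrow> 'a) \<Rightarrow> 'a set" where
  "bad_points V L P = {v \<in> V. \<exists>c w vs. last vs = v \<and> set (w # vs) \<subseteq> V \<and> length vs = L \<and>
     lollipop (cyc_rels P) c w vs}"

lemma stirling_geometric_le:
  fixes q :: real
  assumes "real (stirling n (Suc m)) \<le> q * real (stirling n m)" "0 < stirling n m" "0 \<le> q"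
  shows "real (stirling n (m + i)) \<le> q ^ i * real (stirling n m)"
proof (induction i)
  case (Suc i)
  let ?a = "\<lambda>k. real (stirling n k)"
  have "?a m * ?a (Suc (m + i)) \<le> ?a (Suc m) * ?a (m + i)"
    using stirling_log_concave[of m "m + i" n] unfolding of_nat_mult[symmetric] of_nat_le_iff by simp
  also have "\<dots> \<le> (q * ?a m) * (q ^ i * ?a m)"
    using Suc assms by (intro mult_mono) auto
  finally have "?a m * ?a (Suc (m + i)) \<le> ?a m * (q ^ Suc i * ?a m)" by (simp add: ac_simps)
  then show ?case using assms(2) by simp
qed simp

text \<open>
  There are \<open>2 n\<^sup>L\<^sup>+\<^sup>1\<close> candidates for a lollipop, two kinds times the choices of its points, and each
  occurs for at most a fraction \<open>3 L q\<^sup>L\<^sup>+\<^sup>1\<close> of the pairs of permutations.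
\<close>

lemma sum_bad_points_le:
  assumes V: "finite V" and q: "real (stirling (card V) (Suc m)) \<le> q * real (stirling (card V) m)"
    "0 < stirling (card V) m" "0 \<le> q"
  shows "(\<Sum>(s, p)\<in>perms V m \<times> perms V m. real (card (bad_points V L (perm_pair s p))))
    \<le> 6 * real L * (real (card V) * q) ^ Suc L * (real (stirling (card V) m))\<^sup>2"
proof -
  let ?n = "card V" and ?S = "real (stirling (card V) m)"
  define I where "I = (UNIV :: bool set) \<times> V \<times> {vs. set vs \<subseteq> V \<and> length vs = L}"
  have finI: "finite I" using V by (auto simp: I_def finite_lists_length_eq)
  have cardI: "card I = 2 * ?n ^ Suc L"
    using V by (simp add: I_def card_cartesian_product card_lists_length_eq)
  let ?lol = "\<lambda>(s, p) (c, w, vs). lollipop (cyc_rels (perm_pair s p)) c w vs"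
  have finP: "finite (perms V m)" by (rule finite_perms[OF V])
  have "(\<Sum>(s, p)\<in>perms V m \<times> perms V m. real (card (bad_points V L (perm_pair s p))))
    \<le> (\<Sum>sp\<in>perms V m \<times> perms V m. real (card {i \<in> I. ?lol sp i}))"
  proof (rule sum_mono)
    fix sp :: "('a \<Rightarrow> 'a) \<times> ('a \<Rightarrow> 'a)"
    obtain s p where sp: "sp = (s, p)" by (cases sp)
    have "bad_points V L (perm_pair s p) \<subseteq> (\<lambda>(c, w, vs). last vs) ` {i \<in> I. ?lol (s, p) i}"
      by (force simp: bad_points_def I_def)
    then have "card (bad_points V L (perm_pair s p)) \<le> card ((\<lambda>(c, w, vs). last vs) ` {i \<in> I. ?lol (s, p) i})"
      using finI by (intro card_mono) auto
    also have "\<dots> \<le> card {i \<in> I. ?lol (s, p) i}" using finI by (intro card_image_le) auto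
    finally have "card (bad_points V L (perm_pair s p)) \<le> card {i \<in> I. ?lol (s, p) i}" .
    then show "(case sp of (s, p) \<Rightarrow> real (card (bad_points V L (perm_pair s p))))
        \<le> real (card {i \<in> I. ?lol sp i})"
      unfolding sp prod.case of_nat_le_iff .
  qed
  also have "\<dots> = (\<Sum>i\<in>I. real (card {sp \<in> perms V m \<times> perms V m. ?lol sp i}))"
  proof -
    have "(\<Sum>sp\<in>perms V m \<times> perms V m. card {i \<in> I. ?lol sp i}) =
      (\<Sum>i\<in>I. card {sp \<in> perms V m \<times> perms V m. ?lol sp i})"
      using finI finP by (intro sum_multicount_gen) auto
    then show ?thesis unfolding of_nat_sum[symmetric] by presburger
  qed
  also have "\<dots> \<le> (\<Sum>i\<in>I. 3 * real L * q ^ Suc L * ?S\<^sup>2)"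
  proof (rule sum_mono)
    fix i assume "i \<in> I"
    then obtain c w vs where i: "i = (c, w, vs)" "set (w # vs) \<subseteq> V" "length vs = L"
      by (auto simp: I_def)
    obtain a b where ab: "a + b = Suc L"
      "card {(s, p). s \<in> perms V m \<and> p \<in> perms V m \<and> lollipop (cyc_rels (perm_pair s p)) c w vs}
        \<le> stirling ?n (m + a) * (3 * L * stirling ?n (m + b))"
      by (rule card_lollipop_le[OF V i(2,3), where m = m and c = c])
    have lol_eq: "{sp \<in> perms V m \<times> perms V m. ?lol sp i} =
      {(s, p). s \<in> perms V m \<and> p \<in> perms V m \<and> lollipop (cyc_rels (perm_pair s p)) c w vs}"
      by (auto simp: i(1))
    have "real (card {sp \<in> perms V m \<times> perms V m. ?lol sp i})
      \<le> real (stirling ?n (m + a) * (3 * L * stirling ?n (m + b)))"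
      unfolding lol_eq of_nat_le_iff by (rule ab(2))
    also have "\<dots> = real (stirling ?n (m + a)) * (3 * real L * real (stirling ?n (m + b)))" by simp
    also have "\<dots> \<le> (q ^ a * ?S) * (3 * real L * (q ^ b * ?S))"
      using q by (intro mult_mono stirling_geometric_le) auto
    also have "\<dots> = 3 * real L * q ^ (a + b) * ?S\<^sup>2"
      by (simp add: power_add power2_eq_square ac_simps)
    finally show "real (card {sp \<in> perms V m \<times> perms V m. ?lol sp i}) \<le> 3 * real L * q ^ Suc L * ?S\<^sup>2"
      unfolding ab(1) .
  qed
  also have "\<dots> = 6 * real L * (real ?n * q) ^ Suc L * ?S\<^sup>2"
    by (simp add: cardI power_mult_distrib ac_simps)
  finally show ?thesis .
qed

section \<open>Distances and geodesics in the transposition graph\<close>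

text \<open>
  The formula for the graph distance, with the arguments in the order in which a step of a walk from \<open>x\<close>
  multiplies \<open>inv y \<circ> x\<close> by a transposition on the right; see \<open>graph_dist_cayley_dist\<close>.
\<close>

definition cayley_dist :: "nat \<Rightarrow> (nat \<Rightarrow> nat) \<Rightarrow> (nat \<Rightarrow> nat) \<Rightarrow> nat" where
  "cayley_dist n x y = n - ncyc {1..n} (inv y \<circ> x)"

lemma ncyc_inv: "bij f \<Longrightarrow> ncyc A (inv f) = ncyc A f"
  by (rule ncyc_cong) (simp add: cyc_rel_inv)

lemma cayley_dist_sym:
  assumes "x permutes {1..n}" "y permutes {1..n}"
  shows "cayley_dist n x y = cayley_dist n y x"
proof -
  have b: "bij x" "bij y" using assms by (auto intro: permutes_bij)
  have "inv (inv y \<circ> x) = inv x \<circ> y"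
    using b by (simp add: o_inv_distrib bij_imp_bij_inv inv_inv_eq)
  then show ?thesis
    unfolding cayley_dist_def using ncyc_inv[of "inv y \<circ> x"] b by (metis bij_comp bij_imp_bij_inv)
qed

lemma wf_transposition_graph: "wf_digraph (with_proj (transposition_graph n))"
proof -
  interpret pair_graph "transposition_graph n" by (rule transposition_graph)
  show ?thesis by (rule wf_digraph)
qed

text \<open>
  Each step of a walk changes the number of cycles by one, and the identity has \<open>n\<close> cycles.
\<close>

lemma walk_length_ge:
  assumes "walk_between n x q y" "y permutes {1..n}"
  shows "n \<le> ncyc {1..n} (inv y \<circ> x) + length q"
proof -
  interpret wf_digraph "with_proj (transposition_graph n)" by (rule wf_transposition_graph)
  from assms show ?thesis
  proof (induction q arbitrary: x)
    case Nil
    then have "x = y" by (simp add: awalk_Nil_iff)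
    then have "inv y \<circ> x = id" using permutes_inv_o(2)[OF Nil(2)] by simp
    then show ?case using ncyc_id[of "{1..n}"] by (simp only: card_atLeastAtMost finite_atLeastAtMost)
  next
    case (Cons e q)
    then have e: "e \<in> arcs (with_proj (transposition_graph n))" and xe: "x = fst e" and
      w: "walk_between n (snd e) q y"
      by (simp_all add: awalk_Cons_iff)
    obtain i j where ij: "x permutes {1..n}" "i \<in> {1..n}" "j \<in> {1..n}" "i \<noteq> j"
      "snd e = x \<circ> swap i j"
      using e xe by (cases e) (auto simp: transposition_graph_def)
    let ?f = "inv y \<circ> x"
    have "?f permutes {1..n}" using ij(1) Cons.prems(2) by (intro permutes_compose permutes_inv)
    then have perm: "permutation ?f" using finite_atLeastAtMost by (auto simp: permutation_permutes)
    have step: "ncyc {1..n} (inv y \<circ> snd e) \<le> Suc (ncyc {1..n} ?f)"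
    proof (cases "cyc_rel ?f i j")
      case True
      then show ?thesis using ncyc_split[OF perm True ij(4,2,3)] by (simp add: ij(5) comp_assoc)
    next
      case False
      then show ?thesis using ncyc_join[OF perm False ij(2,3)] by (simp add: ij(5) comp_assoc)
    qed
    have "n \<le> ncyc {1..n} (inv y \<circ> snd e) + length q"
      by (rule Cons.IH[OF w Cons.prems(2)])
    then show ?case using step unfolding length_Cons by linarith
  qed
qed

text \<open>
  As long as \<open>inv y \<circ> x\<close> moves a point \<open>i\<close>, the transposition of \<open>i\<close> with its image splits a cycle.
\<close>

lemma walk_exists:
  assumes "x permutes {1..n}" "y permutes {1..n}"
  shows "\<exists>q. walk_between n x q y \<and> length q = cayley_dist n x y"
  using assms(1)
proof (induction "cayley_dist n x y" arbitrary: x rule: less_induct)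
  case less
  interpret wf_digraph "with_proj (transposition_graph n)" by (rule wf_transposition_graph)
  let ?f = "inv y \<circ> x"
  have f: "?f permutes {1..n}" using less.prems assms(2) by (intro permutes_compose permutes_inv)
  show ?case
  proof (cases "?f = id")
    case True
    then have "y \<circ> ?f = y" by simp
    then have "x = y" using permutes_inv_o(1)[OF assms(2)] by (simp add: comp_assoc[symmetric])
    moreover have "y \<in> verts (with_proj (transposition_graph n))"
      using assms(2) by (simp add: transposition_graph_def)
    then have "walk_between n y [] y" by (simp add: awalk_Nil_iff)
    moreover have "cayley_dist n y y = 0" using permutes_inv_o(2)[OF assms(2)] by (simp add: cayley_dist_def)
    ultimately show ?thesis by (intro exI[of _ "[]"]) simp
  next
    case False
    then obtain i where i: "?f i \<noteq> i" by fastforce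
    have iV: "i \<in> {1..n}" using permutes_not_in[OF f] i by blast
    define j where "j = ?f i"
    have jV: "j \<in> {1..n}" using permutes_in_image[OF f] iV by (simp only: j_def)
    have ij: "i \<noteq> j" using i by (simp add: j_def)
    have perm: "permutation ?f" using f finite_atLeastAtMost by (auto simp: permutation_permutes)
    have rel: "cyc_rel ?f i j" unfolding j_def by (rule cyc_rel_step)
    define x' where "x' = x \<circ> swap i j"
    have x': "x' permutes {1..n}"
      unfolding x'_def by (rule permutes_comp_transpose[OF less.prems iV jV])
    have "ncyc {1..n} (inv y \<circ> x') = Suc (ncyc {1..n} ?f)"
      using ncyc_split[OF perm rel ij iV jV] by (simp add: x'_def comp_assoc)
    moreover have "ncyc {1..n} (inv y \<circ> x') \<le> n" using ncyc_le_card[of "{1..n}"] by simp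
    ultimately have c: "cayley_dist n x y = Suc (cayley_dist n x' y)" by (simp add: cayley_dist_def)
    then obtain q where q: "walk_between n x' q y" "length q = cayley_dist n x' y"
      using less.hyps[of x'] x' by auto
    have "(x, x') \<in> parcs (transposition_graph n)"
      unfolding transposition_graph_def pair_pre_digraph.simps x'_def
      using less.prems iV jV ij by blast
    then have "walk_between n x ((x, x') # q) y"
      using q by (simp add: awalk_Cons_iff)
    then show ?thesis using q c by (intro exI[of _ "(x, x') # q"]) simp
  qed
qed

lemma geodesic_iff:
  assumes "x permutes {1..n}" "y permutes {1..n}"
  shows "geodesic n x g y \<longleftrightarrow> walk_between n x g y \<and> length g = cayley_dist n x y"
proof -
  have ge: "cayley_dist n x y \<le> length q" if "walk_between n x q y" for q
    using walk_length_ge[OF that assms(2)] by (simp add: cayley_dist_def)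
  obtain q where q: "walk_between n x q y" "length q = cayley_dist n x y"
    using walk_exists[OF assms] by blast
  show ?thesis
    unfolding geodesic_def is_arg_min_def using ge q by (metis le_antisym not_less)
qed

lemma graph_dist_cayley_dist:
  assumes "x permutes {1..n}" "y permutes {1..n}"
  shows "graph_dist n x y = real (cayley_dist n x y)"
  using graph_dist_attained[OF assms] geodesic_iff[OF assms] by metis

lemma graph_dist_le_walk:
  assumes "walk_between n x q y" "x permutes {1..n}" "y permutes {1..n}"
  shows "graph_dist n x y \<le> real (length q)"
  using walk_length_ge[OF assms(1,3)] graph_dist_cayley_dist[OF assms(2,3)] by (simp add: cayley_dist_def)

lemma graph_dist_sym:
  assumes "x permutes {1..n}" "y permutes {1..n}"
  shows "graph_dist n x y = graph_dist n y x"
  using assms by (simp add: graph_dist_cayley_dist cayley_dist_sym[of x n y])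

lemma graph_dist_triangle:
  assumes "x permutes {1..n}" "y permutes {1..n}" "z permutes {1..n}"
  shows "graph_dist n x z \<le> graph_dist n x y + graph_dist n y z"
proof -
  interpret wf_digraph "with_proj (transposition_graph n)" by (rule wf_transposition_graph)
  obtain p q where "walk_between n x p y" "length p = cayley_dist n x y"
    "walk_between n y q z" "length q = cayley_dist n y z"
    using walk_exists assms by metis
  then have "graph_dist n x z \<le> real (length (p @ q))"
    using assms by (intro graph_dist_le_walk awalk_appendI)
  then show ?thesis
    using assms \<open>length p = _\<close> \<open>length q = _\<close> by (simp add: graph_dist_cayley_dist)
qed

lemma graph_dist_ncyc:
  assumes "x permutes {1..n}" "y permutes {1..n}"
  shows "graph_dist n x y = real n - real (ncyc {1..n} (inv x \<circ> y))"
proof -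
  have "ncyc {1..n} (inv x \<circ> y) \<le> n" using ncyc_le_card[of "{1..n}"] by simp
  then show ?thesis
    using graph_dist_cayley_dist[OF assms] cayley_dist_sym[OF assms] by (simp add: cayley_dist_def of_nat_diff)
qed

lemma walk_verts_permute:
  assumes "walk_between n x g y" "w \<in> set (pre_digraph.awalk_verts (with_proj (transposition_graph n)) x g)"
  shows "w permutes {1..n}"
proof -
  interpret wf_digraph "with_proj (transposition_graph n)" by (rule wf_transposition_graph)
  have "w \<in> verts (with_proj (transposition_graph n))"
    using awalk_verts_in_verts[of x g w] awalkE[OF assms(1)] assms(2) by blast
  then show ?thesis by (simp add: transposition_graph_def)
qed

lemma dist_to_walk_le:
  assumes "walk_between n x g y" "w \<in> set (pre_digraph.awalk_verts (with_proj (transposition_graph n)) x g)"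
  shows "dist_to_walk n p x g \<le> graph_dist n p w"
  unfolding dist_to_walk_def using assms(2) by (intro Min_le) auto

lemma geodesic_through:
  assumes x: "x permutes {1..n}" and y: "y permutes {1..n}" and z: "z permutes {1..n}"
    and split: "graph_dist n x z + graph_dist n z y \<le> graph_dist n x y"
  shows "\<exists>g. geodesic n x g y \<and> dist_to_walk n id x g \<le> graph_dist n id z"
proof -
  interpret wf_digraph "with_proj (transposition_graph n)" by (rule wf_transposition_graph)
  obtain p q where pq: "walk_between n x p z" "length p = cayley_dist n x z"
    "walk_between n z q y" "length q = cayley_dist n z y"
    using walk_exists assms by metis
  have w: "walk_between n x (p @ q) y" using pq by (intro awalk_appendI)
  have "real (length (p @ q)) \<le> real (cayley_dist n x y)"
    using split pq graph_dist_cayley_dist assms by simp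
  moreover have "cayley_dist n x y \<le> length (p @ q)"
    using walk_length_ge[OF w y] by (simp add: cayley_dist_def)
  ultimately have "geodesic n x (p @ q) y"
    unfolding geodesic_iff[OF x y] using w by simp
  moreover have "z \<in> set (awalk_verts z q)"
    using pq(3) set_awalk_verts[OF pq(3)] by blast
  then have "dist_to_walk n id x (p @ q) \<le> graph_dist n id z"
    using set_awalk_verts_append[OF pq(1,3)] by (intro dist_to_walk_le[OF w]) blast
  ultimately show ?thesis by blast
qed

text \<open>
  The triangle inequality at a vertex \<open>w\<close> of the geodesic, whose distances to the two ends add up to the
  distance between the ends.
\<close>

lemma gromov_product_le_dist_to_geodesic:
  assumes x: "x permutes {1..n}" and y: "y permutes {1..n}" and g: "geodesic n x g y"
  shows "gromov_product n id x y \<le> dist_to_walk n id x g"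
proof -
  interpret wf_digraph "with_proj (transposition_graph n)" by (rule wf_transposition_graph)
  have gw: "walk_between n x g y" "length g = cayley_dist n x y" using g unfolding geodesic_iff[OF x y] by auto
  have id: "id permutes {1..n}" by (rule permutes_id)
  have main: "gromov_product n id x y \<le> graph_dist n id w"
    if w: "w \<in> set (awalk_verts x g)" for w
  proof -
    have wp: "w permutes {1..n}" by (rule walk_verts_permute[OF gw(1) w])
    obtain q r where qr: "g = q @ r" "awalk x q w" "awalk w r y"
      using awalk_decomp[OF gw(1) w] by blast
    have "graph_dist n x w + graph_dist n w y \<le> real (length q) + real (length r)"
      using qr wp x y by (intro add_mono graph_dist_le_walk)
    also have "\<dots> = graph_dist n x y"
      using gw(2) qr(1) graph_dist_cayley_dist[OF x y] by simp
    finally show ?thesis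
      using graph_dist_triangle[OF x wp id] graph_dist_triangle[OF y wp id]
        graph_dist_sym[OF wp id] graph_dist_sym[OF wp y]
      by (simp add: gromov_product_def)
  qed
  have ne: "set (awalk_verts x g) \<noteq> {}" using set_awalk_verts[OF gw(1)] by simp
  show ?thesis
    unfolding dist_to_walk_def using ne main by (subst Min_ge_iff) auto
qed

lemma gromov_product_through:
  assumes x: "x permutes {1..n}" and y: "y permutes {1..n}" and z: "z permutes {1..n}"
    and split: "graph_dist n x z + graph_dist n z y \<le> graph_dist n x y"
  shows "gromov_product n id x y \<le> graph_dist n id z"
  using geodesic_through[OF assms] gromov_product_le_dist_to_geodesic[OF x y] by force

lemma sphere_eq_perms:
  assumes "0 < a" "a < 1"
  shows "sphere a n = perms {1..n} (n - nat \<lfloor>a * real n\<rfloor>)"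
proof -
  have fl: "0 \<le> \<lfloor>a * real n\<rfloor>" using assms by simp
  have "a * real n \<le> 1 * real n" using assms by (intro mult_right_mono) auto
  then have le: "\<lfloor>a * real n\<rfloor> \<le> int n" by linarith
  have "graph_dist n id x = of_int \<lfloor>a * real n\<rfloor> \<longleftrightarrow> ncyc {1..n} x = n - nat \<lfloor>a * real n\<rfloor>"
    if "x permutes {1..n}" for x
  proof -
    have "graph_dist n id x = real n - real (ncyc {1..n} x)"
      using graph_dist_ncyc[OF permutes_id that] by simp
    moreover have "ncyc {1..n} x \<le> n" using ncyc_le_card[of "{1..n}" x] by simp
    ultimately have "graph_dist n id x = of_int \<lfloor>a * real n\<rfloor> \<longleftrightarrow>
      int n - int (ncyc {1..n} x) = \<lfloor>a * real n\<rfloor>" by linarith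
    then show ?thesis using fl le \<open>ncyc {1..n} x \<le> n\<close> by linarith
  qed
  then show ?thesis unfolding sphere_def perms_def by auto
qed

lemma gromov_product_ncyc:
  assumes "x \<in> perms {1..n} m" "y \<in> perms {1..n} m"
  shows "gromov_product n id x y = (real n - 2 * real m + real (ncyc {1..n} (inv x \<circ> y))) / 2"
proof -
  have xy: "x permutes {1..n}" "y permutes {1..n}" "ncyc {1..n} x = m" "ncyc {1..n} y = m"
    using assms by (auto simp: perms_def)
  have "ncyc {1..n} (inv x) = m" "ncyc {1..n} (inv y) = m"
    using xy ncyc_inv permutes_bij by metis+
  then show ?thesis
    using graph_dist_ncyc[OF xy(1) permutes_id] graph_dist_ncyc[OF xy(2) permutes_id]
      graph_dist_ncyc[OF xy(1,2)]
    by (simp add: gromov_product_def)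
qed

section \<open>A midpoint built from the tree components\<close>

lemma cyc_rel_agree:
  assumes "\<And>z. f z \<in> A \<longleftrightarrow> z \<in> A" "\<And>z. z \<in> A \<Longrightarrow> f z = g z" "cyc_rel f x y" "x \<in> A"
  shows "cyc_rel g x y"
proof -
  have "(x \<in> A \<longleftrightarrow> y \<in> A) \<and> (x \<in> A \<longrightarrow> cyc_rel g x y)"
    using assms(3)
  proof (rule cyc_rel_least)
    show "(x \<in> A \<longleftrightarrow> f x \<in> A) \<and> (x \<in> A \<longrightarrow> cyc_rel g x (f x))" for x
      using assms(1,2)[of x] by simp
  qed (blast intro: cyc_rel_refl cyc_rel_sym cyc_rel_trans)+
  then show ?thesis using assms(4) by blast
qed

lemma ncyc_agree:
  assumes "\<And>z. f z \<in> A \<longleftrightarrow> z \<in> A" "\<And>z. g z \<in> A \<longleftrightarrow> z \<in> A" "\<And>z. z \<in> A \<Longrightarrow> f z = g z"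
  shows "ncyc A f = ncyc A g"
  by (rule ncyc_cong) (metis assms cyc_rel_agree)

lemma ncyc_Union:
  assumes fin: "finite \<O>" "\<And>X. X \<in> \<O> \<Longrightarrow> finite X"
    and disj: "\<And>X Y. X \<in> \<O> \<Longrightarrow> Y \<in> \<O> \<Longrightarrow> X \<noteq> Y \<Longrightarrow> X \<inter> Y = {}"
    and inv: "\<And>X z. X \<in> \<O> \<Longrightarrow> f z \<in> X \<longleftrightarrow> z \<in> X"
  shows "ncyc (\<Union>\<O>) f = (\<Sum>X\<in>\<O>. ncyc X f)"
proof -
  have "cycle_of f ` (\<Union>\<O>) = (\<Union>X\<in>\<O>. cycle_of f ` X)" by blast
  moreover have "card (\<Union>X\<in>\<O>. cycle_of f ` X) = (\<Sum>X\<in>\<O>. card (cycle_of f ` X))"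
  proof (rule card_UN_disjoint[OF fin(1)])
    show "\<forall>X\<in>\<O>. finite (cycle_of f ` X)" using fin by blast
    show "\<forall>X\<in>\<O>. \<forall>Y\<in>\<O>. X \<noteq> Y \<longrightarrow> cycle_of f ` X \<inter> cycle_of f ` Y = {}"
    proof (intro ballI impI, rule ccontr)
      fix X Y assume XY: "X \<in> \<O>" "Y \<in> \<O>" "X \<noteq> Y" and "cycle_of f ` X \<inter> cycle_of f ` Y \<noteq> {}"
      then obtain x y where "x \<in> X" "y \<in> Y" "cycle_of f x = cycle_of f y" by blast
      then have "y \<in> X" "y \<in> Y"
        using cyc_rel_invariant[of f x y X] inv[OF XY(1)] by (auto simp: cycle_of_eq_iff)
      then show False using disj[OF XY] by blast
    qed
  qed
  ultimately show ?thesis unfolding ncyc_def by presburger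
qed

lemma ncyc_Un:
  assumes "finite A" "finite B" "A \<inter> B = {}" "\<And>z. f z \<in> A \<longleftrightarrow> z \<in> A" "\<And>z. f z \<in> B \<longleftrightarrow> z \<in> B"
  shows "ncyc (A \<union> B) f = ncyc A f + ncyc B f"
proof (cases "A = B")
  case True
  then have "A = {}" "B = {}" using assms(3) by auto
  then show ?thesis by (simp add: ncyc_def)
next
  case False
  then have "ncyc (\<Union>{A, B}) f = (\<Sum>X\<in>{A, B}. ncyc X f)"
    using assms by (intro ncyc_Union) auto
  then show ?thesis using False by simp
qed

lemma tree_cycle_invariant:
  assumes "tree_cycle P X" "inj (P d)"
  shows "P d z \<in> X \<longleftrightarrow> z \<in> X"
proof -
  have "P d ` X = X" using assms(1) by (simp add: tree_cycle_def)
  then show ?thesis using inj_image_mem_iff[OF assms(2)] by metis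
qed

lemma tree_cycle_disjoint:
  assumes "tree_cycle P X" "tree_cycle P Y" "X \<noteq> Y"
  shows "X \<inter> Y = {}"
proof (rule ccontr)
  assume "X \<inter> Y \<noteq> {}"
  then obtain z where "z \<in> X" "z \<in> Y" by blast
  then show False using assms by (auto simp: tree_cycle_def)
qed

lemma tree_cycle_single:
  assumes "tree_cycle P X"
  shows "ncyc X (P True \<circ> P False) = 1"
proof -
  have "cycle_of (P True \<circ> P False) ` X = {X}"
    using assms by (auto simp: tree_cycle_def)
  then show ?thesis by (simp add: ncyc_def)
qed

text \<open>
  The form in which \<open>tree_cycle_of_no_lollipop\<close> is applied. Since \<open>s\<close> and \<open>inv s\<close> have the same cycles,
  lollipops can be counted for the pair \<open>(s, p)\<close> instead of \<open>(inv s, p)\<close>.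
\<close>

lemma bad_point_of_not_tree_cycle:
  assumes V: "finite V" and s: "s permutes V" and p: "p permutes V" and v: "v \<in> V"
    and nt: "\<not> tree_cycle (perm_pair (inv s) p) (cycle_of (inv s \<circ> p) v)"
  shows "\<exists>L\<in>{1..2 * card (cycle_of (inv s \<circ> p) v)}. v \<in> bad_points V L (perm_pair s p)"
proof (rule ccontr)
  assume no: "\<not> ?thesis"
  have rels: "cyc_rels (perm_pair (inv s) p) = cyc_rels (perm_pair s p)"
    using cyc_rel_inv[OF permutes_bij[OF s]] by (auto simp: perm_pair_def fun_eq_iff)
  have f: "perm_pair (inv s) p True \<circ> perm_pair (inv s) p False = inv s \<circ> p" by (simp add: perm_pair_def)
  have "tree_cycle (perm_pair (inv s) p) (cycle_of (perm_pair (inv s) p True \<circ> perm_pair (inv s) p False) v)"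
  proof (rule tree_cycle_of_no_lollipop[OF V _ v])
    show "perm_pair (inv s) p d permutes V" for d
      using permutes_inv[OF s] p by (simp add: perm_pair_def)
    fix c w vs
    assume vs: "last vs = v" "set (w # vs) \<subseteq> V"
      "length vs \<le> 2 * card (cycle_of (perm_pair (inv s) p True \<circ> perm_pair (inv s) p False) v)"
    show "\<not> lollipop (cyc_rels (perm_pair (inv s) p)) c w vs"
    proof
      assume lol: "lollipop (cyc_rels (perm_pair (inv s) p)) c w vs"
      then have "vs \<noteq> []" by (auto simp: lollipop_def)
      then have "length vs \<in> {1..2 * card (cycle_of (inv s \<circ> p) v)}"
        using vs(3) unfolding f by (cases vs) auto
      moreover have "v \<in> bad_points V (length vs) (perm_pair s p)"
        using lol vs v unfolding rels bad_points_def by blast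
      ultimately show False using no by blast
    qed
  qed
  then show False using nt unfolding f by blast
qed

text \<open>
  A bound for the number of points outside the tree components. The points of a lollipop are
  distinct, so the range of \<open>L\<close> leaves none out.
\<close>

definition defect :: "nat \<Rightarrow> (nat \<Rightarrow> nat) \<times> (nat \<Rightarrow> nat) \<Rightarrow> nat" where
  "defect n sp = (\<Sum>L = 1..2 * n. card (bad_points {1..n} L (perm_pair (fst sp) (snd sp))))"

text \<open>
  Let \<open>G\<close> be the union of the tree components. On \<open>G\<close> the numbers of cycles satisfy
  \<open>c(s) + c(p) = card G + c(inv s \<circ> p)\<close>, which says that the distances of \<open>s\<close> and \<open>p\<close> from the identity
  add up to the distance from \<open>s\<close> to \<open>p\<close>. The permutation \<open>x\<close> that is the identity on \<open>G\<close> and \<open>s\<close> on the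
  rest therefore lies between \<open>s\<close> and \<open>p\<close>.
\<close>

lemma geodesic_midpoint:
  assumes s: "s permutes {1..n}" and p: "p permutes {1..n}"
  obtains x where "x permutes {1..n}" "graph_dist n s x + graph_dist n x p \<le> graph_dist n s p"
    "graph_dist n id x \<le> real (defect n (s, p))"
proof -
  define V where "V = {1..n}"
  have sV: "s permutes V" and pV: "p permutes V" and finV: "finite V" and cV: "card V = n"
    using s p by (auto simp: V_def)
  let ?f = "inv s \<circ> p"
  have isV: "inv s permutes V" by (rule permutes_inv[OF sV])
  have fV: "?f permutes V" by (rule permutes_compose[OF pV isV])
  define \<O> where "\<O> = {X. X \<subseteq> V \<and> tree_cycle (perm_pair (inv s) p) X}"
  define G where "G = \<Union>\<O>"
  define B where "B = V - G"
  have finO: "finite \<O>" unfolding \<O>_def using finV by auto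
  have finX: "finite X" if "X \<in> \<O>" for X using that by (simp add: \<O>_def tree_cycle_def)
  have disj: "X \<inter> Y = {}" if "X \<in> \<O>" "Y \<in> \<O>" "X \<noteq> Y" for X Y
    using that tree_cycle_disjoint unfolding \<O>_def by blast
  have tc: "tree_cycle (perm_pair (inv s) p) X" if "X \<in> \<O>" for X using that by (simp add: \<O>_def)
  have invX: "inv s z \<in> X \<longleftrightarrow> z \<in> X" "p z \<in> X \<longleftrightarrow> z \<in> X" if "X \<in> \<O>" for X z
    using tree_cycle_invariant[OF tc[OF that], of True] tree_cycle_invariant[OF tc[OF that], of False]
      permutes_inj[OF isV] permutes_inj[OF pV] by (simp_all add: perm_pair_def)
  have GV: "G \<subseteq> V" by (auto simp: G_def \<O>_def)
  have invG: "inv s z \<in> G \<longleftrightarrow> z \<in> G" "p z \<in> G \<longleftrightarrow> z \<in> G" for z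
    unfolding G_def using invX by blast+
  have invV: "inv s z \<in> V \<longleftrightarrow> z \<in> V" "p z \<in> V \<longleftrightarrow> z \<in> V" for z
    using permutes_in_image[OF isV] permutes_in_image[OF pV] by blast+
  have invB: "inv s z \<in> B \<longleftrightarrow> z \<in> B" "p z \<in> B \<longleftrightarrow> z \<in> B" for z
    unfolding B_def using invG invV by blast+
  have s_inv: "inv s (s z) = z" "s (inv s z) = z" for z
    using permutes_inverses[OF sV] by auto
  have sG: "s z \<in> G \<longleftrightarrow> z \<in> G" and sB: "s z \<in> B \<longleftrightarrow> z \<in> B" for z
    using invG(1)[of "s z"] invB(1)[of "s z"] s_inv by auto
  have fin: "finite G" "finite B" "G \<inter> B = {}" "G \<union> B = V"
    using GV finV finite_subset by (auto simp: B_def)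
  have split: "ncyc V g = ncyc G g + ncyc B g"
    if "\<And>z. g z \<in> G \<longleftrightarrow> z \<in> G" "\<And>z. g z \<in> B \<longleftrightarrow> z \<in> B" for g
    using ncyc_Un[OF fin(1-3) that] fin(4) by simp
  have "ncyc G (inv s) + ncyc G p = card G + ncyc G ?f"
  proof -
    have "ncyc G (inv s) + ncyc G p = (\<Sum>X\<in>\<O>. ncyc X (inv s) + ncyc X p)"
      unfolding G_def sum.distrib
      using ncyc_Union[OF finO finX disj, of "inv s"] ncyc_Union[OF finO finX disj, of p] invX by simp
    also have "\<dots> = (\<Sum>X\<in>\<O>. card X + ncyc X ?f)"
    proof (rule sum.cong[OF refl])
      fix X assume X: "X \<in> \<O>"
      then show "ncyc X (inv s) + ncyc X p = card X + ncyc X ?f"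
        using tree_cycle_single[OF tc[OF X]] tc[OF X] by (simp add: tree_cycle_def perm_pair_def)
    qed
    also have "\<dots> = card G + ncyc G ?f"
      unfolding G_def sum.distrib
      using ncyc_Union[OF finO finX disj, of ?f] invX card_Union_disjoint[of \<O>] finX disj
      by (simp add: pairwise_def disjnt_def)
    finally show ?thesis .
  qed
  note tree = this
  define x where "x z = (if z \<in> G then z else s z)" for z
  define y where "y z = (if z \<in> G then z else inv s z)" for z
  have xy: "x \<circ> y = id" "y \<circ> x = id" using s_inv sG invG by (auto simp: x_def y_def fun_eq_iff)
  have bijx: "bij x" by (rule o_bij[OF xy(2,1)])
  have invx: "inv x = y" using xy by (metis inv_unique_comp)
  have xV: "x permutes V"
  proof -
    have "x z = z" if "z \<notin> V" for z using permutes_not_in[OF sV that] by (simp add: x_def)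
    then show ?thesis unfolding permutes_def using bijx by (metis bij_iff)
  qed
  have xG: "x z \<in> G \<longleftrightarrow> z \<in> G" and xB: "x z \<in> B \<longleftrightarrow> z \<in> B" for z
    using sG[of z] sB[of z] fin(3) by (auto simp: x_def)
  have yG: "y z \<in> G \<longleftrightarrow> z \<in> G" and yB: "y z \<in> B \<longleftrightarrow> z \<in> B" for z
    using invG(1)[of z] invB(1)[of z] fin(3) by (auto simp: y_def)
  have notG: "z \<notin> G" if "z \<in> B" for z using that by (simp add: B_def)
  have d1: "ncyc V (inv s \<circ> x) = ncyc G (inv s) + card B"
  proof -
    have "ncyc G (inv s \<circ> x) = ncyc G (inv s)"
      by (rule ncyc_agree) (auto simp: invG xG, auto simp: x_def)
    moreover have "ncyc B (inv s \<circ> x) = ncyc B id"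
      by (rule ncyc_agree) (auto simp: invB xB, auto simp: x_def s_inv notG)
    ultimately show ?thesis
      using split[of "inv s \<circ> x"] fin(2) by (simp add: invG xG invB xB)
  qed
  have d2: "ncyc V (inv x \<circ> p) = ncyc G p + ncyc B ?f"
  proof -
    have "ncyc G (y \<circ> p) = ncyc G p"
      by (rule ncyc_agree) (auto simp: invG yG, auto simp: y_def invG)
    moreover have "ncyc B (y \<circ> p) = ncyc B ?f"
    proof (rule ncyc_agree)
      show "(y \<circ> p) z = ?f z" if "z \<in> B" for z
        using notG[of "p z"] invB(2)[of z] that by (simp add: y_def)
    qed (auto simp: invB yB)
    ultimately show ?thesis
      unfolding invx using split[of "y \<circ> p"] by (simp add: invG yG invB yB)
  qed
  have d3: "ncyc V ?f = ncyc G ?f + ncyc B ?f" by (rule split) (simp_all add: invG invB)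
  have d4: "card G \<le> ncyc V x"
  proof -
    have "ncyc G x = ncyc G id" by (rule ncyc_agree) (auto simp: xG, auto simp: x_def)
    then show ?thesis using split[OF xG xB] fin(1) by simp
  qed
  have cardV: "card G + card B = n" using card_Un_disjoint[OF fin(1-3)] fin(4) cV by simp
  have "card B \<le> defect n (s, p)"
  proof -
    have "B \<subseteq> (\<Union>L\<in>{1..2 * n}. bad_points V L (perm_pair s p))"
    proof
      fix v assume v: "v \<in> B"
      let ?X = "cycle_of ?f v"
      have vV: "v \<in> V" using v by (simp add: B_def)
      have XV: "?X \<subseteq> V" by (rule cycle_of_subset[OF fV vV])
      have vX: "v \<in> ?X" by (simp add: cycle_of_def)
      have "?X \<notin> \<O>" using vX v by (auto simp: B_def G_def)
      then have nt: "\<not> tree_cycle (perm_pair (inv s) p) ?X" using XV by (simp add: \<O>_def)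
      obtain L where L: "L \<in> {1..2 * card ?X}" "v \<in> bad_points V L (perm_pair s p)"
        using bad_point_of_not_tree_cycle[OF finV sV pV vV nt] by blast
      have "card ?X \<le> n" using card_mono[OF finV XV] cV by simp
      then have "L \<in> {1..2 * n}" using L(1) by auto
      then show "v \<in> (\<Union>L\<in>{1..2 * n}. bad_points V L (perm_pair s p))" using L(2) by blast
    qed
    moreover have "finite (bad_points V L P)" for L P
      using finV by (simp add: bad_points_def)
    ultimately have "card B \<le> card (\<Union>L\<in>{1..2 * n}. bad_points V L (perm_pair s p))"
      by (intro card_mono) auto
    also have "\<dots> \<le> defect n (s, p)"
      unfolding defect_def V_def fst_conv snd_conv by (rule card_UN_le) simp
    finally show ?thesis .
  qed
  note bad = this
  show ?thesis
  proof (rule that)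
    show x: "x permutes {1..n}" using xV by (simp add: V_def)
    have le: "ncyc V g \<le> n" for g using ncyc_le_card[OF finV, of g] cV by simp
    show "graph_dist n s x + graph_dist n x p \<le> graph_dist n s p"
      unfolding graph_dist_ncyc[OF s x] graph_dist_ncyc[OF x p] graph_dist_ncyc[OF s p]
        V_def[symmetric] d1 d2 d3 using tree cardV by linarith
    have "graph_dist n id x = real n - real (ncyc V x)"
      using graph_dist_ncyc[OF permutes_id x] by (simp add: V_def)
    then show "graph_dist n id x \<le> real (defect n (s, p))"
      using d4 cardV bad by linarith
  qed
qed

section \<open>The subcritical phase\<close>

definition sphere_cycles :: "real \<Rightarrow> nat \<Rightarrow> nat" where
  "sphere_cycles a n = n - nat \<lfloor>a * real n\<rfloor>"

lemma sphere_cycles_bounds: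
  assumes "0 < a" "a < 1" "0 < n"
  shows "0 < sphere_cycles a n" "sphere_cycles a n \<le> n"
proof -
  have "a * real n < 1 * real n" using assms by (intro mult_strict_right_mono) auto
  then have "\<lfloor>a * real n\<rfloor> < int n" by linarith
  then show "0 < sphere_cycles a n" using assms by (simp add: sphere_cycles_def)
qed (simp add: sphere_cycles_def)

lemma sphere_cycles_regime:
  assumes "0 < a" "a < 1" "0 < t" "cycle_density t = 1 - a"
  shows "regime t (\<lambda>n. n) (sphere_cycles a)"
proof -
  have "(\<lambda>n. real_of_int \<lfloor>a * real n\<rfloor> / real n) \<longlonglongrightarrow> a"
  proof (rule real_tendsto_sandwich)
    show "\<forall>\<^sub>F n in sequentially. a - 1 / real n \<le> real_of_int \<lfloor>a * real n\<rfloor> / real n"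
      using eventually_gt_at_top[of 0]
    proof eventually_elim
      case (elim n)
      have "a * real n - 1 \<le> real_of_int \<lfloor>a * real n\<rfloor>" by linarith
      then have "(a * real n - 1) / real n \<le> real_of_int \<lfloor>a * real n\<rfloor> / real n"
        by (intro divide_right_mono) auto
      then show ?case using elim by (simp add: diff_divide_distrib)
    qed
    show "\<forall>\<^sub>F n in sequentially. real_of_int \<lfloor>a * real n\<rfloor> / real n \<le> a"
      using eventually_gt_at_top[of 0]
    proof eventually_elim
      case (elim n)
      have "real_of_int \<lfloor>a * real n\<rfloor> \<le> a * real n" by linarith
      then show ?case using elim by (simp add: divide_le_eq)
    qed
    show "(\<lambda>n. a - 1 / real n) \<longlonglongrightarrow> a" by real_asymp
  qed simp
  then have "(\<lambda>n. 1 - real_of_int \<lfloor>a * real n\<rfloor> / real n) \<longlonglongrightarrow> 1 - a"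
    by (intro tendsto_intros)
  then have "(\<lambda>n. real (sphere_cycles a n) / real n) \<longlonglongrightarrow> 1 - a"
  proof (rule Lim_transform_eventually)
    show "\<forall>\<^sub>F n in sequentially. 1 - real_of_int \<lfloor>a * real n\<rfloor> / real n = real (sphere_cycles a n) / real n"
      using eventually_gt_at_top[of 0]
    proof eventually_elim
      case (elim n)
      have "a * real n < 1 * real n" using assms elim by (intro mult_strict_right_mono) auto
      then have "\<lfloor>a * real n\<rfloor> < int n" "0 \<le> \<lfloor>a * real n\<rfloor>" using assms by (linarith, simp)
      then have "real (sphere_cycles a n) = real n - real_of_int \<lfloor>a * real n\<rfloor>"
        unfolding sphere_cycles_def by linarith
      then show ?case using elim by (simp add: diff_divide_distrib)
    qed
  qed
  then show ?thesis using assms by (simp add: regime_def filterlim_ident)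
qed

text \<open>
  Expectations and probabilities for two independent uniform points of the sphere are averages over pairs
  of permutations with \<open>m n\<close> cycles.
\<close>

locale sphere_pair =
  fixes a :: real
  assumes a: "0 < a" "a < 1"
begin

abbreviation "m \<equiv> sphere_cycles a"

abbreviation pairs :: "nat \<Rightarrow> ((nat \<Rightarrow> nat) \<times> (nat \<Rightarrow> nat)) set" where
  "pairs n \<equiv> perms {1..n} (m n) \<times> perms {1..n} (m n)"

abbreviation mean :: "nat \<Rightarrow> ((nat \<Rightarrow> nat) \<times> (nat \<Rightarrow> nat) \<Rightarrow> real) \<Rightarrow> real" where
  "mean n F \<equiv> measure_pmf.expectation (two_uniform a n) F"

lemma stirling_m_pos: "0 < stirling n (m n)"
proof (cases "n = 0")
  case False
  then show ?thesis using sphere_cycles_bounds[OF a, of n] by (intro stirling_pos) auto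
qed (simp add: sphere_cycles_def)

lemma card_perms_m: "card (perms {1..n} (m n)) = stirling n (m n)"
  using card_perms[of "{1..n}"] by simp

lemma finite_pairs: "finite (pairs n)"
  using finite_perms[of "{1..n}"] by simp

lemma perms_m_nonempty: "perms {1..n} (m n) \<noteq> {}"
  using card_perms_m[of n] stirling_m_pos[of n] by force

lemma card_pairs: "real (card (pairs n)) = (real (stirling n (m n)))\<^sup>2"
  unfolding card_cartesian_product card_perms_m of_nat_mult power2_eq_square ..

lemma two_uniform_eq: "two_uniform a n = pmf_of_set (pairs n)"
proof (rule pmf_eqI)
  fix x :: "(nat \<Rightarrow> nat) \<times> (nat \<Rightarrow> nat)"
  have S: "sphere a n = perms {1..n} (m n)"
    unfolding sphere_cycles_def by (rule sphere_eq_perms[OF a])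
  have fin: "finite (perms {1..n} (m n))" using finite_perms[of "{1..n}"] by simp
  show "pmf (two_uniform a n) x = pmf (pmf_of_set (pairs n)) x"
    using perms_m_nonempty fin
    by (cases x) (auto simp: two_uniform_def S pmf_pair card_cartesian_product indicator_def)
qed

lemma mean_eq: "mean n F = (\<Sum>x\<in>pairs n. F x) / (real (stirling n (m n)))\<^sup>2"
  unfolding two_uniform_eq card_pairs[symmetric]
  by (rule integral_pmf_of_set) (use perms_m_nonempty finite_pairs in auto)

lemma prob_eq: "measure_pmf.prob (two_uniform a n) A = real (card (pairs n \<inter> A)) / (real (stirling n (m n)))\<^sup>2"
  unfolding two_uniform_eq card_pairs[symmetric]
  by (rule measure_pmf_of_set) (use perms_m_nonempty finite_pairs in auto)

lemma mean_mono: "(\<And>x. x \<in> pairs n \<Longrightarrow> F x \<le> G x) \<Longrightarrow> mean n F \<le> mean n G"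
  unfolding mean_eq by (intro divide_right_mono sum_mono) auto

lemma mean_cong: "(\<And>x. x \<in> pairs n \<Longrightarrow> F x = G x) \<Longrightarrow> mean n F = mean n G"
  unfolding mean_eq by (metis (no_types, lifting) sum.cong)

lemma mean_add: "mean n (\<lambda>x. F x + G x) = mean n F + mean n G"
  unfolding mean_eq by (simp add: sum.distrib add_divide_distrib)

lemma mean_cmult: "mean n (\<lambda>x. c * F x) = c * mean n F"
  unfolding mean_eq by (simp add: sum_distrib_left)

lemma mean_sum: "mean n (\<lambda>x. \<Sum>i\<in>I. F i x) = (\<Sum>i\<in>I. mean n (F i))"
  unfolding mean_eq by (subst sum.swap) (simp add: sum_divide_distrib)

lemma markov:
  assumes c: "0 < c" and Z: "\<And>x. x \<in> pairs n \<Longrightarrow> 0 \<le> Z x"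
    and good: "\<And>x. x \<in> pairs n \<Longrightarrow> Z x \<le> c \<Longrightarrow> x \<in> A"
  shows "1 - mean n Z / c \<le> measure_pmf.prob (two_uniform a n) A"
proof -
  let ?S = "(real (stirling n (m n)))\<^sup>2"
  have S: "0 < ?S" using stirling_m_pos[of n] by simp
  have cd: "real (card (pairs n)) = real (card (pairs n \<inter> A)) + real (card (pairs n - A))"
    using card_Int_Diff[OF finite_pairs, of n A] by simp
  have "c * real (card (pairs n - A)) = (\<Sum>x\<in>pairs n - A. c)" by simp
  also have "\<dots> \<le> (\<Sum>x\<in>pairs n - A. Z x)" using good by (intro sum_mono) force
  also have "\<dots> \<le> (\<Sum>x\<in>pairs n. Z x)" using Z finite_pairs by (intro sum_mono2) auto
  finally have "real (card (pairs n - A)) \<le> (\<Sum>x\<in>pairs n. Z x) / c"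
    using c by (simp add: field_simps)
  then have "?S - (\<Sum>x\<in>pairs n. Z x) / c \<le> real (card (pairs n \<inter> A))"
    using cd unfolding card_pairs by linarith
  then have "(?S - (\<Sum>x\<in>pairs n. Z x) / c) / ?S \<le> real (card (pairs n \<inter> A)) / ?S"
    using S by (intro divide_right_mono) auto
  moreover have "(?S - (\<Sum>x\<in>pairs n. Z x) / c) / ?S = 1 - mean n Z / c"
    using S by (simp add: mean_eq diff_divide_distrib)
  ultimately show ?thesis unfolding prob_eq by simp
qed

lemma mean_bad_points_le:
  assumes n: "0 < n" and \<rho>: "real n * real (stirling n (Suc (m n))) / real (stirling n (m n)) \<le> \<rho>"
  shows "mean n (\<lambda>x. real (card (bad_points {1..n} L (perm_pair (fst x) (snd x))))) \<le> 6 * real L * \<rho> ^ Suc L"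
proof -
  let ?s = "real (stirling n (m n))"
  define q where "q = \<rho> / real n"
  have s: "0 < ?s" using stirling_m_pos by simp
  have "0 \<le> real n * real (stirling n (Suc (m n))) / ?s" by simp
  then have "0 \<le> \<rho>" using \<rho> by linarith
  then have q: "0 \<le> q" "real n * q = \<rho>" using n by (simp_all add: q_def)
  have "real n * real (stirling n (Suc (m n))) \<le> \<rho> * ?s"
    using \<rho> s by (simp add: pos_divide_le_eq)
  then have "real (stirling n (Suc (m n))) \<le> q * ?s" using n by (simp add: q_def field_simps)
  then have "(\<Sum>(s, p)\<in>pairs n. real (card (bad_points {1..n} L (perm_pair s p))))
    \<le> 6 * real L * (real n * q) ^ Suc L * ?s\<^sup>2"
    using sum_bad_points_le[of "{1..n}" "m n" q L] stirling_m_pos[of n] q(1) by simp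
  then show ?thesis
    unfolding mean_eq using s by (simp add: q(2) divide_le_eq case_prod_beta)
qed

lemma gromov_product_le_defect:
  assumes "x \<in> pairs n"
  shows "gromov_product n id (fst x) (snd x) \<le> real (defect n x)"
    and "\<exists>g. geodesic n (fst x) g (snd x) \<and> dist_to_walk n id (fst x) g \<le> real (defect n x)"
proof -
  have p: "fst x permutes {1..n}" "snd x permutes {1..n}" using assms by (auto simp: perms_def)
  obtain z where z: "z permutes {1..n}"
    "graph_dist n (fst x) z + graph_dist n z (snd x) \<le> graph_dist n (fst x) (snd x)"
    "graph_dist n id z \<le> real (defect n x)"
    using geodesic_midpoint[OF p] by auto
  show "gromov_product n id (fst x) (snd x) \<le> real (defect n x)"
    using gromov_product_through[OF p z(1,2)] z(3) by linarith
  show "\<exists>g. geodesic n (fst x) g (snd x) \<and> dist_to_walk n id (fst x) g \<le> real (defect n x)"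
    using geodesic_through[OF p z(1,2)] z(3) by force
qed

text \<open>
  For \<open>t > 1\<close> the expected numbers of starting points of lollipops are summable over their length, since
  \<open>\<rho>\<close> can be chosen between \<open>1 / t\<close> and \<open>1\<close>.
\<close>

lemma mean_defect_bounded:
  assumes t: "1 < t" "cycle_density t = 1 - a"
  obtains C where "0 < C" "\<forall>\<^sub>F n in sequentially. mean n (\<lambda>x. real (defect n x)) \<le> C"
proof -
  define \<rho> where "\<rho> = (1 + 1 / t) / 2"
  have \<rho>: "1 / t < \<rho>" "\<rho> < 1" "0 < \<rho>" using t(1) by (auto simp: \<rho>_def field_simps)
  have reg: "regime t (\<lambda>n. n) m" using sphere_cycles_regime[OF a] t by simp
  have "\<forall>\<^sub>F n in sequentially. real n * real (stirling n (Suc (m n))) / real (stirling n (m n)) < \<rho>"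
    using stirling_ratio_limit[OF reg] \<rho>(1) by (rule order_tendstoD)
  then have "\<forall>\<^sub>F n in sequentially. mean n (\<lambda>x. real (defect n x)) \<le> 6 / (1 - \<rho>)\<^sup>2"
    using eventually_gt_at_top[of 0]
  proof eventually_elim
    case (elim n)
    have "mean n (\<lambda>x. real (defect n x)) =
      (\<Sum>L = 1..2 * n. mean n (\<lambda>x. real (card (bad_points {1..n} L (perm_pair (fst x) (snd x))))))"
      unfolding defect_def of_nat_sum by (rule mean_sum)
    also have "\<dots> \<le> (\<Sum>L = 1..2 * n. 6 * real L * \<rho> ^ Suc L)"
      using elim by (intro sum_mono mean_bad_points_le) auto
    also have "\<dots> \<le> (\<Sum>L = 1..2 * n. 6 * (real L * \<rho> ^ L))"
      using \<rho> by (intro sum_mono) (auto intro!: mult_left_le_one_le mult_left_mono)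
    also have "\<dots> \<le> 6 * (\<Sum>L\<le>2 * n. real L * \<rho> ^ L)"
      unfolding sum_distrib_left using \<rho> by (intro sum_mono2) auto
    also have "\<dots> \<le> 6 * (1 / (1 - \<rho>)\<^sup>2)"
      using \<rho> by (intro mult_left_mono geometric_moment_le) auto
    finally show ?case by simp
  qed
  then show ?thesis using that[of "6 / (1 - \<rho>)\<^sup>2"] \<rho> by simp
qed

lemma gromov_product_range:
  assumes "x \<in> pairs n"
  shows "gromov_product n id (fst x) (snd x) \<le> real n"
    and "0 \<le> gromov_product n id (fst x) (snd x)"
proof -
  have p: "fst x permutes {1..n}" "snd x permutes {1..n}"
    and x: "fst x \<in> perms {1..n} (m n)" "snd x \<in> perms {1..n} (m n)" using assms by (auto simp: perms_def)
  have "ncyc {1..n} (inv (fst x) \<circ> snd x) \<le> n" using ncyc_le_card[of "{1..n}"] by simp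
  then show "gromov_product n id (fst x) (snd x) \<le> real n"
    using gromov_product_ncyc[OF x] by simp
  show "0 \<le> gromov_product n id (fst x) (snd x)"
    using graph_dist_triangle[OF p(1) permutes_id p(2)] graph_dist_sym[OF permutes_id p(2)]
    by (simp add: gromov_product_def)
qed

lemma subcritical:
  assumes t: "1 < t" "cycle_density t = 1 - a"
  shows "\<exists>\<delta>::real. 0 < \<delta> \<and>
    (\<forall>n\<ge>2. mean n (\<lambda>(\<sigma>, \<pi>). gromov_product n id \<sigma> \<pi>) \<le> \<delta> * (ln (real n))\<^sup>2) \<and>
    (\<lambda>n. measure_pmf.prob (two_uniform a n)
       {(\<sigma>, \<pi>). \<exists>g. geodesic n \<sigma> g \<pi> \<and> dist_to_walk n id \<sigma> g \<le> \<delta> * (ln (real n))\<^sup>2}) \<longlonglongrightarrow> 1"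
proof -
  obtain C where C: "0 < C" "\<forall>\<^sub>F n in sequentially. mean n (\<lambda>x. real (defect n x)) \<le> C"
    by (rule mean_defect_bounded[OF t])
  then obtain N where N: "\<And>n. N \<le> n \<Longrightarrow> mean n (\<lambda>x. real (defect n x)) \<le> C"
    unfolding eventually_sequentially by blast
  \<comment> \<open>The summand \<open>N\<close> covers the finitely many \<open>n\<close> below \<open>N\<close>, where the
    Gromov product is at most \<open>n\<close>; the divisor uses \<open>ln 2 \<le> ln n\<close>.\<close>
  define \<delta> where "\<delta> = (C + real N) / (ln 2)\<^sup>2"
  have \<delta>: "0 < \<delta>" using C by (simp add: \<delta>_def)
  have bound: "mean n (\<lambda>(\<sigma>, \<pi>). gromov_product n id \<sigma> \<pi>) \<le> \<delta> * (ln (real n))\<^sup>2" if n: "2 \<le> n" for n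
  proof -
    have "mean n (\<lambda>(\<sigma>, \<pi>). gromov_product n id \<sigma> \<pi>) \<le> C + real N"
    proof (cases "N \<le> n")
      case True
      have "mean n (\<lambda>(\<sigma>, \<pi>). gromov_product n id \<sigma> \<pi>) \<le> mean n (\<lambda>x. real (defect n x))"
        using gromov_product_le_defect(1) by (intro mean_mono) (auto simp: case_prod_beta)
      then show ?thesis using N[OF True] by simp
    next
      case False
      have "mean n (\<lambda>(\<sigma>, \<pi>). gromov_product n id \<sigma> \<pi>) \<le> mean n (\<lambda>x. real n)"
        using gromov_product_range(1) by (intro mean_mono) (auto simp: case_prod_beta)
      then show ?thesis using False C by simp
    qed
    also have "\<dots> = \<delta> * (ln 2)\<^sup>2" by (simp add: \<delta>_def)
    also have "\<dots> \<le> \<delta> * (ln (real n))\<^sup>2"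
      using \<delta> n by (intro mult_left_mono power_mono) auto
    finally show ?thesis .
  qed
  let ?A = "\<lambda>n. {(\<sigma>, \<pi>). \<exists>g. geodesic n \<sigma> g \<pi> \<and> dist_to_walk n id \<sigma> g \<le> \<delta> * (ln (real n))\<^sup>2}"
  have "(\<lambda>n. measure_pmf.prob (two_uniform a n) (?A n)) \<longlonglongrightarrow> 1"
  proof (rule real_tendsto_sandwich)
    show "\<forall>\<^sub>F n in sequentially. 1 - C / (\<delta> * (ln (real n))\<^sup>2) \<le> measure_pmf.prob (two_uniform a n) (?A n)"
      using eventually_ge_at_top[of "max N 2"]
    proof eventually_elim
      case (elim n)
      let ?c = "\<delta> * (ln (real n))\<^sup>2"
      have c: "0 < ?c" using \<delta> elim by simp
      have "1 - mean n (\<lambda>x. real (defect n x)) / ?c \<le> measure_pmf.prob (two_uniform a n) (?A n)"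
      proof (rule markov[OF c])
        show "x \<in> ?A n" if "x \<in> pairs n" "real (defect n x) \<le> ?c" for x
          using gromov_product_le_defect(2)[OF that(1)] that(2) by (force simp: case_prod_beta)
      qed simp
      moreover have "mean n (\<lambda>x. real (defect n x)) / ?c \<le> C / ?c"
        using N[of n] elim c by (intro divide_right_mono) auto
      ultimately show ?case by linarith
    qed
    show "(\<lambda>n. 1 - C / (\<delta> * (ln (real n))\<^sup>2)) \<longlonglongrightarrow> 1" using \<delta> by real_asymp
  qed auto
  then show ?thesis using \<delta> bound by blast
qed

end

section \<open>Counting pairs of permutations with given tree components\<close>

abbreviation tree_on :: "'a set \<Rightarrow> ('a \<Rightarrow> 'a) \<times> ('a \<Rightarrow> 'a) \<Rightarrow> bool" where
  "tree_on X sp \<equiv> tree_cycle (perm_pair (inv (fst sp)) (snd sp)) X"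

lemma tree_cycle_agree:
  assumes t: "tree_cycle P X" and agree: "\<And>d z. z \<in> X \<Longrightarrow> P d z = P' d z"
    and inj: "\<And>d. inj (P d)" "\<And>d. inj (P' d)"
  shows "tree_cycle P' X"
proof -
  have inv: "P d z \<in> X \<longleftrightarrow> z \<in> X" for d z by (rule tree_cycle_invariant[OF t inj(1)])
  have im: "P' d ` X = X" for d
  proof -
    have "P' d ` X = P d ` X" using agree by (intro image_cong) auto
    then show ?thesis using t by (simp add: tree_cycle_def)
  qed
  have inv': "P' d z \<in> X \<longleftrightarrow> z \<in> X" for d z using inj_image_mem_iff[OF inj(2)[of d], of z X] im[of d] by simp
  let ?f = "P True \<circ> P False" and ?g = "P' True \<circ> P' False"
  have fg: "?f z = ?g z" if "z \<in> X" for z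
    using agree[of "P False z" True] agree[OF that, of False] inv[of False z] that by simp
  have fi: "?f z \<in> X \<longleftrightarrow> z \<in> X" and gi: "?g z \<in> X \<longleftrightarrow> z \<in> X" for z
    by (simp_all add: inv inv')
  have "cycle_of ?g x = X" if x: "x \<in> X" for x
  proof -
    have "cyc_rel ?g x z \<longleftrightarrow> cyc_rel ?f x z" for z
      using cyc_rel_agree[of ?f X ?g x z, OF fi fg _ x] cyc_rel_agree[of ?g X ?f x z, OF gi fg[symmetric] _ x]
      by blast
    then have "cycle_of ?g x = cycle_of ?f x" by (simp add: cycle_of_def)
    then show ?thesis using t x by (simp add: tree_cycle_def)
  qed
  moreover have "ncyc X (P' d) = ncyc X (P d)" for d
    by (rule ncyc_agree) (use agree inv inv' in auto)
  ultimately show ?thesis using t im by (simp add: tree_cycle_def)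
qed

text \<open>
  Being a tree component depends only on the values of the permutations on the component.
\<close>

lemma tree_on_agree:
  assumes t: "tree_on X (s, p)" and bij: "bij s" "bij p" "bij s'" "bij p'"
    and agree: "\<And>z. z \<in> X \<Longrightarrow> s z = s' z" "\<And>z. z \<in> X \<Longrightarrow> p z = p' z"
  shows "tree_on X (s', p')"
proof -
  let ?P = "perm_pair (inv s) p" and ?P' = "perm_pair (inv s') p'"
  have t: "tree_cycle ?P X" using t by simp
  have "inv s ` X = X" using t by (auto simp: tree_cycle_def perm_pair_def split: if_splits)
  have "inv s z = inv s' z" if z: "z \<in> X" for z
  proof -
    have "inv s z \<in> X" using z \<open>inv s ` X = X\<close> by blast
    then have "s' (inv s z) = z" using agree(1) bij by (metis bij_inv_eq_iff)
    then show ?thesis using bij by (metis bij_inv_eq_iff)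
  qed
  then have "?P d z = ?P' d z" if "z \<in> X" for d z
    using that agree by (simp add: perm_pair_def)
  moreover have "inj (?P d)" "inj (?P' d)" for d
    using bij by (auto simp: perm_pair_def bij_is_inj bij_imp_bij_inv)
  ultimately have "tree_cycle ?P' X" by (rule tree_cycle_agree[OF t])
  then show ?thesis by simp
qed

lemma tree_on_image:
  assumes "tree_on X (s, p)" "bij s"
  shows "s ` X = X" "p ` X = X"
proof -
  have P: "perm_pair (inv s) p d ` X = X" for d using assms(1) by (simp add: tree_cycle_def)
  have "inv s ` X = X" using P[of True] by (simp add: perm_pair_def)
  then show "s ` X = X" using assms(2) by (metis bij_is_surj image_f_inv_f)
  show "p ` X = X" using P[of False] by (simp add: perm_pair_def)
qed

text \<open>
  The possible pairs of restrictions to a tree component with point set \<open>X\<close>.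
\<close>

definition tree_pairs :: "'a set \<Rightarrow> (('a \<Rightarrow> 'a) \<times> ('a \<Rightarrow> 'a)) set" where
  "tree_pairs X = {sp. fst sp permutes X \<and> snd sp permutes X \<and> tree_on X sp}"

lemma finite_tree_pairs: "finite X \<Longrightarrow> finite (tree_pairs X)"
  by (rule finite_subset[of _ "{p. p permutes X} \<times> {p. p permutes X}"])
    (auto simp: tree_pairs_def finite_permutations)

lemma tree_pairs_ncyc:
  assumes "sp \<in> tree_pairs X"
  shows "ncyc X (fst sp) + ncyc X (snd sp) = Suc (card X)"
  using assms ncyc_inv[of "fst sp" X] by (auto simp: tree_pairs_def tree_cycle_def perm_pair_def permutes_bij)

definition restr :: "'a set \<Rightarrow> ('a \<Rightarrow> 'a) \<Rightarrow> 'a \<Rightarrow> 'a" where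
  "restr X f z = (if z \<in> X then f z else z)"

lemma restr_permutes:
  assumes "inj f" "f ` X = X"
  shows "restr X f permutes X"
proof (rule bij_imp_permutes)
  have "bij_betw f X X" using assms by (metis bij_betw_def inj_on_subset subset_UNIV)
  then show "bij_betw (restr X f) X X" by (rule bij_betw_cong[THEN iffD1, rotated]) (simp add: restr_def)
qed (simp add: restr_def)

definition extensions :: "'a set \<Rightarrow> nat \<Rightarrow> 'a set \<Rightarrow> ('a \<Rightarrow> 'a) \<Rightarrow> ('a \<Rightarrow> 'a) set" where
  "extensions V m X t = {f \<in> perms V m. \<forall>z\<in>X. f z = t z}"

text \<open>
  The number of permutations of \<open>n\<close> points with \<open>m\<close> cycles that extend a given permutation of \<open>h\<close> points
  with \<open>c\<close> cycles; see \<open>card_extensions\<close>.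
\<close>

definition ext_count :: "nat \<Rightarrow> nat \<Rightarrow> nat \<Rightarrow> nat \<Rightarrow> nat" where
  "ext_count n m h c = (if c \<le> m then stirling (n - h) (m - c) else 0)"

lemma ncyc_comp_block:
  assumes g: "g permutes Y" and t: "t permutes X" and XY: "X \<inter> Y = {}" "finite X" "finite Y"
  shows "ncyc (X \<union> Y) (g \<circ> t) = ncyc X t + ncyc Y g"
proof -
  have gX: "g z \<in> X \<longleftrightarrow> z \<in> X" for z
    using XY(1) permutes_in_image[OF g] permutes_not_in[OF g] by (metis disjoint_iff)
  have tX: "t z \<in> X \<longleftrightarrow> z \<in> X" for z by (rule permutes_in_image[OF t])
  have gY: "g z \<in> Y \<longleftrightarrow> z \<in> Y" for z by (rule permutes_in_image[OF g])
  have tY: "t z \<in> Y \<longleftrightarrow> z \<in> Y" for z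
    using XY(1) permutes_in_image[OF t] permutes_not_in[OF t] by (metis disjoint_iff)
  have "ncyc (X \<union> Y) (g \<circ> t) = ncyc X (g \<circ> t) + ncyc Y (g \<circ> t)"
    by (rule ncyc_Un) (use XY gX tX gY tY in auto)
  moreover have "ncyc X (g \<circ> t) = ncyc X t"
  proof (rule ncyc_agree)
    show "(g \<circ> t) z = t z" if "z \<in> X" for z
      using permutes_not_in[OF g, of "t z"] tX[of z] that XY(1) by auto
  qed (use gX tX in auto)
  moreover have "ncyc Y (g \<circ> t) = ncyc Y g"
  proof (rule ncyc_agree)
    show "(g \<circ> t) z = g z" if "z \<in> Y" for z
    proof -
      have "z \<notin> X" using that XY(1) by blast
      then show ?thesis using permutes_not_in[OF t] by simp
    qed
  qed (use gY tY in auto)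
  ultimately show ?thesis by simp
qed

lemma card_extensions:
  assumes V: "finite V" and X: "X \<subseteq> V" and t: "t permutes X"
  shows "card (extensions V m X t) = ext_count (card V) m (card X) (ncyc X t)"
proof -
  let ?c = "ncyc X t"
  have finX: "finite X" using V X finite_subset by blast
  have un: "X \<union> (V - X) = V" using X by blast
  have nc: "ncyc V (g \<circ> t) = ?c + ncyc (V - X) g" if "g permutes (V - X)" for g
    using ncyc_comp_block[OF that t] V finX un by auto
  have tV: "t permutes V" using t X by (rule permutes_subset)
  have inv_t: "inv t permutes X" using t by (rule permutes_inv)
  have ext: "g \<circ> t \<in> extensions V m X t" if g: "g permutes (V - X)" "?c + ncyc (V - X) g = m" for g
  proof -
    have "g permutes V" using g(1) by (rule permutes_subset) blast
    then have "g \<circ> t permutes V" by (rule permutes_compose[OF tV])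
    moreover have "(g \<circ> t) z = t z" if "z \<in> X" for z
      using permutes_not_in[OF g(1), of "t z"] permutes_in_image[OF t, of z] that by simp
    ultimately show ?thesis using nc[OF g(1)] g(2) by (simp add: extensions_def perms_def)
  qed
  have ext': "f \<circ> inv t permutes (V - X)" "f = (f \<circ> inv t) \<circ> t" if f: "f \<in> extensions V m X t" for f
  proof -
    have fV: "f permutes V" and fX: "\<And>z. z \<in> X \<Longrightarrow> f z = t z"
      using f by (auto simp: extensions_def perms_def)
    have "f \<circ> inv t permutes V"
      by (rule permutes_compose[OF permutes_subset[OF inv_t X] fV])
    moreover have "(f \<circ> inv t) z = z" if "z \<in> X" for z
      using fX[of "inv t z"] permutes_in_image[OF inv_t, of z] that permutes_inverses(1)[OF t] by simp
    ultimately show "f \<circ> inv t permutes (V - X)" by (rule permutes_superset) auto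
    show "f = (f \<circ> inv t) \<circ> t" using permutes_inv_o(2)[OF t] by (simp add: comp_assoc)
  qed
  show ?thesis
  proof (cases "?c \<le> m")
    case True
    have "extensions V m X t = (\<lambda>g. g \<circ> t) ` perms (V - X) (m - ?c)"
    proof
      show "extensions V m X t \<subseteq> (\<lambda>g. g \<circ> t) ` perms (V - X) (m - ?c)"
      proof
        fix f assume f: "f \<in> extensions V m X t"
        then have "ncyc V f = m" by (simp add: extensions_def perms_def)
        then have "ncyc (V - X) (f \<circ> inv t) = m - ?c"
          using nc[OF ext'(1)[OF f]] ext'(2)[OF f] by simp
        then show "f \<in> (\<lambda>g. g \<circ> t) ` perms (V - X) (m - ?c)"
          using ext'[OF f] by (intro image_eqI[of _ _ "f \<circ> inv t"]) (simp_all add: perms_def)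
      qed
      show "(\<lambda>g. g \<circ> t) ` perms (V - X) (m - ?c) \<subseteq> extensions V m X t"
        using ext True by (auto simp: perms_def)
    qed
    moreover have "inj_on (\<lambda>g. g \<circ> t) (perms (V - X) (m - ?c))"
    proof (rule inj_onI)
      fix g h :: "'a \<Rightarrow> 'a" assume "g \<circ> t = h \<circ> t"
      then have "g \<circ> t \<circ> inv t = h \<circ> t \<circ> inv t" by simp
      then show "g = h" using permutes_inv_o(1)[OF t] by (simp add: comp_assoc)
    qed
    ultimately have "card (extensions V m X t) = card (perms (V - X) (m - ?c))"
      by (simp add: card_image)
    then show ?thesis
      using V X finX True by (simp add: card_perms ext_count_def card_Diff_subset)
  next
    case False
    have "extensions V m X t = {}"
    proof (rule ccontr)
      assume "extensions V m X t \<noteq> {}"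
      then obtain f where f: "f \<in> extensions V m X t" by blast
      then have "ncyc V f = m" by (simp add: extensions_def perms_def)
      then show False using nc[OF ext'(1)[OF f]] ext'(2)[OF f] False by simp
    qed
    then show ?thesis using False by (simp add: ext_count_def)
  qed
qed

lemma card_eq_sum_fibers:
  assumes "finite A" "finite B" "h ` A \<subseteq> B"
  shows "card A = (\<Sum>y\<in>B. card {x \<in> A. h x = y})"
  using sum.group[OF assms, of "\<lambda>_. 1::nat"] by simp

text \<open>
  The pairs of permutations are grouped by their restrictions to \<open>X\<close>. Given the restrictions, the two
  permutations are extended independently.
\<close>

lemma card_tree_on:
  assumes V: "finite V" and X: "X \<subseteq> V"
  shows "card {sp \<in> perms V m \<times> perms V m. tree_on X sp} =
    (\<Sum>tr\<in>tree_pairs X. ext_count (card V) m (card X) (ncyc X (fst tr)) *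
      ext_count (card V) m (card X) (ncyc X (snd tr)))"
proof -
  define h where "h sp = (restr X (fst sp), restr X (snd sp))" for sp :: "('a \<Rightarrow> 'a) \<times> ('a \<Rightarrow> 'a)"
  let ?A = "{sp \<in> perms V m \<times> perms V m. tree_on X sp}"
  have finA: "finite ?A" using finite_perms[OF V] by simp
  have finX: "finite X" using V X finite_subset by blast
  have bijs: "bij f" if "f \<in> perms V m" for f using that permutes_bij by (auto simp: perms_def)
  have hA: "h sp \<in> tree_pairs X" if sp: "sp \<in> ?A" for sp
  proof -
    obtain s p where e: "sp = (s, p)" by (cases sp)
    have b: "bij s" "bij p" and t: "tree_on X (s, p)" using sp bijs e by auto
    have r: "restr X s permutes X" "restr X p permutes X"
      using tree_on_image[OF t b(1)] b by (auto intro: restr_permutes simp: bij_is_inj)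
    moreover have "tree_on X (restr X s, restr X p)"
      by (rule tree_on_agree[OF t b permutes_bij[OF r(1)] permutes_bij[OF r(2)]]) (simp_all add: restr_def)
    ultimately show ?thesis by (simp add: tree_pairs_def h_def e)
  qed
  have "card ?A = (\<Sum>tr\<in>tree_pairs X. card {sp \<in> ?A. h sp = tr})"
    by (rule card_eq_sum_fibers[OF finA finite_tree_pairs[OF finX] image_subsetI[OF hA]])
  also have "\<dots> = (\<Sum>tr\<in>tree_pairs X. card (extensions V m X (fst tr) \<times> extensions V m X (snd tr)))"
  proof (rule sum.cong[OF refl])
    fix tr assume tr: "tr \<in> tree_pairs X"
    obtain t r where e: "tr = (t, r)" by (cases tr)
    have tr': "t permutes X" "r permutes X" "tree_on X (t, r)" using tr by (auto simp: tree_pairs_def e)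
    have "{sp \<in> ?A. h sp = tr} = extensions V m X t \<times> extensions V m X r"
    proof
      show "{sp \<in> ?A. h sp = tr} \<subseteq> extensions V m X t \<times> extensions V m X r"
        by (auto simp: extensions_def h_def e restr_def fun_eq_iff)
      show "extensions V m X t \<times> extensions V m X r \<subseteq> {sp \<in> ?A. h sp = tr}"
      proof
        fix sp assume "sp \<in> extensions V m X t \<times> extensions V m X r"
        then obtain s p where sp: "sp = (s, p)" "s \<in> perms V m" "p \<in> perms V m"
          "\<And>z. z \<in> X \<Longrightarrow> s z = t z" "\<And>z. z \<in> X \<Longrightarrow> p z = r z"
          by (auto simp: extensions_def)
        have "tree_on X (s, p)"
          by (rule tree_on_agree[OF tr'(3)]) (use sp bijs tr' permutes_bij in auto)
        moreover have "restr X s = t" "restr X p = r"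
          using sp(4,5) permutes_not_in[OF tr'(1)] permutes_not_in[OF tr'(2)]
          by (auto simp: restr_def fun_eq_iff)
        ultimately show "sp \<in> {sp \<in> ?A. h sp = tr}" using sp by (simp add: h_def e)
      qed
    qed
    then show "card {sp \<in> ?A. h sp = tr} = card (extensions V m X (fst tr) \<times> extensions V m X (snd tr))"
      by (simp add: e)
  qed
  also have "\<dots> = (\<Sum>tr\<in>tree_pairs X. ext_count (card V) m (card X) (ncyc X (fst tr)) *
      ext_count (card V) m (card X) (ncyc X (snd tr)))"
    by (rule sum.cong[OF refl])
      (simp add: card_cartesian_product card_extensions[OF V X] tree_pairs_def)
  finally show ?thesis .
qed

text \<open>
  Two disjoint tree components are treated as one block, on which the restrictions are composed. This is
  the count that is needed for the second moment.
\<close>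

lemma card_tree_on_two:
  assumes V: "finite V" and X: "X \<subseteq> V" "Y \<subseteq> V" "X \<inter> Y = {}"
  shows "card {sp \<in> perms V m \<times> perms V m. tree_on X sp \<and> tree_on Y sp} =
    (\<Sum>tr\<in>tree_pairs X. \<Sum>uv\<in>tree_pairs Y.
      ext_count (card V) m (card X + card Y) (ncyc X (fst tr) + ncyc Y (fst uv)) *
      ext_count (card V) m (card X + card Y) (ncyc X (snd tr) + ncyc Y (snd uv)))"
proof -
  define h where "h sp = ((restr X (fst sp), restr X (snd sp)), (restr Y (fst sp), restr Y (snd sp)))"
    for sp :: "('a \<Rightarrow> 'a) \<times> ('a \<Rightarrow> 'a)"
  let ?A = "{sp \<in> perms V m \<times> perms V m. tree_on X sp \<and> tree_on Y sp}"
  have finA: "finite ?A" using finite_perms[OF V] by simp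
  have fin: "finite X" "finite Y" using V X finite_subset by blast+
  have bijs: "bij f" if "f \<in> perms V m" for f using that permutes_bij by (auto simp: perms_def)
  have restr_pair: "(restr Z s, restr Z p) \<in> tree_pairs Z"
    if "tree_on Z (s, p)" "bij s" "bij p" for Z and s p :: "'a \<Rightarrow> 'a"
  proof -
    have r: "restr Z s permutes Z" "restr Z p permutes Z"
      using tree_on_image[OF that(1,2)] that by (auto intro: restr_permutes simp: bij_is_inj)
    moreover have "tree_on Z (restr Z s, restr Z p)"
      by (rule tree_on_agree[OF that permutes_bij[OF r(1)] permutes_bij[OF r(2)]]) (simp_all add: restr_def)
    ultimately show ?thesis by (simp add: tree_pairs_def)
  qed
  have hA: "h sp \<in> tree_pairs X \<times> tree_pairs Y" if sp: "sp \<in> ?A" for sp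
    using sp restr_pair bijs by (cases sp) (auto simp: h_def)
  let ?F = "\<lambda>q. {sp \<in> ?A. h sp = q}"
  have "card ?A = (\<Sum>q\<in>tree_pairs X \<times> tree_pairs Y. card (?F q))"
    by (rule card_eq_sum_fibers[OF finA finite_cartesian_product[OF
            finite_tree_pairs[OF fin(1)] finite_tree_pairs[OF fin(2)]] image_subsetI[OF hA]])
  also have "\<dots> = (\<Sum>tr\<in>tree_pairs X. \<Sum>uv\<in>tree_pairs Y. card (?F (tr, uv)))"
    by (simp add: sum.cartesian_product)
  also have "\<dots> = (\<Sum>tr\<in>tree_pairs X. \<Sum>uv\<in>tree_pairs Y.
      card (extensions V m (X \<union> Y) (fst uv \<circ> fst tr) \<times> extensions V m (X \<union> Y) (snd uv \<circ> snd tr)))"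
  proof (intro sum.cong refl)
    fix tr uv assume tr: "tr \<in> tree_pairs X" and uv: "uv \<in> tree_pairs Y"
    obtain t r where e: "tr = (t, r)" by (cases tr)
    obtain u v where e': "uv = (u, v)" by (cases uv)
    have tr': "t permutes X" "r permutes X" "tree_on X (t, r)" using tr by (auto simp: tree_pairs_def e)
    have uv': "u permutes Y" "v permutes Y" "tree_on Y (u, v)" using uv by (auto simp: tree_pairs_def e')
    have onX: "(g \<circ> f) z = f z" if "g permutes Y" "f permutes X" "z \<in> X" for f g :: "'a \<Rightarrow> 'a" and z
      using permutes_not_in[OF that(1), of "f z"] permutes_in_image[OF that(2), of z] that(3) X(3) by auto
    have onY: "(g \<circ> f) z = g z" if "g permutes Y" "f permutes X" "z \<in> Y" for f g :: "'a \<Rightarrow> 'a" and z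
    proof -
      have "z \<notin> X" using that(3) X(3) by blast
      then show ?thesis using permutes_not_in[OF that(2)] by simp
    qed
    have "?F (tr, uv) = extensions V m (X \<union> Y) (u \<circ> t) \<times> extensions V m (X \<union> Y) (v \<circ> r)"
    proof
      show "?F (tr, uv) \<subseteq> extensions V m (X \<union> Y) (u \<circ> t) \<times> extensions V m (X \<union> Y) (v \<circ> r)"
      proof
        fix sp assume "sp \<in> ?F (tr, uv)"
        then obtain s p where sp: "sp = (s, p)" "s \<in> perms V m" "p \<in> perms V m"
          and rs: "restr X s = t" "restr X p = r" "restr Y s = u" "restr Y p = v"
          by (cases sp) (auto simp: h_def e e')
        have "s z = t z" "p z = r z" if "z \<in> X" for z
          using rs(1,2) that by (metis restr_def)+
        moreover have "s z = u z" "p z = v z" if "z \<in> Y" for z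
          using rs(3,4) that by (metis restr_def)+
        ultimately show "sp \<in> extensions V m (X \<union> Y) (u \<circ> t) \<times> extensions V m (X \<union> Y) (v \<circ> r)"
          using onX[OF uv'(1) tr'(1)] onX[OF uv'(2) tr'(2)] onY[OF uv'(1) tr'(1)] onY[OF uv'(2) tr'(2)] sp
          unfolding extensions_def by auto
      qed
      show "extensions V m (X \<union> Y) (u \<circ> t) \<times> extensions V m (X \<union> Y) (v \<circ> r) \<subseteq> ?F (tr, uv)"
      proof
        fix sp assume "sp \<in> extensions V m (X \<union> Y) (u \<circ> t) \<times> extensions V m (X \<union> Y) (v \<circ> r)"
        then obtain s p where sp: "sp = (s, p)" "s \<in> perms V m" "p \<in> perms V m"
          and sz: "\<And>z. z \<in> X \<union> Y \<Longrightarrow> s z = (u \<circ> t) z" and pz: "\<And>z. z \<in> X \<union> Y \<Longrightarrow> p z = (v \<circ> r) z"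
          by (auto simp: extensions_def)
        have sX: "s z = t z" "p z = r z" if "z \<in> X" for z
          using sz[of z] pz[of z] onX[OF uv'(1) tr'(1) that] onX[OF uv'(2) tr'(2) that] that by auto
        have sY: "s z = u z" "p z = v z" if "z \<in> Y" for z
          using sz[of z] pz[of z] onY[OF uv'(1) tr'(1) that] onY[OF uv'(2) tr'(2) that] that by auto
        have "tree_on X (s, p)"
          by (rule tree_on_agree[OF tr'(3)]) (use sp sX bijs tr' permutes_bij in auto)
        moreover have "tree_on Y (s, p)"
          by (rule tree_on_agree[OF uv'(3)]) (use sp sY bijs uv' permutes_bij in auto)
        moreover have "restr X s = t" "restr X p = r"
          using sX permutes_not_in[OF tr'(1)] permutes_not_in[OF tr'(2)]
          by (auto simp: restr_def fun_eq_iff)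
        moreover have "restr Y s = u" "restr Y p = v"
          using sY permutes_not_in[OF uv'(1)] permutes_not_in[OF uv'(2)]
          by (auto simp: restr_def fun_eq_iff)
        ultimately show "sp \<in> ?F (tr, uv)" using sp by (simp add: h_def e e')
      qed
    qed
    then show "card (?F (tr, uv)) = card (extensions V m (X \<union> Y) (fst uv \<circ> fst tr) \<times>
        extensions V m (X \<union> Y) (snd uv \<circ> snd tr))"
      by (simp add: e e')
  qed
  also have "\<dots> = (\<Sum>tr\<in>tree_pairs X. \<Sum>uv\<in>tree_pairs Y.
      ext_count (card V) m (card X + card Y) (ncyc X (fst tr) + ncyc Y (fst uv)) *
      ext_count (card V) m (card X + card Y) (ncyc X (snd tr) + ncyc Y (snd uv)))"
  proof (intro sum.cong refl)
    fix tr uv assume tr: "tr \<in> tree_pairs X" and uv: "uv \<in> tree_pairs Y"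
    have XY: "X \<union> Y \<subseteq> V" and cXY: "card (X \<union> Y) = card X + card Y"
      using X fin by (auto simp: card_Un_disjoint)
    have perm: "g \<circ> f permutes (X \<union> Y)" if "g permutes Y" "f permutes X" for f g :: "'a \<Rightarrow> 'a"
      using that by (intro permutes_compose) (auto intro: permutes_subset)
    have nc: "card (extensions V m (X \<union> Y) (g \<circ> f)) =
      ext_count (card V) m (card X + card Y) (ncyc X f + ncyc Y g)"
      if "g permutes Y" "f permutes X" for f g :: "'a \<Rightarrow> 'a"
      unfolding card_extensions[OF V XY perm[OF that]] ncyc_comp_block[OF that X(3) fin] cXY ..
    show "card (extensions V m (X \<union> Y) (fst uv \<circ> fst tr) \<times> extensions V m (X \<union> Y) (snd uv \<circ> snd tr)) =
      ext_count (card V) m (card X + card Y) (ncyc X (fst tr) + ncyc Y (fst uv)) *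
      ext_count (card V) m (card X + card Y) (ncyc X (snd tr) + ncyc Y (snd uv))"
      using tr uv by (simp add: card_cartesian_product nc tree_pairs_def)
  qed
  finally show ?thesis .
qed


text \<open>
  Conjugation by a bijection relabels the points. It is used to show that the counts for a component
  depend only on its number of points.
\<close>

lemma cyc_rel_conj:
  fixes \<phi> :: "'a \<Rightarrow> 'a"
  assumes "bij \<phi>"
  shows "cyc_rel (\<phi> \<circ> f \<circ> inv \<phi>) (\<phi> x) (\<phi> y) \<longleftrightarrow> cyc_rel f x y"
proof -
  have dir: "cyc_rel (\<phi> \<circ> f \<circ> inv \<phi>) (\<phi> x) (\<phi> y)" if "bij \<phi>" "cyc_rel f x y" for \<phi> f :: "'a \<Rightarrow> 'a" and x y
    using that(2)
  proof (rule cyc_rel_least)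
    show "cyc_rel (\<phi> \<circ> f \<circ> inv \<phi>) (\<phi> x) (\<phi> (f x))" for x
      using cyc_rel_step[of "\<phi> \<circ> f \<circ> inv \<phi>" "\<phi> x"] that(1) by (simp add: bij_is_inj)
  qed (blast intro: cyc_rel_refl cyc_rel_sym cyc_rel_trans)+
  show ?thesis
  proof
    assume "cyc_rel (\<phi> \<circ> f \<circ> inv \<phi>) (\<phi> x) (\<phi> y)"
    from dir[OF bij_imp_bij_inv[OF assms] this]
    have "cyc_rel (inv \<phi> \<circ> (\<phi> \<circ> f \<circ> inv \<phi>) \<circ> inv (inv \<phi>)) x y"
      using assms by (simp add: bij_is_inj)
    moreover have "inv \<phi> \<circ> (\<phi> \<circ> f \<circ> inv \<phi>) \<circ> inv (inv \<phi>) = f"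
      using assms by (simp add: fun_eq_iff inv_inv_eq bij_is_inj)
    ultimately show "cyc_rel f x y" by simp
  qed (rule dir[OF assms])
qed

lemma ncyc_conj:
  fixes \<phi> :: "'a \<Rightarrow> 'a"
  assumes "bij \<phi>"
  shows "ncyc (\<phi> ` X) (\<phi> \<circ> f \<circ> inv \<phi>) = ncyc X f"
proof -
  have "card ((cycle_of (\<phi> \<circ> f \<circ> inv \<phi>) \<circ> \<phi>) ` X) = card (cycle_of f ` X)"
    by (rule card_image_cong) (simp add: cycle_of_eq_iff cyc_rel_conj[OF assms])
  then show ?thesis by (simp add: ncyc_def image_comp)
qed

lemma permutes_conj:
  fixes \<phi> :: "'a \<Rightarrow> 'a"
  assumes "bij \<phi>" "f permutes X"
  shows "\<phi> \<circ> f \<circ> inv \<phi> permutes \<phi> ` X"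
proof (rule bij_imp_permutes)
  have inj: "inj \<phi>" using assms(1) by (rule bij_is_inj)
  have "bij_betw (inv \<phi>) (\<phi> ` X) X"
    using inj by (intro bij_betwI[of _ _ _ \<phi>]) (auto simp: inv_f_f f_inv_into_f)
  moreover have "bij_betw f X X" by (rule permutes_imp_bij[OF assms(2)])
  moreover have "bij_betw \<phi> X (\<phi> ` X)" using inj by (meson bij_betw_imageI inj_on_subset subset_UNIV)
  ultimately show "bij_betw (\<phi> \<circ> f \<circ> inv \<phi>) (\<phi> ` X) (\<phi> ` X)"
    by (meson bij_betw_trans comp_assoc)
  show "(\<phi> \<circ> f \<circ> inv \<phi>) z = z" if "z \<notin> \<phi> ` X" for z
  proof -
    have "inv \<phi> z \<notin> X" using that assms(1) by (metis bij_inv_eq_iff image_eqI)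
    then show ?thesis using permutes_not_in[OF assms(2)] assms(1) by (simp add: bij_is_surj surj_f_inv_f)
  qed
qed

lemma tree_on_conj:
  fixes \<phi> :: "'a \<Rightarrow> 'a"
  assumes \<phi>: "bij \<phi>" and s: "bij s" and t: "tree_on X (s, p)"
  shows "tree_on (\<phi> ` X) (\<phi> \<circ> s \<circ> inv \<phi>, \<phi> \<circ> p \<circ> inv \<phi>)"
proof -
  let ?c = "\<lambda>f. \<phi> \<circ> f \<circ> inv \<phi>"
  let ?P = "perm_pair (inv s) p" and ?P' = "perm_pair (inv (?c s)) (?c p)"
  have t: "tree_cycle ?P X" using t by simp
  have inv_c: "inv (?c s) = ?c (inv s)"
    using \<phi> s by (simp add: o_inv_distrib bij_comp bij_imp_bij_inv inv_inv_eq comp_assoc)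
  have P': "?P' d = ?c (?P d)" for d by (simp add: perm_pair_def inv_c)
  have img: "?c f ` (\<phi> ` X) = \<phi> ` (f ` X)" for f
    using \<phi> by (simp add: image_image bij_is_inj inv_f_f)
  have comp: "?P' True \<circ> ?P' False = ?c (?P True \<circ> ?P False)"
    unfolding P' using \<phi> by (simp add: fun_eq_iff bij_is_inj)
  have "cycle_of (?c (?P True \<circ> ?P False)) (\<phi> x) = \<phi> ` X" if x: "x \<in> X" for x
  proof -
    have "cycle_of (?c f) (\<phi> x) = \<phi> ` cycle_of f x" for f
    proof
      show "\<phi> ` cycle_of f x \<subseteq> cycle_of (?c f) (\<phi> x)"
        by (auto simp: cycle_of_def cyc_rel_conj[OF \<phi>])
      show "cycle_of (?c f) (\<phi> x) \<subseteq> \<phi> ` cycle_of f x"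
      proof
        fix y assume y: "y \<in> cycle_of (?c f) (\<phi> x)"
        have e: "y = \<phi> (inv \<phi> y)" using \<phi> by (simp add: bij_is_surj surj_f_inv_f)
        then have "cyc_rel f x (inv \<phi> y)"
          using y cyc_rel_conj[OF \<phi>, of f x "inv \<phi> y"] by (simp add: cycle_of_def)
        then show "y \<in> \<phi> ` cycle_of f x" using e by (auto simp: cycle_of_def)
      qed
    qed
    then show ?thesis using t x by (simp add: tree_cycle_def)
  qed
  moreover have "card (\<phi> ` X) = card X"
    using \<phi> by (intro card_image) (meson bij_is_inj inj_on_subset subset_UNIV)
  moreover have "?c (?P d) ` (\<phi> ` X) = \<phi> ` X" for d using t unfolding img by (simp add: tree_cycle_def)
  moreover have "finite (\<phi> ` X)" "\<phi> ` X \<noteq> {}"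
    "ncyc X (?P True) + ncyc X (?P False) = Suc (card X)"
    using t by (simp_all add: tree_cycle_def)
  ultimately have "tree_cycle ?P' (\<phi> ` X)"
    unfolding tree_cycle_def comp unfolding P' ncyc_conj[OF \<phi>] by (intro conjI) (simp_all only:, auto)
  then show ?thesis by simp
qed

text \<open>
  A bijection between two finite sets of the same size extends to a permutation of their union, and by the
  identity to the whole type; a bijection of the whole type can be used for conjugation.
\<close>

lemma exists_bij_image:
  fixes X Y :: "'a set"
  assumes "finite X" "finite Y" "card X = card Y"
  obtains \<phi> where "bij \<phi>" "\<phi> ` X = Y"
proof -
  define U where "U = X \<union> Y"
  have fin: "finite (U - X)" "finite (U - Y)" using assms by (auto simp: U_def)
  have "card (U - X) = card (U - Y)"
    using assms by (simp add: U_def card_Diff_subset)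
  then obtain g where g: "bij_betw g (U - X) (U - Y)"
    using finite_same_card_bij[OF fin] by blast
  obtain f where f: "bij_betw f X Y" using finite_same_card_bij[OF assms] by blast
  define \<phi> where "\<phi> z = (if z \<in> X then f z else if z \<in> U then g z else z)" for z
  have 1: "bij_betw \<phi> X Y" using f by (rule bij_betw_cong[THEN iffD1, rotated]) (simp add: \<phi>_def)
  moreover have "bij_betw \<phi> (U - X) (U - Y)"
    using g by (rule bij_betw_cong[THEN iffD1, rotated]) (simp add: \<phi>_def)
  ultimately have "bij_betw \<phi> (X \<union> (U - X)) (Y \<union> (U - Y))"
    by (intro bij_betw_combine) auto
  moreover have "X \<union> (U - X) = U" "Y \<union> (U - Y) = U" by (auto simp: U_def)
  ultimately have "\<phi> permutes U" by (intro bij_imp_permutes) (auto simp: \<phi>_def U_def)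
  then have "bij \<phi>" by (rule permutes_bij)
  moreover have "\<phi> ` X = Y" using 1 by (simp add: bij_betw_def)
  ultimately show ?thesis using that by blast
qed

lemma sum_tree_pairs_transport:
  fixes X Y :: "'a set" and F :: "nat \<Rightarrow> nat \<Rightarrow> 'b::comm_monoid_add"
  assumes "finite X" "finite Y" "card X = card Y"
  shows "(\<Sum>tr\<in>tree_pairs X. F (ncyc X (fst tr)) (ncyc X (snd tr))) =
    (\<Sum>tr\<in>tree_pairs Y. F (ncyc Y (fst tr)) (ncyc Y (snd tr)))"
proof -
  obtain \<phi> where \<phi>: "bij \<phi>" "\<phi> ` X = Y" by (rule exists_bij_image[OF assms])
  have \<phi>': "bij (inv \<phi>)" "inv \<phi> ` Y = X"
    using \<phi> by (auto simp: bij_imp_bij_inv bij_is_inj image_inv_f_f)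
  let ?c = "\<lambda>\<psi> (tr :: ('a \<Rightarrow> 'a) \<times> ('a \<Rightarrow> 'a)). (\<psi> \<circ> fst tr \<circ> inv \<psi>, \<psi> \<circ> snd tr \<circ> inv \<psi>)"
  have in_pairs: "?c \<psi> tr \<in> tree_pairs (\<psi> ` Z)" if "bij \<psi>" "tr \<in> tree_pairs Z" for \<psi> :: "'a \<Rightarrow> 'a" and tr Z
    using that permutes_conj[OF that(1)] tree_on_conj[OF that(1), where s = "fst tr" and X = Z and p = "snd tr"] permutes_bij
    by (auto simp: tree_pairs_def)
  have undo: "inv \<psi> \<circ> (\<psi> \<circ> f \<circ> inv \<psi>) \<circ> inv (inv \<psi>) = f"
    "\<psi> \<circ> (inv \<psi> \<circ> f \<circ> inv (inv \<psi>)) \<circ> inv \<psi> = f" if "bij \<psi>" for \<psi> f :: "'a \<Rightarrow> 'a"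
    using that by (simp_all add: fun_eq_iff inv_inv_eq bij_is_inj bij_is_surj surj_f_inv_f)
  show ?thesis
  proof (rule sum.reindex_bij_witness[of _ "?c (inv \<phi>)" "?c \<phi>"])
    fix tr assume tr: "tr \<in> tree_pairs X"
    show "?c (inv \<phi>) (?c \<phi> tr) = tr" using undo(1)[OF \<phi>(1)] by simp
    show "?c \<phi> tr \<in> tree_pairs Y" using in_pairs[OF \<phi>(1) tr] \<phi>(2) by simp
    show "F (ncyc Y (fst (?c \<phi> tr))) (ncyc Y (snd (?c \<phi> tr))) = F (ncyc X (fst tr)) (ncyc X (snd tr))"
      using ncyc_conj[OF \<phi>(1), of X] \<phi>(2) by simp
  next
    fix tr assume tr: "tr \<in> tree_pairs Y"
    show "?c \<phi> (?c (inv \<phi>) tr) = tr" using undo(2)[OF \<phi>(1)] by simp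
    show "?c (inv \<phi>) tr \<in> tree_pairs X" using in_pairs[OF \<phi>'(1) tr] \<phi>'(2) by simp
  qed
qed

section \<open>Density of tree components\<close>

definition treecount :: "nat \<Rightarrow> nat \<Rightarrow> (nat \<Rightarrow> nat) \<times> (nat \<Rightarrow> nat) \<Rightarrow> nat" where
  "treecount n k x = card {X. X \<subseteq> {1..n} \<and> card X = k \<and> tree_on X x}"

text \<open>
  The limit of the number of tree components with \<open>k\<close> points, divided by \<open>n\<close>. Only the second factor
  depends on \<open>t\<close>: the two permutations have \<open>k + 1\<close> cycles on the component in total, and the limit in
  \<open>stirling_block_ratio_limit\<close> depends on that total alone.
\<close>

definition tree_density :: "real \<Rightarrow> nat \<Rightarrow> real" where
  "tree_density t k = real (card (tree_pairs {1..k})) / fact k * (t ^ Suc k / (1 + t) ^ (2 * k))"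

lemma choose_limit: "(\<lambda>n. real (n choose k) / real n ^ k) \<longlonglongrightarrow> 1 / fact k"
proof -
  have "(\<lambda>n. (\<Prod>i<k. (real n - real i) / real n) / fact k) \<longlonglongrightarrow> (\<Prod>i<k. 1) / fact k"
  proof (intro tendsto_divide tendsto_prod tendsto_const)
    show "(\<lambda>n. (real n - real i) / real n) \<longlonglongrightarrow> 1" for i by real_asymp
  qed simp
  then have "(\<lambda>n. (\<Prod>i<k. (real n - real i) / real n) / fact k) \<longlonglongrightarrow> 1 / fact k" by simp
  moreover have "(\<Prod>i<k. (real n - real i) / real n) / fact k = real (n choose k) / real n ^ k" for n
    by (simp add: prod_dividef binomial_gbinomial gbinomial_prod_rev lessThan_atLeast0 ac_simps)
  ultimately show ?thesis by simp
qed

lemma choose_limit_shift: "(\<lambda>n. real ((n - k) choose k) / real n ^ k) \<longlonglongrightarrow> 1 / fact k"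
proof -
  have f: "filterlim (\<lambda>n::nat. n - k) at_top sequentially" by (rule filterlim_minus_const_nat_at_top)
  have "(\<lambda>n. real ((n - k) choose k) / real (n - k) ^ k * ((real n - real k) / real n) ^ k)
      \<longlonglongrightarrow> 1 / fact k * 1 ^ k"
  proof (intro tendsto_mult tendsto_power)
    show "(\<lambda>n. real ((n - k) choose k) / real (n - k) ^ k) \<longlonglongrightarrow> 1 / fact k"
      by (rule filterlim_compose[OF choose_limit f])
    show "(\<lambda>n. (real n - real k) / real n) \<longlonglongrightarrow> 1" by real_asymp
  qed
  then have "(\<lambda>n. real ((n - k) choose k) / real (n - k) ^ k * ((real n - real k) / real n) ^ k)
      \<longlonglongrightarrow> 1 / fact k" by simp
  then show ?thesis
  proof (rule Lim_transform_eventually)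
    show "\<forall>\<^sub>F n in sequentially. real ((n - k) choose k) / real (n - k) ^ k * ((real n - real k) / real n) ^ k
        = real ((n - k) choose k) / real n ^ k"
      using eventually_gt_at_top[of k]
      by eventually_elim (simp add: power_divide of_nat_diff)
  qed
qed

lemma finite_subsets_of_card: "finite {X. X \<subseteq> {1..n::nat} \<and> card X = k}"
  by (rule finite_subset[of _ "Pow {1..n}"]) auto

lemma treecount_eq_sum:
  "real (treecount n k x) = (\<Sum>X | X \<subseteq> {1..n} \<and> card X = k. of_bool (tree_on X x))"
proof -
  have "{X. X \<subseteq> {1..n} \<and> card X = k \<and> tree_on X x} = {X. X \<subseteq> {1..n} \<and> card X = k} \<inter> {X. tree_on X x}"
    by blast
  then show ?thesis
    using finite_subsets_of_card[of n k] by (simp add: treecount_def sum_of_bool_eq)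
qed

text \<open>
  Different tree components are disjoint, so only disjoint pairs \<open>X\<close>, \<open>Y\<close> contribute besides the diagonal.
\<close>

lemma treecount_square:
  assumes "0 < k"
  shows "(real (treecount n k x))\<^sup>2 = real (treecount n k x) +
    (\<Sum>X | X \<subseteq> {1..n} \<and> card X = k. \<Sum>Y | Y \<subseteq> {1..n} - X \<and> card Y = k.
      of_bool (tree_on X x \<and> tree_on Y x))"
proof -
  let ?I = "{X. X \<subseteq> {1..n} \<and> card X = k}"
  let ?b = "\<lambda>X. of_bool (tree_on X x) :: real"
  have fin: "finite ?I" by (rule finite_subsets_of_card)
  have "(\<Sum>Y\<in>?I. ?b X * ?b Y) = ?b X + (\<Sum>Y | Y \<subseteq> {1..n} - X \<and> card Y = k. of_bool (tree_on X x \<and> tree_on Y x))"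
    if X: "X \<in> ?I" for X
  proof -
    have sub: "{Y. Y \<subseteq> {1..n} - X \<and> card Y = k} \<subseteq> ?I - {X}"
    proof
      fix Y assume Y: "Y \<in> {Y. Y \<subseteq> {1..n} - X \<and> card Y = k}"
      then have "Y \<noteq> {}" "X \<inter> Y = {}" using assms by auto
      then show "Y \<in> ?I - {X}" using Y by blast
    qed
    have "(\<Sum>Y\<in>?I. ?b X * ?b Y) = ?b X * ?b X + (\<Sum>Y\<in>?I - {X}. ?b X * ?b Y)"
      by (rule sum.remove[OF fin X])
    also have "(\<Sum>Y\<in>?I - {X}. ?b X * ?b Y) = (\<Sum>Y | Y \<subseteq> {1..n} - X \<and> card Y = k. ?b X * ?b Y)"
    proof (rule sum.mono_neutral_right[OF _ sub])
      show "\<forall>Y\<in>?I - {X} - {Y. Y \<subseteq> {1..n} - X \<and> card Y = k}. ?b X * ?b Y = 0"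
      proof
        fix Y assume Y: "Y \<in> ?I - {X} - {Y. Y \<subseteq> {1..n} - X \<and> card Y = k}"
        then have "X \<inter> Y \<noteq> {}" "X \<noteq> Y" by auto
        then have "\<not> (tree_on X x \<and> tree_on Y x)" using tree_cycle_disjoint by blast
        then show "?b X * ?b Y = 0" by auto
      qed
    qed (use fin in simp)
    finally show ?thesis by (simp add: of_bool_conj)
  qed
  then have "(\<Sum>X\<in>?I. \<Sum>Y\<in>?I. ?b X * ?b Y) = (\<Sum>X\<in>?I. ?b X +
      (\<Sum>Y | Y \<subseteq> {1..n} - X \<and> card Y = k. of_bool (tree_on X x \<and> tree_on Y x)))"
    by (rule sum.cong[OF refl])
  then show ?thesis
    unfolding treecount_eq_sum power2_eq_square sum_product sum.distrib .
qed

text \<open>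
  Each tree component is a cycle of the product.
\<close>

lemma sum_treecount_le_ncyc:
  assumes s: "s permutes {1..n}" and p: "p permutes {1..n}"
  shows "(\<Sum>k = 1..K. treecount n k (s, p)) \<le> ncyc {1..n} (inv s \<circ> p)"
proof -
  let ?T = "\<lambda>k. {X. X \<subseteq> {1..n} \<and> card X = k \<and> tree_on X (s, p)}"
  have fin: "finite (?T k)" for k by (rule finite_subset[of _ "Pow {1..n}"]) auto
  have "(\<Sum>k = 1..K. treecount n k (s, p)) = card (\<Union>k\<in>{1..K}. ?T k)"
    unfolding treecount_def by (rule card_UN_disjoint[symmetric]) (use fin in auto)
  also have "\<dots> \<le> card (cycle_of (inv s \<circ> p) ` {1..n})"
  proof (rule card_mono)
    show "(\<Union>k\<in>{1..K}. ?T k) \<subseteq> cycle_of (inv s \<circ> p) ` {1..n}"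
    proof
      fix X assume "X \<in> (\<Union>k\<in>{1..K}. ?T k)"
      then have X: "X \<subseteq> {1..n}" "tree_cycle (perm_pair (inv s) p) X" by auto
      then obtain v where v: "v \<in> X" by (auto simp: tree_cycle_def)
      have "cycle_of (inv s \<circ> p) v = X"
        using X(2) v by (simp add: tree_cycle_def perm_pair_def)
      then show "X \<in> cycle_of (inv s \<circ> p) ` {1..n}" using v X(1) by blast
    qed
  qed simp
  finally show ?thesis by (simp add: ncyc_def)
qed

text \<open>
  A cycle of the product has more than \<open>K\<close> points, or is a tree component, or consists of starting points
  of short lollipops. There are at most \<open>n / K\<close> cycles of the first kind; a cycle of the third kind is
  charged to one of its points.
\<close>

lemma ncyc_le_sum_treecount:
  assumes s: "s permutes {1..n}" and p: "p permutes {1..n}" and K: "0 < K"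
  shows "real (ncyc {1..n} (inv s \<circ> p)) \<le> (\<Sum>k = 1..K. real (treecount n k (s, p))) + real n / real K +
    (\<Sum>L = 1..2 * K. real (card (bad_points {1..n} L (perm_pair s p))))"
proof -
  define V where "V = {1..n}"
  let ?f = "inv s \<circ> p"
  have finV: "finite V" and sV: "s permutes V" and pV: "p permutes V" using s p by (auto simp: V_def)
  have fV: "?f permutes V" by (rule permutes_compose[OF pV permutes_inv[OF sV]])
  define \<C> where "\<C> = cycle_of ?f ` V"
  define Long where "Long = {X \<in> \<C>. K < card X}"
  define Tree where "Tree = {X \<in> \<C>. card X \<le> K \<and> tree_on X (s, p)}"
  define Bad where "Bad = {X \<in> \<C>. card X \<le> K \<and> \<not> tree_on X (s, p)}"
  have fin\<C>: "finite \<C>" using finV by (simp add: \<C>_def)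
  have sub: "X \<subseteq> V" "finite X" "X \<noteq> {}" if "X \<in> \<C>" for X
  proof -
    obtain v where v: "v \<in> V" "X = cycle_of ?f v" using \<open>X \<in> \<C>\<close> by (auto simp: \<C>_def)
    show "X \<subseteq> V" using cycle_of_subset[OF fV v(1)] v(2) by simp
    then show "finite X" using finV finite_subset by blast
    have "v \<in> X" using v(2) by (simp add: cycle_of_def)
    then show "X \<noteq> {}" by blast
  qed
  have cyc: "X = cycle_of ?f v" if "X \<in> \<C>" "v \<in> X" for X v
  proof -
    obtain w where w: "X = cycle_of ?f w" using \<open>X \<in> \<C>\<close> by (auto simp: \<C>_def)
    then show ?thesis using that(2) by (simp add: cycle_of_eq_iff) (simp add: cycle_of_def)
  qed
  have disj: "X \<inter> Y = {}" if "X \<in> \<C>" "Y \<in> \<C>" "X \<noteq> Y" for X Y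
    using cyc that by blast
  have split: "\<C> = Long \<union> (Tree \<union> Bad)" by (auto simp: Long_def Tree_def Bad_def)
  have "card \<C> \<le> card Long + card (Tree \<union> Bad)" unfolding split by (rule card_Un_le)
  also have "\<dots> \<le> card Long + (card Tree + card Bad)" by (intro add_left_mono card_Un_le)
  finally have c: "ncyc V ?f \<le> card Long + (card Tree + card Bad)" by (simp add: ncyc_def \<C>_def)
  have "K * card Long = (\<Sum>X\<in>Long. K)" by simp
  also have "\<dots> \<le> (\<Sum>X\<in>Long. card X)" by (rule sum_mono) (simp add: Long_def)
  also have "\<dots> = card (\<Union>Long)"
    using sub disj by (intro card_Union_disjoint[symmetric]) (auto simp: pairwise_def disjnt_def Long_def)
  also have "\<dots> \<le> card V" using sub finV by (intro card_mono) (auto simp: Long_def)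
  finally have "K * card Long \<le> n" by (simp add: V_def)
  then have "real K * real (card Long) \<le> real n" by (metis of_nat_le_iff of_nat_mult)
  then have long: "real (card Long) \<le> real n / real K" using K by (simp add: field_simps)
  have "Tree \<subseteq> (\<Union>k\<in>{1..K}. {X. X \<subseteq> {1..n} \<and> card X = k \<and> tree_on X (s, p)})"
  proof
    fix X assume X: "X \<in> Tree"
    then have "0 < card X" using sub[of X] by (simp add: Tree_def card_gt_0_iff)
    then show "X \<in> (\<Union>k\<in>{1..K}. {X. X \<subseteq> {1..n} \<and> card X = k \<and> tree_on X (s, p)})"
      using X sub(1)[of X] by (auto simp: Tree_def V_def)
  qed
  then have "card Tree \<le> card (\<Union>k\<in>{1..K}. {X. X \<subseteq> {1..n} \<and> card X = k \<and> tree_on X (s, p)})"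
    by (intro card_mono) (auto intro: finite_subset[of _ "Pow {1..n}"])
  also have "\<dots> \<le> (\<Sum>k = 1..K. treecount n k (s, p))"
    unfolding treecount_def by (rule card_UN_le) simp
  finally have "card Tree \<le> (\<Sum>k = 1..K. treecount n k (s, p))" .
  then have tree: "real (card Tree) \<le> (\<Sum>k = 1..K. real (treecount n k (s, p)))"
    unfolding of_nat_sum[symmetric] of_nat_le_iff .
  have badv: "v \<in> (\<Union>L\<in>{1..2 * K}. bad_points V L (perm_pair s p))" if X: "X \<in> Bad" and v: "v \<in> X" for X v
  proof -
    have XC: "X \<in> \<C>" using X by (simp add: Bad_def)
    have Xv: "cycle_of ?f v = X" using cyc[OF XC v] by simp
    have "v \<in> V" using sub(1)[OF XC] v by blast
    moreover have "\<not> tree_cycle (perm_pair (inv s) p) (cycle_of ?f v)" using X by (simp add: Xv Bad_def)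
    ultimately obtain L where "L \<in> {1..2 * card X}" "v \<in> bad_points V L (perm_pair s p)"
      using bad_point_of_not_tree_cycle[OF finV sV pV] Xv by metis
    moreover have "card X \<le> K" using X by (simp add: Bad_def)
    ultimately show ?thesis by force
  qed
  have finB: "finite (bad_points V L P)" for L P using finV by (simp add: bad_points_def)
  have "card Bad \<le> card (\<Union>L\<in>{1..2 * K}. bad_points V L (perm_pair s p))"
  proof (rule card_inj_on_le[of "\<lambda>X. SOME v. v \<in> X"])
    have some: "(SOME v. v \<in> X) \<in> X" if "X \<in> Bad" for X
      using sub(3)[of X] that by (auto simp: Bad_def some_in_eq)
    show "inj_on (\<lambda>X. SOME v. v \<in> X) Bad"
    proof (rule inj_onI)
      fix X Y assume XY: "X \<in> Bad" "Y \<in> Bad" "(SOME v. v \<in> X) = (SOME v. v \<in> Y)"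
      then have "X \<inter> Y \<noteq> {}" using some[of X] some[of Y] by auto
      then show "X = Y" using disj[of X Y] XY by (auto simp: Bad_def)
    qed
    show "(\<lambda>X. SOME v. v \<in> X) ` Bad \<subseteq> (\<Union>L\<in>{1..2 * K}. bad_points V L (perm_pair s p))"
      using badv some by blast
  qed (use finB in simp)
  also have "\<dots> \<le> (\<Sum>L = 1..2 * K. card (bad_points V L (perm_pair s p)))"
    by (rule card_UN_le) simp
  finally have bad: "real (card Bad) \<le> (\<Sum>L = 1..2 * K. real (card (bad_points V L (perm_pair s p))))"
    unfolding of_nat_sum[symmetric] of_nat_le_iff .
  have "real (ncyc V ?f) \<le> real (card Long) + (real (card Tree) + real (card Bad))"
    using c unfolding of_nat_add[symmetric] of_nat_le_iff .
  then show ?thesis using long tree bad unfolding V_def by linarith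
qed

context sphere_pair
begin

lemma mean_of_bool: "mean n (\<lambda>x. of_bool (Q x)) = real (card {x \<in> pairs n. Q x}) / (real (stirling n (m n)))\<^sup>2"
proof -
  have "{x \<in> pairs n. Q x} = pairs n \<inter> {x. Q x}" by blast
  then show ?thesis unfolding mean_eq using finite_pairs[of n] by (simp add: sum_of_bool_eq)
qed

lemma mean_treecount:
  "mean n (\<lambda>x. real (treecount n k x)) = real (n choose k) * (\<Sum>tr\<in>tree_pairs {1..k}.
    real (ext_count n (m n) k (ncyc {1..k} (fst tr))) * real (ext_count n (m n) k (ncyc {1..k} (snd tr)))) /
    (real (stirling n (m n)))\<^sup>2"
proof -
  let ?I = "{X. X \<subseteq> {1..n} \<and> card X = k}"
  let ?W = "\<lambda>c d. real (ext_count n (m n) k c) * real (ext_count n (m n) k d)"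
  let ?T = "\<Sum>tr\<in>tree_pairs {1..k}. ?W (ncyc {1..k} (fst tr)) (ncyc {1..k} (snd tr))"
  let ?S = "(real (stirling n (m n)))\<^sup>2"
  have "mean n (\<lambda>x. real (treecount n k x)) = (\<Sum>X\<in>?I. mean n (\<lambda>x. of_bool (tree_on X x)))"
    unfolding treecount_eq_sum by (rule mean_sum)
  also have "\<dots> = (\<Sum>X\<in>?I. ?T / ?S)"
  proof (rule sum.cong[OF refl])
    fix X assume X: "X \<in> ?I"
    have fX: "finite X" using X finite_subset by blast
    have "real (card {x \<in> pairs n. tree_on X x}) = (\<Sum>tr\<in>tree_pairs X. ?W (ncyc X (fst tr)) (ncyc X (snd tr)))"
      using card_tree_on[of "{1..n}" X "m n"] X by simp
    also have "\<dots> = ?T"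
      by (rule sum_tree_pairs_transport[of X "{1..k}" ?W]) (use X fX in auto)
    finally show "mean n (\<lambda>x. of_bool (tree_on X x)) = ?T / ?S" unfolding mean_of_bool by simp
  qed
  also have "\<dots> = real (card ?I) * (?T / ?S)" by simp
  also have "card ?I = n choose k" using n_subsets[of "{1..n}" k] by simp
  finally show ?thesis by simp
qed

lemma mean_treecount_square:
  assumes k: "0 < k"
  shows "mean n (\<lambda>x. (real (treecount n k x))\<^sup>2) = mean n (\<lambda>x. real (treecount n k x)) +
    real (n choose k) * real ((n - k) choose k) *
    (\<Sum>tr\<in>tree_pairs {1..k}. \<Sum>uv\<in>tree_pairs {1..k}.
      real (ext_count n (m n) (2 * k) (ncyc {1..k} (fst tr) + ncyc {1..k} (fst uv))) *
      real (ext_count n (m n) (2 * k) (ncyc {1..k} (snd tr) + ncyc {1..k} (snd uv)))) /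
    (real (stirling n (m n)))\<^sup>2"
proof -
  let ?I = "{X. X \<subseteq> {1..n} \<and> card X = k}"
  let ?J = "\<lambda>X. {Y. Y \<subseteq> {1..n} - X \<and> card Y = k}"
  let ?W = "\<lambda>c d c' d'. real (ext_count n (m n) (2 * k) (c + c')) * real (ext_count n (m n) (2 * k) (d + d'))"
  let ?T = "\<Sum>tr\<in>tree_pairs {1..k}. \<Sum>uv\<in>tree_pairs {1..k}.
    ?W (ncyc {1..k} (fst tr)) (ncyc {1..k} (snd tr)) (ncyc {1..k} (fst uv)) (ncyc {1..k} (snd uv))"
  let ?S = "(real (stirling n (m n)))\<^sup>2"
  have "mean n (\<lambda>x. (real (treecount n k x))\<^sup>2) = mean n (\<lambda>x. real (treecount n k x)) +
    (\<Sum>X\<in>?I. \<Sum>Y\<in>?J X. mean n (\<lambda>x. of_bool (tree_on X x \<and> tree_on Y x)))"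
    unfolding treecount_square[OF k] mean_add mean_sum ..
  also have "(\<Sum>X\<in>?I. \<Sum>Y\<in>?J X. mean n (\<lambda>x. of_bool (tree_on X x \<and> tree_on Y x))) = (\<Sum>X\<in>?I. \<Sum>Y\<in>?J X. ?T / ?S)"
  proof (intro sum.cong refl)
    fix X Y assume X: "X \<in> ?I" and Y: "Y \<in> ?J X"
    have f: "finite X" "finite Y" using X Y finite_subset by blast+
    have XY: "X \<subseteq> {1..n}" "Y \<subseteq> {1..n}" "X \<inter> Y = {}" using X Y by auto
    have ck: "card X = k" "card Y = k" "card X + card Y = 2 * k" using X Y by auto
    have "real (card {x \<in> pairs n. tree_on X x \<and> tree_on Y x}) =
      (\<Sum>tr\<in>tree_pairs X. \<Sum>uv\<in>tree_pairs Y.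
        ?W (ncyc X (fst tr)) (ncyc X (snd tr)) (ncyc Y (fst uv)) (ncyc Y (snd uv)))"
      unfolding card_tree_on_two[OF finite_atLeastAtMost XY] ck(3) by simp
    also have "\<dots> = (\<Sum>tr\<in>tree_pairs X. \<Sum>uv\<in>tree_pairs {1..k}.
        ?W (ncyc X (fst tr)) (ncyc X (snd tr)) (ncyc {1..k} (fst uv)) (ncyc {1..k} (snd uv)))"
      by (intro sum.cong refl sum_tree_pairs_transport) (use ck f in auto)
    also have "\<dots> = ?T"
      by (rule sum_tree_pairs_transport[of X "{1..k}" "\<lambda>c d. \<Sum>uv\<in>tree_pairs {1..k}.
          ?W c d (ncyc {1..k} (fst uv)) (ncyc {1..k} (snd uv))"]) (use ck f in auto)
    finally show "mean n (\<lambda>x. of_bool (tree_on X x \<and> tree_on Y x)) = ?T / ?S" unfolding mean_of_bool by simp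
  qed
  also have "\<dots> = (\<Sum>X\<in>?I. real ((n - k) choose k) * (?T / ?S))"
  proof (rule sum.cong[OF refl])
    fix X assume X: "X \<in> ?I"
    have "card ({1..n} - X) = n - k" using X finite_subset[of X "{1..n}"] by (simp add: card_Diff_subset)
    then have "card (?J X) = (n - k) choose k" using n_subsets[of "{1..n} - X" k] by simp
    then show "(\<Sum>Y\<in>?J X. ?T / ?S) = real ((n - k) choose k) * (?T / ?S)" by simp
  qed
  also have "\<dots> = real (card ?I) * (real ((n - k) choose k) * (?T / ?S))" by simp
  also have "card ?I = n choose k" using n_subsets[of "{1..n}" k] by simp
  finally show ?thesis by simp
qed

lemma ext_count_limit:
  assumes reg: "regime t (\<lambda>n. n) m" and c: "c \<le> h"
  shows "(\<lambda>n. real n ^ (h - c) * real (ext_count n (m n) h c) / real (stirling n (m n))) \<longlonglongrightarrow> t ^ c / (1 + t) ^ h"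
proof (rule Lim_transform_eventually[OF stirling_block_ratio_limit[OF c reg]])
  show "\<forall>\<^sub>F n in sequentially. real n ^ (h - c) * real (stirling (n - h) (m n - c)) / real (stirling n (m n)) =
      real n ^ (h - c) * real (ext_count n (m n) h c) / real (stirling n (m n))"
    using regime_eventually[OF reg, of c] by eventually_elim (simp add: ext_count_def)
qed

text \<open>
  There are about \<open>n\<^sup>k / k!\<close> candidates for the point set of a component. The two extension counts
  contribute \<open>n\<close> to the power \<open>(k + 1) - 2k\<close>, because the cycles on the component add up to \<open>k + 1\<close>;
  what remains is a factor \<open>n\<close>.
\<close>

lemma mean_treecount_limit:
  assumes reg: "regime t (\<lambda>n. n) m" and k: "0 < k"
  shows "(\<lambda>n. mean n (\<lambda>x. real (treecount n k x)) / real n) \<longlonglongrightarrow> tree_density t k"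
proof -
  let ?P = "tree_pairs {1..k}"
  let ?c = "\<lambda>tr :: (nat \<Rightarrow> nat) \<times> (nat \<Rightarrow> nat). ncyc {1..k} (fst tr)"
  let ?d = "\<lambda>tr :: (nat \<Rightarrow> nat) \<times> (nat \<Rightarrow> nat). ncyc {1..k} (snd tr)"
  let ?w = "\<lambda>n c. real n ^ (k - c) * real (ext_count n (m n) k c) / real (stirling n (m n))"
  have cd: "?c tr + ?d tr = Suc k" if "tr \<in> ?P" for tr using tree_pairs_ncyc[OF that] by simp
  have le: "?c tr \<le> k" "?d tr \<le> k" for tr using ncyc_le_card[of "{1..k}"] by simp_all
  have "(\<lambda>n. real (n choose k) / real n ^ k * (\<Sum>tr\<in>?P. ?w n (?c tr) * ?w n (?d tr))) \<longlonglongrightarrow>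
      1 / fact k * (\<Sum>tr\<in>?P. t ^ ?c tr / (1 + t) ^ k * (t ^ ?d tr / (1 + t) ^ k))"
    by (intro tendsto_mult tendsto_sum choose_limit ext_count_limit[OF reg] le)
  also have "(\<Sum>tr\<in>?P. t ^ ?c tr / (1 + t) ^ k * (t ^ ?d tr / (1 + t) ^ k)) =
      (\<Sum>tr\<in>?P. t ^ Suc k / (1 + t) ^ (2 * k))"
    by (rule sum.cong[OF refl])
      (simp only: times_divide_times_eq power_add[symmetric] cd mult_2)
  also have "1 / fact k * (\<Sum>tr\<in>?P. t ^ Suc k / (1 + t) ^ (2 * k)) = tree_density t k"
    by (simp add: tree_density_def)
  finally show ?thesis
  proof (rule Lim_transform_eventually)
    show "\<forall>\<^sub>F n in sequentially. real (n choose k) / real n ^ k * (\<Sum>tr\<in>?P. ?w n (?c tr) * ?w n (?d tr)) =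
        mean n (\<lambda>x. real (treecount n k x)) / real n"
      using eventually_gt_at_top[of 0]
    proof eventually_elim
      case (elim n)
      have "?w n (?c tr) * ?w n (?d tr) = real n ^ k / real n *
          (real (ext_count n (m n) k (?c tr)) * real (ext_count n (m n) k (?d tr))) / (real (stirling n (m n)))\<^sup>2"
        if "tr \<in> ?P" for tr
      proof -
        have "(k - ?c tr) + (k - ?d tr) = k - 1" using cd[OF that] le[of tr] by linarith
        then have "real n ^ (k - ?c tr) * real n ^ (k - ?d tr) = real n ^ (k - 1)"
          by (simp add: power_add[symmetric])
        also have "\<dots> = real n ^ k / real n" using elim k by (simp add: power_diff)
        finally have E: "real n ^ (k - ?c tr) * real n ^ (k - ?d tr) = real n ^ k / real n" .
        show ?thesis
          unfolding E[symmetric] power2_eq_square times_divide_times_eq by (simp only: ac_simps)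
      qed
      then have "(\<Sum>tr\<in>?P. ?w n (?c tr) * ?w n (?d tr)) = (\<Sum>tr\<in>?P. real n ^ k / real n *
          (real (ext_count n (m n) k (?c tr)) * real (ext_count n (m n) k (?d tr))) / (real (stirling n (m n)))\<^sup>2)"
        by (rule sum.cong[OF refl])
      also have "\<dots> = real n ^ k / real n * (\<Sum>tr\<in>?P.
          (real (ext_count n (m n) k (?c tr)) * real (ext_count n (m n) k (?d tr)))) / (real (stirling n (m n)))\<^sup>2"
        by (simp only: sum_distrib_left sum_divide_distrib)
      finally show ?case using elim unfolding mean_treecount by simp
    qed
  qed
qed

text \<open>
  The same computation for a block of two components. The limit of the block factorizes, so asymptotically
  the variance vanishes.
\<close>

lemma mean_treecount_square_limit:
  assumes reg: "regime t (\<lambda>n. n) m" and k: "0 < k"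
  shows "(\<lambda>n. mean n (\<lambda>x. (real (treecount n k x))\<^sup>2) / (real n)\<^sup>2) \<longlonglongrightarrow> (tree_density t k)\<^sup>2"
proof -
  let ?P = "tree_pairs {1..k}"
  let ?c = "\<lambda>tr :: (nat \<Rightarrow> nat) \<times> (nat \<Rightarrow> nat). ncyc {1..k} (fst tr)"
  let ?d = "\<lambda>tr :: (nat \<Rightarrow> nat) \<times> (nat \<Rightarrow> nat). ncyc {1..k} (snd tr)"
  let ?w = "\<lambda>n c. real n ^ (2 * k - c) * real (ext_count n (m n) (2 * k) c) / real (stirling n (m n))"
  let ?e = "\<lambda>n c. real (ext_count n (m n) (2 * k) c)"
  let ?S = "\<lambda>n. (real (stirling n (m n)))\<^sup>2"
  have cd: "?c tr + ?d tr = Suc k" if "tr \<in> ?P" for tr using tree_pairs_ncyc[OF that] by simp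
  have le: "?c tr + ?c uv \<le> 2 * k" "?d tr + ?d uv \<le> 2 * k" for tr uv
    using ncyc_le_card[of "{1..k}" "fst tr"] ncyc_le_card[of "{1..k}" "fst uv"]
      ncyc_le_card[of "{1..k}" "snd tr"] ncyc_le_card[of "{1..k}" "snd uv"] by simp_all
  let ?F = "\<lambda>n. real (n choose k) / real n ^ k * (real ((n - k) choose k) / real n ^ k) *
    (\<Sum>tr\<in>?P. \<Sum>uv\<in>?P. ?w n (?c tr + ?c uv) * ?w n (?d tr + ?d uv))"
  have "?F \<longlonglongrightarrow> 1 / fact k * (1 / fact k) * (\<Sum>tr\<in>?P. \<Sum>uv\<in>?P.
        t ^ (?c tr + ?c uv) / (1 + t) ^ (2 * k) * (t ^ (?d tr + ?d uv) / (1 + t) ^ (2 * k)))"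
    by (intro tendsto_mult tendsto_sum choose_limit choose_limit_shift ext_count_limit[OF reg] le)
  also have "(\<Sum>tr\<in>?P. \<Sum>uv\<in>?P.
        t ^ (?c tr + ?c uv) / (1 + t) ^ (2 * k) * (t ^ (?d tr + ?d uv) / (1 + t) ^ (2 * k))) =
      (\<Sum>tr\<in>?P. \<Sum>uv\<in>?P. (t ^ Suc k / (1 + t) ^ (2 * k))\<^sup>2)"
  proof (intro sum.cong refl)
    fix tr uv assume "tr \<in> ?P" "uv \<in> ?P"
    then have "(?c tr + ?c uv) + (?d tr + ?d uv) = Suc k + Suc k" using cd[of tr] cd[of uv] by linarith
    then have "t ^ (?c tr + ?c uv) * t ^ (?d tr + ?d uv) = t ^ Suc k * t ^ Suc k"
      unfolding power_add[symmetric] by (rule arg_cong)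
    then show "t ^ (?c tr + ?c uv) / (1 + t) ^ (2 * k) * (t ^ (?d tr + ?d uv) / (1 + t) ^ (2 * k)) =
        (t ^ Suc k / (1 + t) ^ (2 * k))\<^sup>2"
      unfolding power2_eq_square times_divide_times_eq by (simp only:)
  qed
  also have "1 / fact k * (1 / fact k) * (\<Sum>tr\<in>?P. \<Sum>uv\<in>?P. (t ^ Suc k / (1 + t) ^ (2 * k))\<^sup>2) =
      (tree_density t k)\<^sup>2"
    by (simp add: tree_density_def power2_eq_square ac_simps)
  finally have lim: "?F \<longlonglongrightarrow> (tree_density t k)\<^sup>2" .
  have "(\<lambda>n. mean n (\<lambda>x. real (treecount n k x)) / real n * (1 / real n)) \<longlonglongrightarrow> tree_density t k * 0"
    by (intro tendsto_mult mean_treecount_limit[OF reg k] lim_1_over_n)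
  from tendsto_add[OF this lim]
  have "(\<lambda>n. mean n (\<lambda>x. real (treecount n k x)) / real n * (1 / real n) + ?F n) \<longlonglongrightarrow> (tree_density t k)\<^sup>2"
    by simp
  then show ?thesis
  proof (rule Lim_transform_eventually)
    show "\<forall>\<^sub>F n in sequentially. mean n (\<lambda>x. real (treecount n k x)) / real n * (1 / real n) + ?F n =
        mean n (\<lambda>x. (real (treecount n k x))\<^sup>2) / (real n)\<^sup>2"
      using eventually_gt_at_top[of 0]
    proof eventually_elim
      case (elim n)
      have "?w n (?c tr + ?c uv) * ?w n (?d tr + ?d uv) = (real n ^ k * real n ^ k) / (real n)\<^sup>2 *
          (?e n (?c tr + ?c uv) * ?e n (?d tr + ?d uv)) / ?S n"
        if "tr \<in> ?P" "uv \<in> ?P" for tr uv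
      proof -
        have "(2 * k - (?c tr + ?c uv)) + (2 * k - (?d tr + ?d uv)) = 2 * k - 2"
          using cd[OF that(1)] cd[OF that(2)] le[of tr uv] by linarith
        then have "real n ^ (2 * k - (?c tr + ?c uv)) * real n ^ (2 * k - (?d tr + ?d uv)) = real n ^ (2 * k - 2)"
          by (simp add: power_add[symmetric])
        also have "\<dots> = (real n ^ k * real n ^ k) / (real n)\<^sup>2"
          using elim k by (simp add: power_diff mult_2 power_add)
        finally have E: "real n ^ (2 * k - (?c tr + ?c uv)) * real n ^ (2 * k - (?d tr + ?d uv)) =
          (real n ^ k * real n ^ k) / (real n)\<^sup>2" .
        show ?thesis
          unfolding E[symmetric] power2_eq_square[of "real (stirling n (m n))"] times_divide_times_eq
          by (simp only: ac_simps)
      qed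
      then have "(\<Sum>tr\<in>?P. \<Sum>uv\<in>?P. ?w n (?c tr + ?c uv) * ?w n (?d tr + ?d uv)) =
          (\<Sum>tr\<in>?P. \<Sum>uv\<in>?P. (real n ^ k * real n ^ k) / (real n)\<^sup>2 *
          (?e n (?c tr + ?c uv) * ?e n (?d tr + ?d uv)) / ?S n)"
        by (intro sum.cong refl)
      also have "\<dots> = (real n ^ k * real n ^ k) / (real n)\<^sup>2 * (\<Sum>tr\<in>?P. \<Sum>uv\<in>?P.
          ?e n (?c tr + ?c uv) * ?e n (?d tr + ?d uv)) / ?S n"
        by (simp only: sum_distrib_left sum_divide_distrib)
      finally have DS: "(\<Sum>tr\<in>?P. \<Sum>uv\<in>?P. ?w n (?c tr + ?c uv) * ?w n (?d tr + ?d uv)) =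
          (real n ^ k * real n ^ k) / (real n)\<^sup>2 * (\<Sum>tr\<in>?P. \<Sum>uv\<in>?P.
          ?e n (?c tr + ?c uv) * ?e n (?d tr + ?d uv)) / ?S n" .
      have F: "?F n = real (n choose k) * real ((n - k) choose k) * (\<Sum>tr\<in>?P. \<Sum>uv\<in>?P.
          ?e n (?c tr + ?c uv) * ?e n (?d tr + ?d uv)) / ?S n / (real n)\<^sup>2"
        unfolding DS using elim by (simp add: ac_simps)
      show ?case
        unfolding F mean_treecount_square[OF k] add_divide_distrib
        by (simp add: power2_eq_square)
    qed
  qed
qed


definition tree_sum :: "nat \<Rightarrow> nat \<Rightarrow> (nat \<Rightarrow> nat) \<times> (nat \<Rightarrow> nat) \<Rightarrow> real" where
  "tree_sum K n x = (\<Sum>k = 1..K. real (treecount n k x)) / real n"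

definition cycle_fraction :: "nat \<Rightarrow> (nat \<Rightarrow> nat) \<times> (nat \<Rightarrow> nat) \<Rightarrow> real" where
  "cycle_fraction n x = real (ncyc {1..n} (inv (fst x) \<circ> snd x)) / real n"

text \<open>
  Convergence in mean square, from the first two moments for each size.
\<close>

lemma tree_sum_deviation:
  assumes reg: "regime t (\<lambda>n. n) m"
  shows "(\<lambda>n. mean n (\<lambda>x. (tree_sum K n x - (\<Sum>k = 1..K. tree_density t k))\<^sup>2)) \<longlonglongrightarrow> 0"
proof -
  let ?\<tau> = "tree_density t"
  let ?X = "\<lambda>n k x. real (treecount n k x) / real n"
  have dev: "(\<lambda>n. mean n (\<lambda>x. (?X n k x - ?\<tau> k)\<^sup>2)) \<longlonglongrightarrow> 0" if k: "k \<in> {1..K}" for k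
  proof -
    have "mean n (\<lambda>x. (?X n k x - ?\<tau> k)\<^sup>2) = mean n (\<lambda>x. (real (treecount n k x))\<^sup>2) / (real n)\<^sup>2
      + (- 2 * ?\<tau> k) * (mean n (\<lambda>x. real (treecount n k x)) / real n) + (?\<tau> k)\<^sup>2" for n
    proof -
      have "mean n (\<lambda>x. (?X n k x - ?\<tau> k)\<^sup>2) = mean n (\<lambda>x. (1 / (real n)\<^sup>2 * (real (treecount n k x))\<^sup>2
          + (- 2 * ?\<tau> k / real n) * real (treecount n k x)) + (?\<tau> k)\<^sup>2)"
        by (rule mean_cong) (simp add: power2_diff power_divide)
      then show ?thesis unfolding mean_add mean_cmult by simp
    qed
    moreover have "(\<lambda>n. mean n (\<lambda>x. (real (treecount n k x))\<^sup>2) / (real n)\<^sup>2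
        + (- 2 * ?\<tau> k) * (mean n (\<lambda>x. real (treecount n k x)) / real n) + (?\<tau> k)\<^sup>2) \<longlonglongrightarrow>
        (?\<tau> k)\<^sup>2 + (- 2 * ?\<tau> k) * ?\<tau> k + (?\<tau> k)\<^sup>2"
      using k by (intro tendsto_add tendsto_mult tendsto_const mean_treecount_square_limit[OF reg]
          mean_treecount_limit[OF reg]) auto
    ultimately show ?thesis by (simp add: power2_eq_square)
  qed
  have upper: "mean n (\<lambda>x. (tree_sum K n x - (\<Sum>k = 1..K. ?\<tau> k))\<^sup>2)
    \<le> real K * (\<Sum>k = 1..K. mean n (\<lambda>x. (?X n k x - ?\<tau> k)\<^sup>2))" for n
  proof -
    have "(tree_sum K n x - (\<Sum>k = 1..K. ?\<tau> k))\<^sup>2 \<le> real K * (\<Sum>k = 1..K. (?X n k x - ?\<tau> k)\<^sup>2)" for x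
    proof -
      have "tree_sum K n x - (\<Sum>k = 1..K. ?\<tau> k) = (\<Sum>k = 1..K. ?X n k x - ?\<tau> k)"
        by (simp add: tree_sum_def sum_divide_distrib sum_subtractf)
      then show ?thesis
        using sum_squared_le_sum_of_squares[of "\<lambda>k. ?X n k x - ?\<tau> k" "{1..K}"] by (simp add: mult.commute)
    qed
    then have "mean n (\<lambda>x. (tree_sum K n x - (\<Sum>k = 1..K. ?\<tau> k))\<^sup>2)
      \<le> mean n (\<lambda>x. real K * (\<Sum>k = 1..K. (?X n k x - ?\<tau> k)\<^sup>2))" by (intro mean_mono)
    then show ?thesis unfolding mean_cmult mean_sum .
  qed
  have "(\<lambda>n. real K * (\<Sum>k = 1..K. mean n (\<lambda>x. (?X n k x - ?\<tau> k)\<^sup>2))) \<longlonglongrightarrow> real K * (\<Sum>k = 1..K. 0)"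
    by (intro tendsto_mult tendsto_const tendsto_sum dev)
  then have lim: "(\<lambda>n. real K * (\<Sum>k = 1..K. mean n (\<lambda>x. (?X n k x - ?\<tau> k)\<^sup>2))) \<longlonglongrightarrow> 0" by simp
  have nonneg: "0 \<le> mean n (\<lambda>x. (tree_sum K n x - (\<Sum>k = 1..K. ?\<tau> k))\<^sup>2)" for n
    by (rule Bochner_Integration.integral_nonneg) simp
  show ?thesis
    by (rule real_tendsto_sandwich[OF always_eventually always_eventually tendsto_const lim])
      (intro allI nonneg, intro allI upper)
qed

lemma tree_sum_mean_limit:
  assumes reg: "regime t (\<lambda>n. n) m"
  shows "(\<lambda>n. mean n (tree_sum K n)) \<longlonglongrightarrow> (\<Sum>k = 1..K. tree_density t k)"
proof -
  have "mean n (tree_sum K n) = (\<Sum>k = 1..K. mean n (\<lambda>x. real (treecount n k x)) / real n)" for n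
  proof -
    have "mean n (tree_sum K n) = mean n (\<lambda>x. 1 / real n * (\<Sum>k = 1..K. real (treecount n k x)))"
      by (simp add: tree_sum_def[abs_def])
    then show ?thesis unfolding mean_cmult mean_sum by (simp add: sum_divide_distrib)
  qed
  then show ?thesis using mean_treecount_limit[OF reg] by (auto intro!: tendsto_sum)
qed

lemma tree_sum_le_cycle_fraction:
  assumes "x \<in> pairs n"
  shows "tree_sum K n x \<le> cycle_fraction n x"
proof -
  obtain s p where x: "x = (s, p)" by (cases x)
  have "(\<Sum>k = 1..K. treecount n k (s, p)) \<le> ncyc {1..n} (inv s \<circ> p)"
    using assms x by (intro sum_treecount_le_ncyc) (auto simp: perms_def)
  then have "(\<Sum>k = 1..K. real (treecount n k (s, p))) \<le> real (ncyc {1..n} (inv s \<circ> p))"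
    unfolding of_nat_sum[symmetric] of_nat_le_iff .
  then show ?thesis unfolding tree_sum_def cycle_fraction_def x fst_conv snd_conv by (intro divide_right_mono) auto
qed

text \<open>
  Lollipops of bounded length are rare in every regime: for fixed \<open>L\<close> the bound of \<open>mean_bad_points_le\<close>
  stays bounded as \<open>n\<close> grows, and it is divided by \<open>n\<close> here.
\<close>

lemma mean_cycle_fraction_le:
  assumes reg: "regime t (\<lambda>n. n) m" and K: "0 < K"
  shows "\<forall>\<^sub>F n in sequentially. mean n (cycle_fraction n) \<le> mean n (tree_sum K n) + 2 / real K"
proof -
  define \<rho> where "\<rho> = 1 / t + 1"
  define C where "C = (\<Sum>L = 1..2 * K. 6 * real L * \<rho> ^ Suc L)"
  have "\<forall>\<^sub>F n in sequentially. real n * real (stirling n (Suc (m n))) / real (stirling n (m n)) < \<rho>"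
    using stirling_ratio_limit[OF reg] by (rule order_tendstoD) (simp add: \<rho>_def)
  moreover have "\<forall>\<^sub>F n in sequentially. C * real K < real n"
    using filterlim_real_sequentially by (simp add: filterlim_at_top_dense)
  ultimately show ?thesis using eventually_gt_at_top[of 0]
  proof eventually_elim
    case (elim n)
    let ?B = "\<lambda>x. \<Sum>L = 1..2 * K. real (card (bad_points {1..n} L (perm_pair (fst x) (snd x))))"
    have "mean n (cycle_fraction n) \<le> mean n (\<lambda>x. (tree_sum K n x + 1 / real K) + 1 / real n * ?B x)"
    proof (rule mean_mono)
      fix x assume x: "x \<in> pairs n"
      obtain s p where e: "x = (s, p)" by (cases x)
      have "real (ncyc {1..n} (inv s \<circ> p)) \<le> (\<Sum>k = 1..K. real (treecount n k (s, p))) + real n / real K + ?B (s, p)"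
        using ncyc_le_sum_treecount[of s n p K] x e K by (auto simp: perms_def)
      then have "real (ncyc {1..n} (inv s \<circ> p)) / real n \<le>
          ((\<Sum>k = 1..K. real (treecount n k (s, p))) + real n / real K + ?B (s, p)) / real n"
        by (rule divide_right_mono) simp
      also have "\<dots> = tree_sum K n x + 1 / real K + 1 / real n * ?B x"
        using elim by (simp add: e tree_sum_def add_divide_distrib)
      finally show "cycle_fraction n x \<le> (tree_sum K n x + 1 / real K) + 1 / real n * ?B x"
        by (simp add: cycle_fraction_def e)
    qed
    also have "\<dots> = mean n (tree_sum K n) + 1 / real K + 1 / real n * mean n ?B"
      unfolding mean_add mean_cmult by simp
    also have "mean n ?B \<le> C"
      unfolding mean_sum C_def using elim by (intro sum_mono mean_bad_points_le) auto
    then have "1 / real n * mean n ?B \<le> 1 / real n * C" by (intro mult_left_mono) auto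
    also have "1 / real n * C \<le> 1 / real K" using elim K by (simp add: field_simps)
    finally show ?case by simp
  qed
qed

text \<open>
  For each \<open>K\<close> the expectation is eventually within \<open>3 / K\<close> of the partial sum of the tree densities. So
  the expectations form a Cauchy sequence, and their limit is the sum of the series.
\<close>

lemma cycle_fraction_limit:
  assumes reg: "regime t (\<lambda>n. n) m"
  obtains \<Lambda> where "(\<lambda>n. mean n (cycle_fraction n)) \<longlonglongrightarrow> \<Lambda>" "(\<lambda>K. \<Sum>k = 1..K. tree_density t k) \<longlonglongrightarrow> \<Lambda>"
proof -
  let ?c = "\<lambda>n. mean n (cycle_fraction n)"
  let ?s = "\<lambda>K. \<Sum>k = 1..K. tree_density t k"
  have near: "\<forall>\<^sub>F n in sequentially. \<bar>?c n - ?s K\<bar> \<le> 3 / real K" if K: "0 < K" for K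
  proof -
    have "\<forall>\<^sub>F n in sequentially. ?s K - 1 / real K < mean n (tree_sum K n)"
      using tree_sum_mean_limit[OF reg] K by (intro order_tendstoD) auto
    moreover have "\<forall>\<^sub>F n in sequentially. mean n (tree_sum K n) < ?s K + 1 / real K"
      using tree_sum_mean_limit[OF reg] K by (intro order_tendstoD) auto
    ultimately show ?thesis using mean_cycle_fraction_le[OF reg K]
    proof eventually_elim
      case (elim n)
      have "mean n (tree_sum K n) \<le> ?c n" using tree_sum_le_cycle_fraction by (rule mean_mono)
      moreover have "3 / real K = 1 / real K + 2 / real K" "0 < 1 / real K" using K by auto
      ultimately show ?case using elim by linarith
    qed
  qed
  have "Cauchy ?c"
  proof (rule metric_CauchyI)
    fix e :: real assume e: "0 < e"
    obtain K :: nat where K: "6 / e < real K" using reals_Archimedean2 by blast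
    have "0 < 6 / e" using e by simp
    then have K0: "0 < real K" using K by linarith
    have Ke: "3 / real K + 3 / real K < e" using K K0 e by (simp add: field_simps)
    obtain N where N: "\<And>n. N \<le> n \<Longrightarrow> \<bar>?c n - ?s K\<bar> \<le> 3 / real K"
      using near[of K] K0 unfolding eventually_sequentially by auto
    have "dist (?c i) (?c j) < e" if "N \<le> i" "N \<le> j" for i j
      using N[OF that(1)] N[OF that(2)] Ke by (simp add: dist_real_def)
    then show "\<exists>M. \<forall>i\<ge>M. \<forall>j\<ge>M. dist (?c i) (?c j) < e" by blast
  qed
  then obtain \<Lambda> where \<Lambda>: "?c \<longlonglongrightarrow> \<Lambda>" using Cauchy_convergent convergent_def by blast
  have bnd: "\<bar>\<Lambda> - ?s K\<bar> \<le> 3 / real K" if "0 < K" for K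
  proof (rule tendsto_upperbound[OF _ near[OF that]])
    show "(\<lambda>n. \<bar>?c n - ?s K\<bar>) \<longlonglongrightarrow> \<bar>\<Lambda> - ?s K\<bar>" by (intro tendsto_intros \<Lambda>)
  qed simp
  have "?s \<longlonglongrightarrow> \<Lambda>"
  proof (rule LIMSEQ_I)
    fix r :: real assume r: "0 < r"
    obtain N :: nat where N: "3 / r < real N" using reals_Archimedean2 by blast
    have "norm (?s K - \<Lambda>) < r" if "N \<le> K" for K
    proof -
      have K: "3 / r < real K" using N that by linarith
      have "0 < 3 / r" using r by simp
      then have "0 < real K" using K by linarith
      moreover from this have "3 / real K < r" using K r by (simp add: field_simps)
      ultimately show ?thesis using bnd[of K] by (simp add: abs_minus_commute)
    qed
    then show "\<exists>no. \<forall>n\<ge>no. norm (?s n - \<Lambda>) < r" by blast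
  qed
  then show ?thesis using that \<Lambda> by blast
qed

lemma gromov_product_cycle_fraction:
  assumes "x \<in> pairs n" "0 < n"
  shows "gromov_product n id (fst x) (snd x) = real n * ((1 - 2 * (real (m n) / real n) + cycle_fraction n x) / 2)"
proof -
  have x: "fst x \<in> perms {1..n} (m n)" "snd x \<in> perms {1..n} (m n)" using assms by auto
  show ?thesis unfolding gromov_product_ncyc[OF x] cycle_fraction_def using assms(2) by (simp add: field_simps)
qed

lemma mean_gromov_product:
  assumes "0 < n"
  shows "mean n (\<lambda>(\<sigma>, \<pi>). gromov_product n id \<sigma> \<pi>) =
    real n * ((1 - 2 * (real (m n) / real n) + mean n (cycle_fraction n)) / 2)"
proof -
  have "mean n (\<lambda>(\<sigma>, \<pi>). gromov_product n id \<sigma> \<pi>) =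
    mean n (\<lambda>x. real n * (1 - 2 * (real (m n) / real n)) / 2 + real n / 2 * cycle_fraction n x)"
    by (rule mean_cong) (use gromov_product_cycle_fraction assms in \<open>auto simp: case_prod_beta algebra_simps add_divide_distrib diff_divide_distrib\<close>)
  also have "\<dots> = real n * (1 - 2 * (real (m n) / real n)) / 2 + real n / 2 * mean n (cycle_fraction n)"
    unfolding mean_add mean_cmult by simp
  also have "\<dots> = real n * ((1 - 2 * (real (m n) / real n) + mean n (cycle_fraction n)) / 2)"
  proof -
    have "r * (1 - 2 * u) / 2 + r / 2 * M = r * ((1 - 2 * u + M) / 2)" for r u M :: real
      by (simp add: field_simps)
    then show ?thesis .
  qed
  finally show ?thesis .
qed

lemma regime_density:
  assumes "regime t (\<lambda>n. n) m"
  shows "(\<lambda>n. real (m n) / real n) \<longlonglongrightarrow> cycle_density t"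
  using assms by (simp add: regime_def)

text \<open>
  In the subcritical phase the expected Gromov product is bounded, which determines the number of cycles
  of the product to first order and thereby the sum of the tree densities.
\<close>

lemma subcritical_tree_sum:
  assumes t: "1 < t" "cycle_density t = 1 - a"
  shows "(\<lambda>K. \<Sum>k = 1..K. tree_density t k) \<longlonglongrightarrow> 2 * cycle_density t - 1"
proof -
  have reg: "regime t (\<lambda>n. n) m" using sphere_cycles_regime[OF a] t by simp
  obtain \<Lambda> where \<Lambda>: "(\<lambda>n. mean n (cycle_fraction n)) \<longlonglongrightarrow> \<Lambda>" "(\<lambda>K. \<Sum>k = 1..K. tree_density t k) \<longlonglongrightarrow> \<Lambda>"
    by (rule cycle_fraction_limit[OF reg])
  obtain C where "0 < C" and C: "\<forall>\<^sub>F n in sequentially. mean n (\<lambda>x. real (defect n x)) \<le> C"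
    by (rule mean_defect_bounded[OF t])
  let ?g = "\<lambda>n. (1 - 2 * (real (m n) / real n) + mean n (cycle_fraction n)) / 2"
  have lim: "?g \<longlonglongrightarrow> (1 - 2 * cycle_density t + \<Lambda>) / 2"
    by (intro tendsto_intros \<Lambda>(1) regime_density[OF reg]) simp
  have "?g \<longlonglongrightarrow> 0"
  proof (rule real_tendsto_sandwich)
    show "\<forall>\<^sub>F n in sequentially. 0 \<le> ?g n"
      using eventually_gt_at_top[of 0]
    proof eventually_elim
      case (elim n)
      have "mean n (\<lambda>x. 0) \<le> mean n (\<lambda>(\<sigma>, \<pi>). gromov_product n id \<sigma> \<pi>)"
        using gromov_product_range(2) by (intro mean_mono) (auto simp: case_prod_beta)
      then show ?case unfolding mean_gromov_product[OF elim] using elim by (simp add: zero_le_mult_iff)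
    qed
    show "\<forall>\<^sub>F n in sequentially. ?g n \<le> C * (1 / real n)"
      using C eventually_gt_at_top[of 0]
    proof eventually_elim
      case (elim n)
      have "mean n (\<lambda>(\<sigma>, \<pi>). gromov_product n id \<sigma> \<pi>) \<le> mean n (\<lambda>x. real (defect n x))"
        using gromov_product_le_defect(1) by (intro mean_mono) (auto simp: case_prod_beta)
      then have "real n * ?g n \<le> C" unfolding mean_gromov_product[OF elim(2)] using elim(1) by linarith
      then show ?case using elim(2) by (simp add: field_simps)
    qed
    show "(\<lambda>n. C * (1 / real n)) \<longlonglongrightarrow> 0" by real_asymp
  qed simp
  then have "(1 - 2 * cycle_density t + \<Lambda>) / 2 = 0" by (rule LIMSEQ_unique[OF lim])
  then have "\<Lambda> = 2 * cycle_density t - 1" by simp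
  then show ?thesis using \<Lambda>(2) by simp
qed

end

text \<open>
  The expression \<open>t / (1 + t)\<^sup>2\<close> is invariant under \<open>t \<mapsto> 1 / t\<close>.
\<close>

lemma tree_density_dual:
  assumes "0 < t"
  shows "tree_density t k = t\<^sup>2 * tree_density (1 / t) k"
proof -
  have "t ^ Suc k / (1 + t) ^ (2 * k) = t\<^sup>2 * ((1 / t) ^ Suc k / (1 + 1 / t) ^ (2 * k))"
  proof -
    have e: "1 + 1 / t = (1 + t) / t" using assms by (simp add: field_simps)
    show ?thesis
      using assms unfolding e by (simp add: power_divide field_simps power2_eq_square power_mult)
  qed
  then show ?thesis by (simp add: tree_density_def)
qed

text \<open>
  By duality this is \<open>t\<^sup>2\<close> times the value at \<open>1 / t\<close>, which is subcritical.
\<close>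

lemma supercritical_tree_sum:
  assumes t: "0 < t" "t < 1"
  shows "(\<lambda>K. \<Sum>k = 1..K. tree_density t k) \<longlonglongrightarrow> 2 * t * ln (1 + t) - t\<^sup>2"
proof -
  define s where "s = 1 / t"
  have s: "1 < s" "0 < s" using t by (auto simp: s_def)
  interpret dual: sphere_pair "1 - cycle_density s"
    using cycle_density_range[OF s(2)] by unfold_locales auto
  have "(\<lambda>K. t\<^sup>2 * (\<Sum>k = 1..K. tree_density s k)) \<longlonglongrightarrow> t\<^sup>2 * (2 * cycle_density s - 1)"
    using dual.subcritical_tree_sum[OF s(1)] by (intro tendsto_mult tendsto_const) simp
  moreover have "t\<^sup>2 * (2 * cycle_density s - 1) = 2 * t * ln (1 + t) - t\<^sup>2"
    using t by (simp add: cycle_density_def s_def power2_eq_square field_simps)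
  moreover have "t\<^sup>2 * (\<Sum>k = 1..K. tree_density s k) = (\<Sum>k = 1..K. tree_density t k)" for K
    unfolding sum_distrib_left s_def using tree_density_dual[OF t(1)] by simp
  ultimately show ?thesis by simp
qed

text \<open>
  The right-hand side is \<open>1 - t\<^sup>2 + 2 t ln t\<close>. It vanishes at \<open>t = 1\<close>, and its derivative
  \<open>2 (ln t + 1 - t)\<close> is negative on the open interval.
\<close>

lemma excess_pos:
  assumes t: "0 < t" "t < (1::real)"
  shows "0 < 1 - 2 * cycle_density t + (2 * t * ln (1 + t) - t\<^sup>2)"
proof -
  have l: "ln (1 + 1 / t) = ln (1 + t) - ln t"
  proof -
    have "1 + 1 / t = (1 + t) / t" using t by (simp add: field_simps)
    then show ?thesis using t by (simp add: ln_div)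
  qed
  have e: "1 - 2 * cycle_density t + (2 * t * ln (1 + t) - t\<^sup>2) = 1 + 2 * t * ln t - t\<^sup>2"
    unfolding cycle_density_def l by (simp add: algebra_simps)
  have "(\<lambda>x. 1 + 2 * x * ln x - x\<^sup>2) 1 < (\<lambda>x. 1 + 2 * x * ln x - x\<^sup>2) t"
  proof (rule DERIV_neg_imp_decreasing_open[OF t(2)])
    fix x :: real assume x: "t < x" "x < 1"
    have x0: "0 < x" using x t by simp
    have "((\<lambda>x. 1 + 2 * x * ln x - x\<^sup>2) has_real_derivative (2 * ln x + 2 - 2 * x)) (at x)"
      using x0 by (auto intro!: derivative_eq_intros simp: field_simps)
    moreover have "ln x \<noteq> x - 1" using ln_eq_minus_one[OF x0] x by auto
    then have "2 * ln x + 2 - 2 * x < 0" using ln_le_minus_one[OF x0] by linarith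
    ultimately show "\<exists>y. ((\<lambda>x. 1 + 2 * x * ln x - x\<^sup>2) has_real_derivative y) (at x) \<and> y < 0" by blast
  next
    show "continuous_on {t..1} (\<lambda>x. 1 + 2 * x * ln x - x\<^sup>2)"
      using t by (intro continuous_intros) auto
  qed
  then show ?thesis unfolding e by simp
qed

context sphere_pair
begin

text \<open>
  The first claim is the limit of the cycle fraction. For the second, the Gromov product is bounded from
  below by means of the tree components with at most \<open>K\<close> points, whose number concentrates by Chebyshev's
  inequality; \<open>K\<close> is chosen such that the larger components are negligible.
\<close>

lemma supercritical:
  assumes t: "0 < t" "t < 1" "cycle_density t = 1 - a"
  shows "\<exists>\<delta>::real. 0 < \<delta> \<and>
      (\<lambda>n. mean n (\<lambda>(\<sigma>, \<pi>). gromov_product n id \<sigma> \<pi>)) \<sim>[sequentially] (\<lambda>n. \<delta> * real n)"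
    and "\<exists>\<delta>'::real. 0 < \<delta>' \<and> (\<lambda>n. measure_pmf.prob (two_uniform a n)
       {(\<sigma>, \<pi>). \<not> (\<exists>g. geodesic n \<sigma> g \<pi> \<and> dist_to_walk n id \<sigma> g < \<delta>' * real n)}) \<longlonglongrightarrow> 1"
proof -
  have reg: "regime t (\<lambda>n. n) m" using sphere_cycles_regime[OF a] t by simp
  define \<Lambda> where "\<Lambda> = 2 * t * ln (1 + t) - t\<^sup>2"
  let ?s = "\<lambda>K. \<Sum>k = 1..K. tree_density t k"
  have s: "?s \<longlonglongrightarrow> \<Lambda>" unfolding \<Lambda>_def by (rule supercritical_tree_sum[OF t(1,2)])
  have c: "(\<lambda>n. mean n (cycle_fraction n)) \<longlonglongrightarrow> \<Lambda>"
  proof -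
    obtain \<Lambda>' where L: "(\<lambda>n. mean n (cycle_fraction n)) \<longlonglongrightarrow> \<Lambda>'" "?s \<longlonglongrightarrow> \<Lambda>'"
      by (rule cycle_fraction_limit[OF reg])
    then show ?thesis using LIMSEQ_unique[OF s L(2)] by simp
  qed
  define \<delta> where "\<delta> = (1 - 2 * cycle_density t + \<Lambda>) / 2"
  have \<delta>: "0 < \<delta>" using excess_pos[OF t(1,2)] by (simp add: \<delta>_def \<Lambda>_def)
  show "\<exists>\<delta>::real. 0 < \<delta> \<and>
      (\<lambda>n. mean n (\<lambda>(\<sigma>, \<pi>). gromov_product n id \<sigma> \<pi>)) \<sim>[sequentially] (\<lambda>n. \<delta> * real n)"
  proof (intro exI[of _ \<delta>] conjI \<delta> asymp_equivI')
    have "(\<lambda>n. (1 - 2 * (real (m n) / real n) + mean n (cycle_fraction n)) / 2 / \<delta>) \<longlonglongrightarrow> \<delta> / \<delta>"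
      unfolding \<delta>_def[symmetric] using \<delta> unfolding \<delta>_def
      by (intro tendsto_intros c regime_density[OF reg]) auto
    then have "(\<lambda>n. (1 - 2 * (real (m n) / real n) + mean n (cycle_fraction n)) / 2 / \<delta>) \<longlonglongrightarrow> 1" using \<delta> by simp
    then show "(\<lambda>n. mean n (\<lambda>(\<sigma>, \<pi>). gromov_product n id \<sigma> \<pi>) / (\<delta> * real n)) \<longlonglongrightarrow> 1"
    proof (rule Lim_transform_eventually)
      show "\<forall>\<^sub>F n in sequentially. (1 - 2 * (real (m n) / real n) + mean n (cycle_fraction n)) / 2 / \<delta> =
          mean n (\<lambda>(\<sigma>, \<pi>). gromov_product n id \<sigma> \<pi>) / (\<delta> * real n)"
        using eventually_gt_at_top[of 0]
        by eventually_elim (simp add: mean_gromov_product)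
    qed
  qed
  \<comment> \<open>Errors of this size are allowed in the tree sum, in its truncation at \<open>K\<close> and in the density of
    cycles. With \<open>\<delta> = 4 * \<epsilon>\<close> they leave at least \<open>\<epsilon>\<close>, which
    serves as \<open>\<delta>'\<close>.\<close>
  define \<epsilon> where "\<epsilon> = \<delta> / 4"
  have \<epsilon>: "0 < \<epsilon>" using \<delta> by (simp add: \<epsilon>_def)
  have "\<forall>\<^sub>F K in sequentially. \<Lambda> - \<epsilon> < ?s K" using s \<epsilon> by (intro order_tendstoD) auto
  then obtain K where K: "\<Lambda> - \<epsilon> < ?s K" unfolding eventually_sequentially by blast
  let ?Z = "\<lambda>n x. (tree_sum K n x - ?s K)\<^sup>2"
  let ?A = "\<lambda>n. {(\<sigma>, \<pi>). \<not> (\<exists>g. geodesic n \<sigma> g \<pi> \<and> dist_to_walk n id \<sigma> g < \<epsilon> * real n)}"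
  have dens: "\<forall>\<^sub>F n in sequentially. real (m n) / real n < cycle_density t + \<epsilon>"
    using regime_density[OF reg] \<epsilon> by (intro order_tendstoD) auto
  have "(\<lambda>n. measure_pmf.prob (two_uniform a n) (?A n)) \<longlonglongrightarrow> 1"
  proof (rule real_tendsto_sandwich)
    show "\<forall>\<^sub>F n in sequentially. 1 - mean n (?Z n) / \<epsilon>\<^sup>2 \<le> measure_pmf.prob (two_uniform a n) (?A n)"
      using dens eventually_gt_at_top[of 0]
    proof eventually_elim
      case (elim n)
      show ?case
      proof (rule markov)
        show "0 < \<epsilon>\<^sup>2" using \<epsilon> by simp
        fix x assume x: "x \<in> pairs n" and Z: "?Z n x \<le> \<epsilon>\<^sup>2"
        obtain \<sigma> \<pi> where e: "x = (\<sigma>, \<pi>)" by (cases x)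
        have p: "\<sigma> permutes {1..n}" "\<pi> permutes {1..n}" using x e by (auto simp: perms_def)
        have "\<bar>tree_sum K n x - ?s K\<bar> \<le> \<epsilon>" using Z \<epsilon> by (simp add: abs_le_square_iff[symmetric])
        then have "\<Lambda> - 2 * \<epsilon> \<le> cycle_fraction n x" using K tree_sum_le_cycle_fraction[OF x, of K] by linarith
        moreover have "1 - 2 * cycle_density t + \<Lambda> = 8 * \<epsilon>" by (simp add: \<epsilon>_def \<delta>_def)
        ultimately have "2 * \<epsilon> \<le> 1 - 2 * (real (m n) / real n) + cycle_fraction n x"
          using elim(1) \<epsilon> by linarith
        then have "real n * \<epsilon> \<le> real n * ((1 - 2 * (real (m n) / real n) + cycle_fraction n x) / 2)"
          by (intro mult_left_mono) auto
        then have "\<epsilon> * real n \<le> gromov_product n id \<sigma> \<pi>"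
          using gromov_product_cycle_fraction[OF x elim(2)] by (simp add: e mult.commute)
        then have "\<epsilon> * real n \<le> dist_to_walk n id \<sigma> g" if "geodesic n \<sigma> g \<pi>" for g
          using gromov_product_le_dist_to_geodesic[OF p that] by linarith
        then show "x \<in> ?A n" unfolding e by force
      qed simp
    qed
    have "(\<lambda>n. 1 - mean n (?Z n) / \<epsilon>\<^sup>2) \<longlonglongrightarrow> 1 - 0 / \<epsilon>\<^sup>2"
      using \<epsilon> by (intro tendsto_intros tree_sum_deviation[OF reg]) auto
    then show "(\<lambda>n. 1 - mean n (?Z n) / \<epsilon>\<^sup>2) \<longlonglongrightarrow> 1" by simp
  qed auto
  then show "\<exists>\<delta>'::real. 0 < \<delta>' \<and> (\<lambda>n. measure_pmf.prob (two_uniform a n)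
       {(\<sigma>, \<pi>). \<not> (\<exists>g. geodesic n \<sigma> g \<pi> \<and> dist_to_walk n id \<sigma> g < \<delta>' * real n)}) \<longlonglongrightarrow> 1"
    using \<epsilon> by blast
qed

end

theorem theorem8:
  fixes a :: real
  assumes "0 < a" and "a < 1"
  shows
    "(a < 1 - ln 2 \<longrightarrow>
       (\<exists>\<delta>::real. 0 < \<delta> \<and>
          (\<forall>n\<ge>2. measure_pmf.expectation (two_uniform a n) (\<lambda>(\<sigma>, \<pi>). gromov_product n id \<sigma> \<pi>)
                     \<le> \<delta> * (ln (real n))\<^sup>2) \<and>
          (\<lambda>n. measure_pmf.prob (two_uniform a n)
                 {(\<sigma>, \<pi>). \<exists>g. geodesic n \<sigma> g \<pi> \<and> dist_to_walk n id \<sigma> g \<le> \<delta> * (ln (real n))\<^sup>2})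
            \<longlonglongrightarrow> 1)) \<and>
     (a > 1 - ln 2 \<longrightarrow>
       (\<exists>\<delta>::real. 0 < \<delta> \<and>
          (\<lambda>n. measure_pmf.expectation (two_uniform a n) (\<lambda>(\<sigma>, \<pi>). gromov_product n id \<sigma> \<pi>))
            \<sim>[sequentially] (\<lambda>n. \<delta> * real n)) \<and>
       (\<exists>\<delta>'::real. 0 < \<delta>' \<and>
          (\<lambda>n. measure_pmf.prob (two_uniform a n)
                 {(\<sigma>, \<pi>). \<not> (\<exists>g. geodesic n \<sigma> g \<pi> \<and> dist_to_walk n id \<sigma> g < \<delta>' * real n)})
            \<longlonglongrightarrow> 1))"
proof -
  interpret sphere_pair a using assms by unfold_locales
  obtain t where t: "0 < t" "cycle_density t = 1 - a"
    using cycle_density_surj[of "1 - a"] assms by auto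
  have "1 < t" if "a < 1 - ln 2"
  proof (rule ccontr)
    assume "\<not> 1 < t"
    then have "cycle_density t \<le> cycle_density 1"
      using cycle_density_strict_mono[OF t(1), of 1] by (cases "t = 1") auto
    then show False using that t(2) by (simp add: cycle_density_one)
  qed
  moreover have "t < 1" if "1 - ln 2 < a"
  proof (rule ccontr)
    assume "\<not> t < 1"
    then have "cycle_density 1 \<le> cycle_density t"
      using cycle_density_strict_mono[of 1 t] by (cases "t = 1") auto
    then show False using that t(2) by (simp add: cycle_density_one)
  qed
  ultimately show ?thesis
    using subcritical[OF _ t(2)] supercritical[OF t(1) _ t(2)] by blast
qed

end
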